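(* Let $\Omega\subset\mathbb{R}^n$ be a bounded domain and suppose that a nonparametric minimal submanifold $\Sigma$ is the graph of a map $f:\Omega\subset\mathbb{R}^n\to\mathbb{R}^m$. Then $\Sigma$ is stable if $|\wedge^2 df|(x)\le\frac{1}{n-1}$ for all $x\in\Omega$.
   Context: A $C^2$ vector-valued function $f=(f^1,\dots,f^m):\Omega\to\mathbb{R}^m$ on a bounded domain $\Omega\subset\mathbb{R}^n$ is a solution to the minimal surface system if $$\sum_{i,j=1}^n\frac{\partial}{\partial x^i}\left(\sqrt{g}\,g^{ij}\frac{\partial f^\alpha}{\partial x^j}\right)=0\quad\text{for each }\alpha=1,\dots,m,$$ where $g_{ij}=\delta_{ij}+\sum_\alpha\frac{\partial f^\alpha}{\partial x^i}\frac{\partial f^\alpha}{\partial x^j}$, $g=\det(g_{ij})$ and $(g^{ij})$ is the inverse matrix of $(g_{ij})$. The graph $\{(x,f(x)):x\in\Omega\}\subset\mathbb{R}^n\times\mathbb{R}^m$ of such an $f$ is called a nonparametric minimal submanifold; the system is the Euler-Lagrange equation of the volume functional $\int_\Omega\sqrt{g}\,dx^1\wedge\cdots\wedge dx^n$. For a linear transformation $L:\mathbb{R}^n\to\mathbb{R}^m$, let $\wedge^2L:\wedge^2\mathbb{R}^n\to\wedge^2\mathbb{R}^m$ be the induced linear map $(\wedge^2L)(v\wedge w)=L(v)\wedge L(w)$, and define $$|\wedge^2L|=\sup_{|v\wedge w|=1}|(\wedge^2L)(v\wedge w)|.$$ In particular $|\wedge^2L|=0$ if $L$ has rank one. $|\wedge^2df|(x)$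 denotes this quantity for $L=df(x)$. A minimal submanifold is called stable if the second derivative (at time $0$) of the volume functional with respect to any compactly supported normal variation is non-negative. *)

theory Defs
  imports "HOL-Analysis.Analysis"
begin

definition partial :: "'n::finite \<Rightarrow> (real^'n \<Rightarrow> 'b::real_normed_vector) \<Rightarrow> real^'n \<Rightarrow> 'b"
  where "partial i f x = vector_derivative (\<lambda>s. f (x + s *\<^sub>R axis i 1)) (at 0)"

text \<open>The next two notions are meant for open sets, where they are the usual classes
  \<open>C\<^sup>1\<close> and \<open>C\<^sup>2\<close>.\<close>

definition C1_on :: "(real^'n::finite) set \<Rightarrow> (real^'n \<Rightarrow> 'b::real_normed_vector) \<Rightarrow> bool"
  where "C1_on S f \<longleftrightarrow> f differentiable_on S \<and> (\<forall>i. continuous_on S (partial i f))"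

definition C2_on :: "(real^'n::finite) set \<Rightarrow> (real^'n \<Rightarrow> 'b::real_normed_vector) \<Rightarrow> bool"
  where "C2_on S f \<longleftrightarrow> C1_on S f \<and> (\<forall>i. C1_on S (partial i f))"

definition induced_metric :: "(real^'n::finite \<Rightarrow> real^'m::finite) \<Rightarrow> real^'n \<Rightarrow> real^'n^'n"
  where "induced_metric f x =
    (\<chi> i j. (if i = j then 1 else 0) + (\<Sum>\<alpha>\<in>UNIV. partial i f x $ \<alpha> * partial j f x $ \<alpha>))"

definition minimal_surface_system ::
    "(real^'n::finite) set \<Rightarrow> (real^'n \<Rightarrow> real^'m::finite) \<Rightarrow> bool"
  where "minimal_surface_system \<Omega> f \<longleftrightarrow> C2_on \<Omega> f \<and>
    (\<forall>x\<in>\<Omega>. \<forall>\<alpha>. (\<Sum>i\<in>UNIV. \<Sum>j\<in>UNIV.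
       partial i (\<lambda>y. sqrt (det (induced_metric f y)) * matrix_inv (induced_metric f y) $ i $ j
                        * partial j f y $ \<alpha>) x) = 0)"

text \<open>The second exterior power of \<open>\<real>\<^sup>n\<close> is realised as the space of antisymmetric matrices, with
  \<open>e\<^sub>i \<and> e\<^sub>j\<close> the matrix that has \<open>1\<close> at \<open>(i, j)\<close> and \<open>-1\<close> at \<open>(j, i)\<close>. The factor \<open>1/2\<close> below
  makes the \<open>e\<^sub>i \<and> e\<^sub>j\<close> (one for each unordered pair) orthonormal.\<close>

definition wedge :: "real^'n::finite \<Rightarrow> real^'n \<Rightarrow> real^'n^'n"
  where "wedge v w = (\<chi> i j. v $ i * w $ j - v $ j * w $ i)"

definition bivector_norm :: "real^'n::finite^'n \<Rightarrow> real"
  where "bivector_norm B = sqrt ((\<Sum>i\<in>UNIV. \<Sum>j\<in>UNIV. (B $ i $ j)\<^sup>2) / 2)"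

definition wedge2_map :: "(real^'n::finite \<Rightarrow> real^'m::finite) \<Rightarrow> real^'n^'n \<Rightarrow> real^'m^'m"
  where "wedge2_map L B = matrix L ** B ** transpose (matrix L)"

definition wedge2_norm :: "(real^'n::finite \<Rightarrow> real^'m::finite) \<Rightarrow> real"
  where "wedge2_norm L =
    (SUP (v, w) \<in> {(v, w). bivector_norm (wedge v w) = 1}.
       bivector_norm (wedge2_map L (wedge v w)))"

lemma linear_wedge2_map: "linear (wedge2_map L)"
  by (rule linearI)
     (simp_all add: wedge2_map_def vec_eq_iff matrix_matrix_mult_def sum_distrib_left
        sum_distrib_right sum.distrib algebra_simps)

lemma wedge2_map_wedge:
  assumes "linear L"
  shows "wedge2_map L (wedge v w) = wedge (L v) (L w)"
proof -
  have L: "L u = matrix L *v u" for u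
    using assms by (simp add: matrix_works)
  have "(wedge2_map L (wedge v w)) $ i $ j = wedge (L v) (L w) $ i $ j" for i j
  proof -
    have "(wedge2_map L (wedge v w)) $ i $ j
       = (\<Sum>l\<in>UNIV. \<Sum>k\<in>UNIV. (matrix L $ i $ k * v $ k) * (matrix L $ j $ l * w $ l))
       - (\<Sum>l\<in>UNIV. \<Sum>k\<in>UNIV. (matrix L $ i $ k * w $ k) * (matrix L $ j $ l * v $ l))"
      by (simp add: wedge2_map_def wedge_def matrix_matrix_mult_def transpose_def
          sum_distrib_left sum_distrib_right algebra_simps flip: sum_subtractf)
    also have "\<dots> = (matrix L *v v) $ i * (matrix L *v w) $ j - (matrix L *v w) $ i * (matrix L *v v) $ j"
      by (subst (1 2) sum.swap) (simp add: matrix_vector_mult_def sum_product)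
    finally show ?thesis
      by (simp add: wedge_def mult.commute flip: L)
  qed
  then show ?thesis by (simp add: vec_eq_iff)
qed

lemma bivector_norm_wedge:
  "bivector_norm (wedge v w) = sqrt ((v \<bullet> v) * (w \<bullet> w) - (v \<bullet> w)\<^sup>2)"
proof -
  have "(\<Sum>i\<in>UNIV. \<Sum>j\<in>UNIV. (wedge v w $ i $ j)\<^sup>2)
      = (\<Sum>i\<in>UNIV. \<Sum>j\<in>UNIV. (v $ i * v $ i) * (w $ j * w $ j))
        + (\<Sum>i\<in>UNIV. \<Sum>j\<in>UNIV. (w $ i * w $ i) * (v $ j * v $ j))
        - 2 * (\<Sum>i\<in>UNIV. \<Sum>j\<in>UNIV. (v $ i * w $ i) * (v $ j * w $ j))"
    by (simp add: wedge_def power2_eq_square algebra_simps sum.distrib sum_subtractf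
        sum_distrib_left)
  also have "\<dots> = 2 * ((v \<bullet> v) * (w \<bullet> w) - (v \<bullet> w)\<^sup>2)"
    by (simp only: sum_product[symmetric] inner_vec_def inner_real_def power2_eq_square)
       (simp add: algebra_simps)
  finally show ?thesis
    by (simp add: bivector_norm_def)
qed

text \<open>Submanifolds are given by a parametrisation \<open>X\<close> on \<open>\<Omega>\<close>; \<open>volume K X\<close> is the
  \<open>n\<close>-dimensional volume (area formula) of the part over \<open>K\<close>.\<close>

definition gram_matrix :: "(real^'n::finite \<Rightarrow> 'b::euclidean_space) \<Rightarrow> real^'n \<Rightarrow> real^'n^'n"
  where "gram_matrix X x = (\<chi> i j. partial i X x \<bullet> partial j X x)"

definition volume :: "(real^'n::finite) set \<Rightarrow> (real^'n \<Rightarrow> 'b::euclidean_space) \<Rightarrow> real"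
  where "volume K X = integral K (\<lambda>x. sqrt (det (gram_matrix X x)))"

definition time_deriv :: "(real \<Rightarrow> 'a \<Rightarrow> 'b::real_normed_vector) \<Rightarrow> real \<Rightarrow> 'a \<Rightarrow> 'b"
  where "time_deriv h t x = vector_derivative (\<lambda>s. h s x) (at t)"

definition C2_in_time ::
    "real \<Rightarrow> 'a::topological_space set \<Rightarrow> (real \<Rightarrow> 'a \<Rightarrow> 'b::real_normed_vector) \<Rightarrow> bool"
  where "C2_in_time \<epsilon> S h \<longleftrightarrow>
    (\<forall>t\<in>{-\<epsilon><..<\<epsilon>}. \<forall>x\<in>S. (\<lambda>s. h s x) differentiable at t
                         \<and> (\<lambda>s. time_deriv h s x) differentiable at t) \<and>
    continuous_on ({-\<epsilon><..<\<epsilon>} \<times> S) (\<lambda>(t, x). h t x) \<and>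
    continuous_on ({-\<epsilon><..<\<epsilon>} \<times> S) (\<lambda>(t, x). time_deriv h t x) \<and>
    continuous_on ({-\<epsilon><..<\<epsilon>} \<times> S) (\<lambda>(t, x). time_deriv (time_deriv h) t x)"

text \<open>A variation \<open>F\<close> of \<open>X\<close>, for times in \<open>(-\<epsilon>, \<epsilon>)\<close>, that is stationary outside the compact
  set \<open>K\<close> and whose velocity at time \<open>0\<close> is normal to the submanifold. The regularity asked for
  (\<open>F\<close> and its first space derivatives are \<open>C\<^sup>2\<close> in time) is what makes the volume twice
  differentiable in time; more cannot be asked in space, since \<open>F 0 = X\<close> is only
  \<open>C\<^sup>2\<close> and a normal field along it is in general only \<open>C\<^sup>1\<close>. For instance \<open>F t x = X x + t *\<^sub>R V x\<close>
  is admitted for every \<open>C\<^sup>1\<close> normal field \<open>V\<close> that vanishes outside \<open>K\<close>.\<close>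

definition normal_variation ::
    "(real^'n::finite) set \<Rightarrow> (real^'n \<Rightarrow> 'b::euclidean_space) \<Rightarrow> (real^'n) set \<Rightarrow> real
      \<Rightarrow> (real \<Rightarrow> real^'n \<Rightarrow> 'b) \<Rightarrow> bool"
  where "normal_variation \<Omega> X K \<epsilon> F \<longleftrightarrow>
    compact K \<and> K \<subseteq> \<Omega> \<and> 0 < \<epsilon> \<and>
    (\<forall>x\<in>\<Omega>. F 0 x = X x) \<and>
    (\<forall>t\<in>{-\<epsilon><..<\<epsilon>}. \<forall>x\<in>\<Omega> - K. F t x = X x) \<and>
    (\<forall>t\<in>{-\<epsilon><..<\<epsilon>}. F t differentiable_on \<Omega>) \<and>
    C2_in_time \<epsilon> \<Omega> F \<and> (\<forall>i. C2_in_time \<epsilon> \<Omega> (\<lambda>t. partial i (F t))) \<and>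
    (\<forall>x\<in>\<Omega>. \<forall>i. time_deriv F 0 x \<bullet> partial i X x = 0)"

text \<open>The volume over \<open>\<Omega>\<close> may be infinite, so the volume is taken over \<open>K\<close>; the rest of the
  submanifold does not move.\<close>

definition stable_submanifold :: "(real^'n::finite) set \<Rightarrow> (real^'n \<Rightarrow> 'b::euclidean_space) \<Rightarrow> bool"
  where "stable_submanifold \<Omega> X \<longleftrightarrow>
    (\<forall>K \<epsilon> F. normal_variation \<Omega> X K \<epsilon> F \<longrightarrow>
      (\<exists>vol' D.
        (\<forall>\<^sub>F t in nhds 0. ((\<lambda>s. volume K (F s)) has_real_derivative vol' t) (at t)) \<and>
        (vol' has_real_derivative D) (at 0) \<and> 0 \<le> D))"

definition graph_param :: "('a \<Rightarrow> 'b) \<Rightarrow> 'a \<Rightarrow> 'a \<times> 'b"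
  where "graph_param f x = (x, f x)"

end

theory Submission
  imports Defs
begin

text \<open>Let \<open>A(P) = sqrt (det (I + P\<^sup>T P))\<close> be the area integrand. In singular-value coordinates the second
  derivative of \<open>A\<close> at \<open>P\<close> splits into a diagonal and an off-diagonal part, and both are non-negative
  as soon as \<open>\<lambda>\<^sub>i \<lambda>\<^sub>j \<le> 1/(n-1)\<close> for \<open>i \<noteq> j\<close>. By compactness,
  \<open>A(P + Q) \<ge> A(P) + A'(P) Q - e \<bar>Q\<bar>\<^sup>2\<close> for every \<open>e > 0\<close>, all \<open>P\<close> in \<open>df(K)\<close> and all small \<open>Q\<close>.
  For small \<open>t\<close> a variation \<open>F\<^sub>t\<close> is, after the change of variables \<open>x \<mapsto> fst (F\<^sub>t x)\<close>, the graph of a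
  function \<open>f\<^sub>t\<close> with \<open>df\<^sub>t - df = O(t)\<close>. The linear term integrates to \<open>0\<close> by the minimal surface
  system, so the volume at time \<open>t\<close> is at least the volume at time \<open>0\<close> minus \<open>e t\<^sup>2\<close>, for every
  \<open>e > 0\<close>, and its second derivative at \<open>0\<close> cannot be negative.
  Only space derivatives of \<open>f\<^sub>t\<close> enter: it need not be twice differentiable in time.\<close>

section \<open>Functions of class C2 in time, derivatives of determinants\<close>

text \<open>Origin of 1/(n-1): if the v_i are orthonormal with orthogonal images of lengths
  \<lambda>_i, the norm of P v_i wedge P v_j is \<lambda>_i \<lambda>_j. In suitably rescaled
  diagonal entries b_i the diagonal part is the sum of the b_i^2 plus the sum of \<lambda>_i
  \<lambda>_j b_i b_j over i and j distinct. Each b_i meets n-1 others, so Cauchy-Schwarz absorbs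
  the mixed terms as soon as the products are at most 1/(n-1). The loss of e times |Q|^2 is forced:
  the hypothesis controls the second derivative of A at df(x) only, whereas the Taylor remainder
  sits at a nearby matrix, where it may be slightly negative. Since Q = O(t), the loss is an
  arbitrarily small multiple of t^2, which a negative second derivative of the volume would beat.
  That the volume is twice differentiable at all is a separate matter. It follows by differentiating
  the Gram determinant of the original parametrisation in time, on an interval where that
  parametrisation stays immersed; the comparison with graphs then only decides the sign.\<close>

text \<open>Explicit witnesses \<open>h'\<close> and \<open>h''\<close> replace the chosen value
  \<open>vector_derivative\<close>, so that the closure properties below reduce to ordinary
  derivative rules.\<close>

lemma C2_in_time_iff:
  "C2_in_time \<epsilon> S h \<longleftrightarrow> (\<exists>h' h''.
    (\<forall>t\<in>{-\<epsilon><..<\<epsilon>}. \<forall>x\<in>S. ((\<lambda>s. h s x) has_vector_derivative h' t x) (at t)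
                         \<and> ((\<lambda>s. h' s x) has_vector_derivative h'' t x) (at t)) \<and>
    continuous_on ({-\<epsilon><..<\<epsilon>} \<times> S) (\<lambda>(t, x). h t x) \<and>
    continuous_on ({-\<epsilon><..<\<epsilon>} \<times> S) (\<lambda>(t, x). h' t x) \<and>
    continuous_on ({-\<epsilon><..<\<epsilon>} \<times> S) (\<lambda>(t, x). h'' t x))" (is "?L = ?R")
proof
  assume ?L
  show ?R
  proof (rule exI[of _ "time_deriv h"], rule exI[of _ "time_deriv (time_deriv h)"], intro conjI ballI)
    fix t x assume "t \<in> {-\<epsilon><..<\<epsilon>}" "x \<in> S"
    then have *: "(\<lambda>s. h s x) differentiable at t" "(\<lambda>s. time_deriv h s x) differentiable at t"
      using \<open>?L\<close> unfolding C2_in_time_def by blast+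
    show "((\<lambda>s. h s x) has_vector_derivative time_deriv h t x) (at t)"
      using *(1) unfolding time_deriv_def by (simp add: vector_derivative_works[symmetric])
    show "((\<lambda>s. time_deriv h s x) has_vector_derivative time_deriv (time_deriv h) t x) (at t)"
      using *(2) unfolding time_deriv_def[of "time_deriv h"] by (simp add: vector_derivative_works[symmetric])
  qed (use \<open>?L\<close> in \<open>simp_all add: C2_in_time_def\<close>)
next
  assume ?R
  then obtain h' h'' where d: "\<And>t x. t \<in> {-\<epsilon><..<\<epsilon>} \<Longrightarrow> x \<in> S \<Longrightarrow> ((\<lambda>s. h s x) has_vector_derivative h' t x) (at t)"
      "\<And>t x. t \<in> {-\<epsilon><..<\<epsilon>} \<Longrightarrow> x \<in> S \<Longrightarrow> ((\<lambda>s. h' s x) has_vector_derivative h'' t x) (at t)"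
    and c: "continuous_on ({-\<epsilon><..<\<epsilon>} \<times> S) (\<lambda>(t, x). h t x)"
      "continuous_on ({-\<epsilon><..<\<epsilon>} \<times> S) (\<lambda>(t, x). h' t x)"
      "continuous_on ({-\<epsilon><..<\<epsilon>} \<times> S) (\<lambda>(t, x). h'' t x)"
    by blast
  have e1: "time_deriv h t x = h' t x" if "t \<in> {-\<epsilon><..<\<epsilon>}" "x \<in> S" for t x
    unfolding time_deriv_def by (rule vector_derivative_at[OF d(1)[OF that]])
  \<comment> \<open>\<open>time_deriv h\<close> agrees with \<open>h'\<close> only for times in the
    interval; its openness lets the derivative be transferred.\<close>
  have d2: "((\<lambda>s. time_deriv h s x) has_vector_derivative h'' t x) (at t)"
    if "t \<in> {-\<epsilon><..<\<epsilon>}" "x \<in> S" for t x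
    by (rule has_vector_derivative_transform_within_open[OF d(2)[OF that], where S = "{-\<epsilon><..<\<epsilon>}"])
       (use that e1 in auto)
  have e2: "time_deriv (time_deriv h) t x = h'' t x" if "t \<in> {-\<epsilon><..<\<epsilon>}" "x \<in> S" for t x
    unfolding time_deriv_def[of "time_deriv h"] by (rule vector_derivative_at[OF d2[OF that]])
  have "continuous_on ({-\<epsilon><..<\<epsilon>} \<times> S) (\<lambda>(t, x). time_deriv h t x)"
    by (rule continuous_on_eq[OF c(2)]) (auto simp: e1)
  moreover have "continuous_on ({-\<epsilon><..<\<epsilon>} \<times> S) (\<lambda>(t, x). time_deriv (time_deriv h) t x)"
    by (rule continuous_on_eq[OF c(3)]) (auto simp: e2)
  ultimately show ?L
    unfolding C2_in_time_def using c(1) d(1) d2 by (meson differentiableI_vector)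
qed

lemma C2_in_timeI:
  assumes "\<And>t x. t \<in> {-\<epsilon><..<\<epsilon>} \<Longrightarrow> x \<in> S \<Longrightarrow> ((\<lambda>s. h s x) has_vector_derivative h' t x) (at t)"
    and "\<And>t x. t \<in> {-\<epsilon><..<\<epsilon>} \<Longrightarrow> x \<in> S \<Longrightarrow> ((\<lambda>s. h' s x) has_vector_derivative h'' t x) (at t)"
    and "continuous_on ({-\<epsilon><..<\<epsilon>} \<times> S) (\<lambda>p. h (fst p) (snd p))"
    and "continuous_on ({-\<epsilon><..<\<epsilon>} \<times> S) (\<lambda>p. h' (fst p) (snd p))"
    and "continuous_on ({-\<epsilon><..<\<epsilon>} \<times> S) (\<lambda>p. h'' (fst p) (snd p))"
  shows "C2_in_time \<epsilon> S h"
  unfolding C2_in_time_iff case_prod_unfold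
  by (rule exI[of _ h'], rule exI[of _ h'']) (use assms in blast)

lemma C2_in_timeE:
  assumes "C2_in_time \<epsilon> S h"
  obtains h' h'' where
    "\<And>t x. t \<in> {-\<epsilon><..<\<epsilon>} \<Longrightarrow> x \<in> S \<Longrightarrow> ((\<lambda>s. h s x) has_vector_derivative h' t x) (at t)"
    "\<And>t x. t \<in> {-\<epsilon><..<\<epsilon>} \<Longrightarrow> x \<in> S \<Longrightarrow> ((\<lambda>s. h' s x) has_vector_derivative h'' t x) (at t)"
    "continuous_on ({-\<epsilon><..<\<epsilon>} \<times> S) (\<lambda>p. h (fst p) (snd p))"
    "continuous_on ({-\<epsilon><..<\<epsilon>} \<times> S) (\<lambda>p. h' (fst p) (snd p))"
    "continuous_on ({-\<epsilon><..<\<epsilon>} \<times> S) (\<lambda>p. h'' (fst p) (snd p))"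
  using assms unfolding C2_in_time_iff case_prod_unfold by blast

lemma C2_in_time_subset:
  assumes "C2_in_time \<epsilon> S h" "T \<subseteq> S" "\<delta> \<le> \<epsilon>"
  shows "C2_in_time \<delta> T h"
proof -
  from assms(1) obtain h' h'' where
    "\<And>t x. t \<in> {-\<epsilon><..<\<epsilon>} \<Longrightarrow> x \<in> S \<Longrightarrow> ((\<lambda>s. h s x) has_vector_derivative h' t x) (at t)"
    "\<And>t x. t \<in> {-\<epsilon><..<\<epsilon>} \<Longrightarrow> x \<in> S \<Longrightarrow> ((\<lambda>s. h' s x) has_vector_derivative h'' t x) (at t)"
    "continuous_on ({-\<epsilon><..<\<epsilon>} \<times> S) (\<lambda>p. h (fst p) (snd p))"
    "continuous_on ({-\<epsilon><..<\<epsilon>} \<times> S) (\<lambda>p. h' (fst p) (snd p))"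
    "continuous_on ({-\<epsilon><..<\<epsilon>} \<times> S) (\<lambda>p. h'' (fst p) (snd p))"
    by (rule C2_in_timeE) blast
  moreover have "{-\<delta><..<\<delta>} \<times> T \<subseteq> {-\<epsilon><..<\<epsilon>} \<times> S" using assms by auto
  ultimately show ?thesis
    by (intro C2_in_timeI[where h' = h' and h'' = h'']) (use assms in \<open>auto intro: continuous_on_subset\<close>)
qed

lemma C2_in_time_const:
  assumes "continuous_on S c"
  shows "C2_in_time \<epsilon> S (\<lambda>t x. c x)"
  by (rule C2_in_timeI[where h' = "\<lambda>_ _. 0" and h'' = "\<lambda>_ _. 0"])
     (auto intro!: continuous_intros continuous_on_compose2[OF assms])

lemma C2_in_time_time: "C2_in_time \<epsilon> S (\<lambda>t x. t :: real)"
  by (rule C2_in_timeI[where h' = "\<lambda>_ _. 1" and h'' = "\<lambda>_ _. 0"])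
     (auto intro!: continuous_intros derivative_eq_intros)

lemma C2_in_time_bounded_linear:
  assumes "bounded_linear L" "C2_in_time \<epsilon> S h"
  shows "C2_in_time \<epsilon> S (\<lambda>t x. L (h t x))"
  using assms(2)
proof (rule C2_in_timeE)
  fix h' h''
  assume "\<And>t x. t \<in> {-\<epsilon><..<\<epsilon>} \<Longrightarrow> x \<in> S \<Longrightarrow> ((\<lambda>s. h s x) has_vector_derivative h' t x) (at t)"
    "\<And>t x. t \<in> {-\<epsilon><..<\<epsilon>} \<Longrightarrow> x \<in> S \<Longrightarrow> ((\<lambda>s. h' s x) has_vector_derivative h'' t x) (at t)"
    "continuous_on ({-\<epsilon><..<\<epsilon>} \<times> S) (\<lambda>p. h (fst p) (snd p))"
    "continuous_on ({-\<epsilon><..<\<epsilon>} \<times> S) (\<lambda>p. h' (fst p) (snd p))"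
    "continuous_on ({-\<epsilon><..<\<epsilon>} \<times> S) (\<lambda>p. h'' (fst p) (snd p))"
  then show ?thesis
    by (intro C2_in_timeI[where h' = "\<lambda>t x. L (h' t x)" and h'' = "\<lambda>t x. L (h'' t x)"])
       (auto intro!: bounded_linear.has_vector_derivative[OF assms(1)] bounded_linear.continuous_on[OF assms(1)])
qed

lemma C2_in_time_add:
  assumes "C2_in_time \<epsilon> S f" "C2_in_time \<epsilon> S g"
  shows "C2_in_time \<epsilon> S (\<lambda>t x. f t x + g t x)"
proof -
  obtain f' f'' where f: "\<And>t x. t \<in> {-\<epsilon><..<\<epsilon>} \<Longrightarrow> x \<in> S \<Longrightarrow> ((\<lambda>s. f s x) has_vector_derivative f' t x) (at t)"
    "\<And>t x. t \<in> {-\<epsilon><..<\<epsilon>} \<Longrightarrow> x \<in> S \<Longrightarrow> ((\<lambda>s. f' s x) has_vector_derivative f'' t x) (at t)"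
    "continuous_on ({-\<epsilon><..<\<epsilon>} \<times> S) (\<lambda>p. f (fst p) (snd p))"
    "continuous_on ({-\<epsilon><..<\<epsilon>} \<times> S) (\<lambda>p. f' (fst p) (snd p))"
    "continuous_on ({-\<epsilon><..<\<epsilon>} \<times> S) (\<lambda>p. f'' (fst p) (snd p))"
    by (rule C2_in_timeE[OF assms(1)]) blast
  obtain g' g'' where g: "\<And>t x. t \<in> {-\<epsilon><..<\<epsilon>} \<Longrightarrow> x \<in> S \<Longrightarrow> ((\<lambda>s. g s x) has_vector_derivative g' t x) (at t)"
    "\<And>t x. t \<in> {-\<epsilon><..<\<epsilon>} \<Longrightarrow> x \<in> S \<Longrightarrow> ((\<lambda>s. g' s x) has_vector_derivative g'' t x) (at t)"
    "continuous_on ({-\<epsilon><..<\<epsilon>} \<times> S) (\<lambda>p. g (fst p) (snd p))"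
    "continuous_on ({-\<epsilon><..<\<epsilon>} \<times> S) (\<lambda>p. g' (fst p) (snd p))"
    "continuous_on ({-\<epsilon><..<\<epsilon>} \<times> S) (\<lambda>p. g'' (fst p) (snd p))"
    by (rule C2_in_timeE[OF assms(2)]) blast
  show ?thesis
    by (rule C2_in_timeI[where h' = "\<lambda>t x. f' t x + g' t x" and h'' = "\<lambda>t x. f'' t x + g'' t x"])
       (intro has_vector_derivative_add continuous_on_add f g; assumption)+
qed

lemma C2_in_time_sum:
  assumes "\<And>i. i \<in> I \<Longrightarrow> C2_in_time \<epsilon> S (f i)"
  shows "C2_in_time \<epsilon> S (\<lambda>t x. \<Sum>i\<in>I. f i t x)"
  using assms
  by (induction I rule: infinite_finite_induct) (auto intro!: C2_in_time_add C2_in_time_const continuous_intros)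

lemma C2_in_time_mult:
  fixes f g :: "real \<Rightarrow> 'a::topological_space \<Rightarrow> real"
  assumes "C2_in_time \<epsilon> S f" "C2_in_time \<epsilon> S g"
  shows "C2_in_time \<epsilon> S (\<lambda>t x. f t x * g t x)"
proof -
  obtain f' f'' where f: "\<And>t x. t \<in> {-\<epsilon><..<\<epsilon>} \<Longrightarrow> x \<in> S \<Longrightarrow> ((\<lambda>s. f s x) has_vector_derivative f' t x) (at t)"
    "\<And>t x. t \<in> {-\<epsilon><..<\<epsilon>} \<Longrightarrow> x \<in> S \<Longrightarrow> ((\<lambda>s. f' s x) has_vector_derivative f'' t x) (at t)"
    "continuous_on ({-\<epsilon><..<\<epsilon>} \<times> S) (\<lambda>p. f (fst p) (snd p))"
    "continuous_on ({-\<epsilon><..<\<epsilon>} \<times> S) (\<lambda>p. f' (fst p) (snd p))"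
    "continuous_on ({-\<epsilon><..<\<epsilon>} \<times> S) (\<lambda>p. f'' (fst p) (snd p))"
    by (rule C2_in_timeE[OF assms(1)]) blast
  obtain g' g'' where g: "\<And>t x. t \<in> {-\<epsilon><..<\<epsilon>} \<Longrightarrow> x \<in> S \<Longrightarrow> ((\<lambda>s. g s x) has_vector_derivative g' t x) (at t)"
    "\<And>t x. t \<in> {-\<epsilon><..<\<epsilon>} \<Longrightarrow> x \<in> S \<Longrightarrow> ((\<lambda>s. g' s x) has_vector_derivative g'' t x) (at t)"
    "continuous_on ({-\<epsilon><..<\<epsilon>} \<times> S) (\<lambda>p. g (fst p) (snd p))"
    "continuous_on ({-\<epsilon><..<\<epsilon>} \<times> S) (\<lambda>p. g' (fst p) (snd p))"
    "continuous_on ({-\<epsilon><..<\<epsilon>} \<times> S) (\<lambda>p. g'' (fst p) (snd p))"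
    by (rule C2_in_timeE[OF assms(2)]) blast
  show ?thesis
    by (rule C2_in_timeI[where h' = "\<lambda>t x. f t x * g' t x + f' t x * g t x"
          and h'' = "\<lambda>t x. (f t x * g'' t x + f' t x * g' t x) + (f' t x * g' t x + f'' t x * g t x)"])
       (intro has_vector_derivative_add has_vector_derivative_mult continuous_on_add continuous_on_mult f g; assumption)+
qed

lemma C2_in_time_prod:
  fixes f :: "'i \<Rightarrow> real \<Rightarrow> 'a::topological_space \<Rightarrow> real"
  assumes "\<And>i. i \<in> I \<Longrightarrow> C2_in_time \<epsilon> S (f i)"
  shows "C2_in_time \<epsilon> S (\<lambda>t x. \<Prod>i\<in>I. f i t x)"
  using assms
  by (induction I rule: infinite_finite_induct) (auto intro!: C2_in_time_mult C2_in_time_const continuous_intros)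

lemma C2_in_time_det:
  assumes "\<And>i j. C2_in_time \<epsilon> S (\<lambda>t x. A t x $ i $ j :: real)"
  shows "C2_in_time \<epsilon> S (\<lambda>t x. det (A t x))"
  unfolding det_def
  by (intro C2_in_time_sum C2_in_time_mult C2_in_time_prod assms C2_in_time_const continuous_intros)

lemma C2_in_time_sqrt:
  fixes f :: "real \<Rightarrow> 'a::topological_space \<Rightarrow> real"
  assumes "C2_in_time \<epsilon> S f" and pos: "\<And>t x. t \<in> {-\<epsilon><..<\<epsilon>} \<Longrightarrow> x \<in> S \<Longrightarrow> 0 < f t x"
  shows "C2_in_time \<epsilon> S (\<lambda>t x. sqrt (f t x))"
proof -
  obtain f' f'' where f: "\<And>t x. t \<in> {-\<epsilon><..<\<epsilon>} \<Longrightarrow> x \<in> S \<Longrightarrow> ((\<lambda>s. f s x) has_vector_derivative f' t x) (at t)"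
    "\<And>t x. t \<in> {-\<epsilon><..<\<epsilon>} \<Longrightarrow> x \<in> S \<Longrightarrow> ((\<lambda>s. f' s x) has_vector_derivative f'' t x) (at t)"
    and c: "continuous_on ({-\<epsilon><..<\<epsilon>} \<times> S) (\<lambda>p. f (fst p) (snd p))"
    "continuous_on ({-\<epsilon><..<\<epsilon>} \<times> S) (\<lambda>p. f' (fst p) (snd p))"
    "continuous_on ({-\<epsilon><..<\<epsilon>} \<times> S) (\<lambda>p. f'' (fst p) (snd p))"
    by (rule C2_in_timeE[OF assms(1)]) blast
  show ?thesis
  proof (rule C2_in_timeI[where h' = "\<lambda>t x. f' t x / (2 * sqrt (f t x))"
          and h'' = "\<lambda>t x. f'' t x / (2 * sqrt (f t x)) - f' t x * f' t x / (4 * f t x * sqrt (f t x))"])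
    fix t x assume tx: "t \<in> {-\<epsilon><..<\<epsilon>}" "x \<in> S"
    note p = pos[OF tx]
    have p': "sqrt (f t x) * sqrt (f t x) = f t x" "sqrt (f t x) > 0" using p by auto
    note d = f[OF tx, unfolded has_real_derivative_iff_has_vector_derivative[symmetric]]
    have d1: "((\<lambda>s. sqrt (f s x)) has_real_derivative f' t x / (2 * sqrt (f t x))) (at t)"
      using DERIV_chain2[OF DERIV_real_sqrt[OF p] d(1)] by (simp add: field_simps)
    then show "((\<lambda>s. sqrt (f s x)) has_vector_derivative f' t x / (2 * sqrt (f t x))) (at t)"
      by (simp add: has_real_derivative_iff_has_vector_derivative)
    have "((\<lambda>s. f' s x / (2 * sqrt (f s x))) has_real_derivative
        (f'' t x * (2 * sqrt (f t x)) - f' t x * (2 * (f' t x / (2 * sqrt (f t x))))) /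
          ((2 * sqrt (f t x)) * (2 * sqrt (f t x)))) (at t)"
      by (rule DERIV_divide[OF d(2) DERIV_cmult[OF d1]]) (use p in simp)
    moreover have "(f'' t x * (2 * sqrt (f t x)) - f' t x * (2 * (f' t x / (2 * sqrt (f t x))))) /
          ((2 * sqrt (f t x)) * (2 * sqrt (f t x)))
      = f'' t x / (2 * sqrt (f t x)) - f' t x * f' t x / (4 * f t x * sqrt (f t x))"
    proof -
      \<comment> \<open>In terms of the square root \<open>r\<close> the claim is an identity of
        rational functions.\<close>
      obtain r where r: "sqrt (f t x) = r" "f t x = r * r" "r > 0" using p' by metis
      have "f' t x * f' t x / (r * (r * (r * 4))) + (r * (2 * f'' t x) - f' t x * f' t x / r) / (r * (r * 4))
          = f'' t x / (r * 2)" using r(3) by (simp add: field_simps)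
      then show ?thesis using r(3) by (simp add: r(1) field_simps) (simp add: r(2) field_simps)
    qed
    ultimately show "((\<lambda>s. f' s x / (2 * sqrt (f s x))) has_vector_derivative
        f'' t x / (2 * sqrt (f t x)) - f' t x * f' t x / (4 * f t x * sqrt (f t x))) (at t)"
      by (simp add: has_real_derivative_iff_has_vector_derivative)
  qed (use pos in \<open>auto intro!: continuous_intros c simp: less_imp_neq[symmetric]\<close>)
qed

section \<open>Jacobi's formula\<close>

text \<open>A permutation other than the identity moves at least two points, so after one factor of
  its Leibniz term is differentiated, an off-diagonal entry of \<open>mat 1\<close> still remains
  and kills the term. The identity permutation contributes the trace.\<close>

lemma det_has_derivative_at_one:
  fixes H :: "real \<Rightarrow> real^'n::finite^'n"
  assumes H: "\<And>i j. ((\<lambda>s. H s $ i $ j) has_real_derivative H' $ i $ j) (at t)" and one: "H t = mat 1"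
  shows "((\<lambda>s. det (H s)) has_real_derivative trace H') (at t)"
proof -
  have prod: "((\<lambda>s. \<Prod>i\<in>UNIV. H s $ i $ p i) has_real_derivative
      (\<Sum>i\<in>UNIV. H' $ i $ p i * (\<Prod>j\<in>UNIV - {i}. H t $ j $ p j))) (at t)" for p :: "'n \<Rightarrow> 'n"
    by (rule has_field_derivative_prod) (rule H)
  have z: "(\<Sum>i\<in>UNIV. H' $ i $ p i * (\<Prod>j\<in>UNIV - {i}. H t $ j $ p j)) = (if p = id then trace H' else 0)"
    if p: "p permutes UNIV" for p :: "'n \<Rightarrow> 'n"
  proof (cases "p = id")
    case True
    then show ?thesis by (simp add: one mat_def trace_def)
  next
    case False
    then obtain k where k: "p k \<noteq> k" by (auto simp: fun_eq_iff)
    have "(\<Prod>j\<in>UNIV - {i}. H t $ j $ p j) = 0" for i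
    proof -
      \<comment> \<open>With \<open>k\<close> also \<open>p k\<close> is moved, so some moved point
        differs from the index \<open>i\<close> that was differentiated.\<close>
      have "p (p k) \<noteq> p k" using k p by (metis permutes_def)
      then obtain j where "j \<noteq> i" "p j \<noteq> j" using k by metis
      then have "\<exists>a\<in>UNIV - {i}. H t $ a $ p a = 0" by (intro bexI[of _ j]) (auto simp: one mat_def)
      then show ?thesis by (intro prod_zero) auto
    qed
    then show ?thesis using False by (simp only: mult_zero_right sum.neutral_const if_False)
  qed
  have "((\<lambda>s. det (H s)) has_real_derivative
     (\<Sum>p | p permutes UNIV. of_int (sign p) * (\<Sum>i\<in>UNIV. H' $ i $ p i * (\<Prod>j\<in>UNIV - {i}. H t $ j $ p j)))) (at t)"
    unfolding det_def by (intro DERIV_sum DERIV_cmult prod)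
  moreover have "(\<Sum>p | p permutes UNIV. of_int (sign p) * (\<Sum>i\<in>UNIV. H' $ i $ p i * (\<Prod>j\<in>UNIV - {i}. H t $ j $ p j)))
      = (\<Sum>p | p permutes (UNIV :: 'n set). if p = id then trace H' else 0)"
    by (rule sum.cong) (auto simp: z)
  moreover have "\<dots> = trace H'"
    by (simp add: sum.delta finite_permutations permutes_id)
  ultimately show ?thesis by simp
qed

text \<open>Multiplication by the inverse \<open>B\<close> of \<open>G t\<close> moves the base
  point to \<open>mat 1\<close>, at the price of the constant factor
  \<open>det (G t)\<close>.\<close>

lemma det_has_derivative:
  fixes G :: "real \<Rightarrow> real^'n::finite^'n"
  assumes G: "\<And>i j. ((\<lambda>s. G s $ i $ j) has_real_derivative G' $ i $ j) (at t)" and B: "G t ** B = mat 1"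
  shows "((\<lambda>s. det (G s)) has_real_derivative det (G t) * trace (B ** G')) (at t)"
proof -
  have BG: "B ** G t = mat 1" using B by (simp add: matrix_left_right_inverse)
  have e: "det (G s) = det (G t) * det (B ** G s)" for s
    using B by (metis det_I det_mul mult.assoc mult_1)
  have "((\<lambda>s. det (B ** G s)) has_real_derivative trace (B ** G')) (at t)"
  proof (rule det_has_derivative_at_one[where H = "\<lambda>s. B ** G s", OF _ BG])
    fix i j
    show "((\<lambda>s. (B ** G s) $ i $ j) has_real_derivative (B ** G') $ i $ j) (at t)"
      unfolding matrix_matrix_mult_def by (simp, intro DERIV_sum DERIV_cmult G)
  qed
  then show ?thesis
    by (subst e) (rule DERIV_cmult)
qed

section \<open>Change of variables over an arbitrary finite index type\<close>

text \<open>The change of variables theorem of the library is stated for \<open>real^'n\<close> with a well-ordered index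
  type. A copy of the index type carries such an order, and permuting coordinates preserves integrals
  and determinants.\<close>

typedef 'a wo_copy = "UNIV :: 'a set" ..

text \<open>Only the existence of a well-order matters, so any injection into the naturals serves;
  finiteness of the type provides one.\<close>

definition wo_index :: "'a::finite wo_copy \<Rightarrow> nat"
  where "wo_index x = (SOME f. inj f) (Rep_wo_copy x)"

lemma inj_wo_index: "inj (wo_index :: 'a::finite wo_copy \<Rightarrow> nat)"
proof -
  obtain f :: "'a \<Rightarrow> nat" and n where "f ` UNIV = {i. i < n}" and f: "inj f"
    using finite_imp_inj_to_nat_seg[OF finite[of "UNIV :: 'a set"]] by (elim exE conjE)
  have inj: "inj (SOME f :: 'a \<Rightarrow> nat. inj f)" by (rule someI[where P = inj, OF f])
  show ?thesis
  proof (rule injI)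
    fix x y :: "'a wo_copy"
    assume "wo_index x = wo_index y"
    then have "Rep_wo_copy x = Rep_wo_copy y"
      unfolding wo_index_def by (rule injD[OF inj])
    then show "x = y" by (simp only: Rep_wo_copy_inject)
  qed
qed

instantiation wo_copy :: (finite) linorder
begin

definition "x \<le> (y :: 'a wo_copy) \<longleftrightarrow> wo_index x \<le> wo_index y"
definition "x < (y :: 'a wo_copy) \<longleftrightarrow> wo_index x < wo_index y"

instance
proof
  fix x y :: "'a wo_copy"
  show "x \<le> y \<Longrightarrow> y \<le> x \<Longrightarrow> x = y"
    unfolding less_eq_wo_copy_def by (rule injD[OF inj_wo_index]) (rule order.antisym)
qed (auto simp: less_eq_wo_copy_def less_wo_copy_def)

end

lemma bij_Rep_wo_copy: "bij Rep_wo_copy"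
  by (rule bij_betwI[of _ _ _ Abs_wo_copy]) (auto simp: Rep_wo_copy_inverse Abs_wo_copy_inverse)

instance wo_copy :: (finite) finite
proof
  show "finite (UNIV :: 'a wo_copy set)"
    by (rule finite_imageD[OF finite_subset[OF subset_UNIV finite] bij_is_inj[OF bij_Rep_wo_copy]])
qed

instance wo_copy :: (finite) wellorder
proof
  fix P :: "'a wo_copy \<Rightarrow> bool" and a
  assume step: "\<And>x. (\<And>y. y < x \<Longrightarrow> P y) \<Longrightarrow> P x"
  show "P a"
  proof (induction a rule: measure_induct_rule[of wo_index])
    case (less x)
    show ?case by (rule step, rule less) (simp add: less_wo_copy_def)
  qed
qed

section \<open>Permuting coordinates in determinants and integrals\<close>

text \<open>Conjugation by \<open>h\<close> is a sign-preserving bijection between the permutations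
  of the two index types and matches the Leibniz sums term by term.\<close>

lemma det_reindex:
  fixes A :: "'a::comm_ring_1^'n::finite^'n" and h :: "'k::finite \<Rightarrow> 'n"
  assumes h: "bij h"
  shows "det (\<chi> i j. A $ h i $ h j) = det A"
proof -
  have inv: "bij (inv h)" using h by (rule bij_imp_bij_inv)
  have "(\<Sum>p\<in>{p. p permutes (UNIV :: 'k set)}. of_int (sign p) * (\<Prod>i\<in>UNIV. (\<chi> i j. A $ h i $ h j) $ i $ p i))
     = (\<Sum>p\<in>{p. p permutes (UNIV :: 'n set)}. of_int (sign p) * (\<Prod>i\<in>UNIV. A $ i $ p i))"
  proof (rule sum.reindex_bij_witness[where j = "map_permutation UNIV h" and i = "map_permutation UNIV (inv h)"])
    fix p assume p: "p \<in> {p. p permutes (UNIV :: 'k set)}"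
    then show "map_permutation UNIV (inv h) (map_permutation UNIV h p) = p"
      by (intro map_permutation_compose_inv) (use h in \<open>auto simp: bij_is_inj\<close>)
    show "map_permutation UNIV h p \<in> {p. p permutes UNIV}"
      using map_permutation_permutes[OF h, of p] p by simp
    have "(\<Prod>i\<in>UNIV. A $ i $ map_permutation UNIV h p i) = (\<Prod>i\<in>UNIV. A $ h i $ map_permutation UNIV h p (h i))"
      by (rule prod.reindex_bij_betw[OF h, symmetric])
    also have "\<dots> = (\<Prod>i\<in>UNIV. A $ h i $ h (p i))"
      using h by (simp add: map_permutation_apply bij_is_inj)
    finally show "of_int (sign (map_permutation UNIV h p)) * (\<Prod>i\<in>UNIV. A $ i $ map_permutation UNIV h p i)
      = of_int (sign p) * (\<Prod>i\<in>UNIV. (\<chi> i j. A $ h i $ h j) $ i $ p i)"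
      using p h by (simp add: sign_map_permutation bij_is_inj)
  next
    fix p assume p: "p \<in> {p. p permutes (UNIV :: 'n set)}"
    then show "map_permutation UNIV h (map_permutation UNIV (inv h) p) = p"
      by (intro map_permutation_compose_inv) (use h inv in \<open>auto simp: bij_is_inj bij_is_surj surj_f_inv_f\<close>)
    show "map_permutation UNIV (inv h) p \<in> {p. p permutes UNIV}"
      using map_permutation_permutes[OF inv, of p] p by simp
  qed
  then show ?thesis by (simp add: det_def)
qed

definition reindex :: "('k \<Rightarrow> 'n) \<Rightarrow> 'a^'n \<Rightarrow> 'a^'k"
  where "reindex h x = (\<chi> i. x $ h i)"

lemma reindex_inverse:
  assumes "bij h"
  shows "reindex (inv h) (reindex h x) = x" "reindex h (reindex (inv h) y) = y"
  using assms by (auto simp: reindex_def vec_eq_iff bij_is_inj bij_is_surj surj_f_inv_f)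

lemma bounded_linear_reindex: "bounded_linear (reindex h :: real^'n::finite \<Rightarrow> real^'k::finite)"
  by (intro linear_conv_bounded_linear[THEN iffD1] linearI) (auto simp: reindex_def vec_eq_iff)

lemma reindex_cbox:
  fixes h :: "'k::finite \<Rightarrow> 'n::finite" and u v :: "real^'n"
  assumes h: "bij h"
  shows "reindex h ` cbox u v = cbox (reindex h u) (reindex h v)"
proof (rule equalityI)
  show "reindex h ` cbox u v \<subseteq> cbox (reindex h u) (reindex h v)"
    by (auto simp: reindex_def mem_box_cart)
  show "cbox (reindex h u) (reindex h v) \<subseteq> reindex h ` cbox u v"
  proof
    fix y assume y: "y \<in> cbox (reindex h u) (reindex h v)"
    have "u $ i \<le> reindex (inv h) y $ i \<and> reindex (inv h) y $ i \<le> v $ i" for i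
    proof -
      have "h (inv h i) = i" using h by (simp add: bij_is_surj surj_f_inv_f)
      then show ?thesis
        using y unfolding mem_box_cart by (metis (no_types, lifting) reindex_def vec_lambda_beta)
    qed
    then have "reindex (inv h) y \<in> cbox u v" by (simp add: mem_box_cart)
    then show "y \<in> reindex h ` cbox u v"
      by (metis h image_eqI reindex_inverse(2))
  qed
qed

lemma content_reindex:
  fixes h :: "'k::finite \<Rightarrow> 'n::finite" and u v :: "real^'n"
  assumes h: "bij h"
  shows "measure lborel (reindex h ` cbox u v) = measure lborel (cbox u v)"
proof (cases "cbox u v = {}")
  case False
  then have "cbox (reindex h u) (reindex h v) \<noteq> {}"
    using reindex_cbox[OF h, of u v] by auto
  then show ?thesis
    using False by (simp add: reindex_cbox[OF h] content_cbox_cart)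
      (simp add: reindex_def prod.reindex_bij_betw[OF h, of "\<lambda>i. v $ i - u $ i"])
qed simp

text \<open>A permutation of coordinates sends boxes to boxes of the same content, which is what
  \<open>has_integral_twiddle\<close> asks for with factor 1. Boundedness of \<open>S\<close> allows
  extending \<open>f\<close> by zero to a box.\<close>

lemma has_integral_reindex:
  fixes h :: "'k::finite \<Rightarrow> 'n::finite" and f :: "real^'n \<Rightarrow> real"
  assumes h: "bij h" and "bounded S" and f: "(f has_integral I) S"
  shows "((\<lambda>y. f (reindex (inv h) y)) has_integral I) (reindex h ` S)"
proof -
  have inv: "bij (inv h)" using h by (rule bij_imp_bij_inv)
  obtain a b where ab: "S \<subseteq> cbox a b"
    using bounded_subset_cbox_symmetric[OF \<open>bounded S\<close>] by blast
  define F where "F x = (if x \<in> S then f x else 0)" for x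
  have "(F has_integral I) (cbox a b)"
    unfolding F_def by (subst has_integral_restrict) (use f ab in auto)
  have "((\<lambda>y. F (reindex (inv h) y)) has_integral (1 / 1) *\<^sub>R I) (reindex h ` cbox a b)"
  proof (rule has_integral_twiddle)
    show "reindex h (reindex (inv h) x) = x" for x :: "real^'k"
      using reindex_inverse[OF h] by blast
    show "reindex (inv h) (reindex h x) = x" for x :: "real^'n"
      using reindex_inverse[OF h] by blast
    show "continuous (at x) (reindex (inv h))" for x :: "real^'k"
      by (intro linear_continuous_at bounded_linear_reindex)
    show "\<exists>w z. reindex (inv h) ` cbox u v = cbox w z" for u v :: "real^'k"
      using reindex_cbox[OF inv] by blast
    show "\<exists>w z. reindex h ` cbox u v = cbox w z" for u v :: "real^'n"
      using reindex_cbox[OF h] by blast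
    show "measure lborel (reindex (inv h) ` cbox u v) = 1 * measure lborel (cbox u v)" for u v :: "real^'k"
      using content_reindex[OF inv] by simp
  qed (use \<open>(F has_integral I) (cbox a b)\<close> in auto)
  moreover have "F (reindex (inv h) y) = (if y \<in> reindex h ` S then f (reindex (inv h) y) else 0)" for y
  proof -
    have "reindex (inv h) y \<in> S \<longleftrightarrow> y \<in> reindex h ` S"
      using reindex_inverse[OF h] by (metis (no_types) image_iff)
    then show ?thesis by (simp add: F_def)
  qed
  ultimately have "((\<lambda>y. if y \<in> reindex h ` S then f (reindex (inv h) y) else 0) has_integral I)
      (reindex h ` cbox a b)"
    by simp
  then have "((\<lambda>y. if y \<in> reindex h ` S then f (reindex (inv h) y) else 0) has_integral I)
      (cbox (reindex h a) (reindex h b))"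
    unfolding reindex_cbox[OF h] .
  then show ?thesis
    by (subst (asm) has_integral_restrict) (use ab reindex_cbox[OF h] in blast)+
qed

lemma absolutely_integrable_continuous_compact:
  fixes f :: "'a::euclidean_space \<Rightarrow> 'b::euclidean_space"
  assumes "compact S" "continuous_on S f"
  shows "f absolutely_integrable_on S"
proof -
  have "integrable lborel (\<lambda>x. indicator S x *\<^sub>R f x)"
    by (rule borel_integrable_compact[OF assms])
  then show ?thesis
    unfolding set_integrable_def by (simp add: integrable_completion)
qed


text \<open>Conjugating \<open>g\<close> by \<open>reindex\<close> gives a map \<open>?G\<close>
  over the well-ordered copy. There the known theorem applies; \<open>has_integral_reindex\<close>
  carries the two integrals over and \<open>det_reindex\<close> identifies the Jacobian
  determinants.\<close>

lemma has_integral_change_of_variables_compact: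
  fixes g :: "real^'n::finite \<Rightarrow> real^'n" and f :: "real^'n \<Rightarrow> real"
  assumes S: "compact S" and g: "\<And>x. x \<in> S \<Longrightarrow> (g has_derivative g' x) (at x within S)"
    and inj: "inj_on g S" and f: "continuous_on (g ` S) f"
  shows "((\<lambda>x. \<bar>det (matrix (g' x))\<bar> * f (g x)) has_integral integral (g ` S) f) S"
proof -
  let ?h = "Rep_wo_copy :: 'n wo_copy \<Rightarrow> 'n"
  let ?R = "reindex ?h :: real^'n \<Rightarrow> real^'n wo_copy" and ?R' = "reindex (inv ?h) :: real^'n wo_copy \<Rightarrow> real^'n"
  note h = bij_Rep_wo_copy[where 'a = 'n]
  have inv: "bij (inv ?h)" using h by (rule bij_imp_bij_inv)
  have inv_inv: "inv (inv ?h) = ?h" using h by (rule inv_inv_eq)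
  have R: "?R' (?R x) = x" "?R (?R' y) = y" for x y
    using reindex_inverse[OF h] by auto
  let ?T = "?R ` S" and ?G = "\<lambda>y. ?R (g (?R' y))" and ?G' = "\<lambda>y v. ?R (g' (?R' y) (?R' v))"
  have lin: "bounded_linear ?R" "bounded_linear ?R'"
    by (rule bounded_linear_reindex)+
  have contR: "continuous_on X ?R" "continuous_on Y ?R'" for X Y
    using lin by (auto intro: linear_continuous_on)
  have T: "compact ?T"
    using S contR by (intro compact_continuous_image) auto
  have contg: "continuous_on S g"
    using g has_derivative_continuous_on by blast
  have RT: "?R' ` ?T = S"
    using R by (auto simp: image_iff)
  have GT: "?G ` ?T = ?R ` g ` S"
    using R by (auto simp: image_iff)
  have der: "(?G has_derivative ?G' y) (at y within ?T)" if "y \<in> ?T" for y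
  proof -
    have "?R' y \<in> S" using that RT by blast
    have 1: "(?R' has_derivative ?R') (at y within ?T)"
      by (rule bounded_linear_imp_has_derivative[OF lin(2)])
    have "((g \<circ> ?R') has_derivative (g' (?R' y) \<circ> ?R')) (at y within ?T)"
      by (rule diff_chain_within[OF 1]) (use g[OF \<open>?R' y \<in> S\<close>] RT in simp)
    from bounded_linear.has_derivative[OF lin(1) this] show ?thesis
      by (simp add: o_def)
  qed
  have injG: "inj_on ?G ?T"
    using inj R by (auto simp: inj_on_def) (metis R(1))
  \<comment> \<open>The theorem applied below integrates functions with values in a space
    \<open>real^_\<close>, hence the wrapping of the scalar integrand into
    \<open>real^1\<close>.\<close>
  define F :: "real^'n wo_copy \<Rightarrow> real^1" where "F z = (\<chi> _. f (?R' z))" for z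
  have fR: "continuous_on (?G ` ?T) F"
    unfolding GT F_def
    by (intro continuous_on_vec_lambda continuous_on_compose2[OF f contR(2)]) (use R in auto)
  have GTc: "compact (?G ` ?T)" "compact (g ` S)"
    unfolding GT using S contg contR by (auto intro!: compact_continuous_image)
  have F: "F absolutely_integrable_on ?G ` ?T"
    using GTc fR by (intro absolutely_integrable_continuous_compact)
  then have 2: "(\<lambda>x. \<bar>det (matrix (?G' x))\<bar> *\<^sub>R F (?G x)) absolutely_integrable_on ?T"
      "integral ?T (\<lambda>x. \<bar>det (matrix (?G' x))\<bar> *\<^sub>R F (?G x)) = integral (?G ` ?T) F"
    using has_absolute_integral_change_of_variables_compact[OF T der injG,
        of F "integral (?G ` ?T) F"] by simp_all
  have "(f has_integral integral (g ` S) f) (g ` S)"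
    using absolutely_integrable_continuous_compact[OF GTc(2) f] set_lebesgue_integral_eq_integral(1)
    by blast
  from has_integral_reindex[OF h compact_imp_bounded[OF GTc(2)] this]
  have "integral (?G ` ?T) (\<lambda>z. f (?R' z)) = integral (g ` S) f"
    unfolding GT by (rule integral_unique)
  moreover have "((\<lambda>z. F z $ 1) has_integral integral (?G ` ?T) F $ 1) (?G ` ?T)"
    using has_integral_linear[OF integrable_integral[OF set_lebesgue_integral_eq_integral(1)[OF F]]
        bounded_linear_vec_nth[of 1]] by (simp add: o_def)
  then have "integral (?G ` ?T) (\<lambda>z. f (?R' z)) = integral (?G ` ?T) F $ 1"
    unfolding F_def by (simp add: integral_unique)
  moreover have "((\<lambda>x. (\<bar>det (matrix (?G' x))\<bar> *\<^sub>R F (?G x)) $ 1) has_integral integral (?G ` ?T) F $ 1) ?T"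
    using has_integral_linear[OF integrable_integral[OF set_lebesgue_integral_eq_integral(1)[OF 2(1)]]
        bounded_linear_vec_nth[of 1]] unfolding 2(2) o_def .
  ultimately have 3: "((\<lambda>x. \<bar>det (matrix (?G' x))\<bar> * f (?R' (?G x))) has_integral integral (g ` S) f) ?T"
    by (simp add: F_def)
  have det: "det (matrix (?G' (?R x))) = det (matrix (g' x))" if "x \<in> S" for x
  proof -
    have "matrix (?G' (?R x)) $ i $ j = matrix (g' x) $ ?h i $ ?h j" for i j
    proof -
      have "?R' (axis j 1) = axis (?h j) 1"
        using bij_is_inj[OF h] bij_is_surj[OF h]
        by (auto simp: vec_eq_iff reindex_def axis_def inv_f_f surj_f_inv_f)
      then show ?thesis by (simp add: matrix_def R) (simp add: reindex_def)
    qed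
    then have "matrix (?G' (?R x)) = (\<chi> i j. matrix (g' x) $ ?h i $ ?h j)"
      by (simp add: vec_eq_iff)
    then show ?thesis using det_reindex[OF h] by metis
  qed
  have "((\<lambda>x. \<bar>det (matrix (?G' (?R x)))\<bar> * f (g x)) has_integral integral (g ` S) f) S"
    using has_integral_reindex[OF inv compact_imp_bounded[OF T] 3] unfolding inv_inv RT
    by (simp add: R)
  then show ?thesis
    by (rule has_integral_eq[rotated]) (simp add: det)
qed

section \<open>The second variation form\<close>

lemma matrix_inv_inverse:
  fixes A :: "real^'n::finite^'n"
  assumes "det A \<noteq> 0"
  shows "A ** matrix_inv A = mat 1" "matrix_inv A ** A = mat 1"
proof -
  have "\<exists>B. A ** B = mat 1 \<and> B ** A = mat 1"
    using assms by (simp add: invertible_det_nz[symmetric] invertible_def)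
  then have "A ** matrix_inv A = mat 1 \<and> matrix_inv A ** A = mat 1"
    unfolding matrix_inv_def by (rule someI_ex)
  then show "A ** matrix_inv A = mat 1" "matrix_inv A ** A = mat 1" by auto
qed

text \<open>Cramer's rule. It presents each entry of the inverse as a quotient of polynomials in the
  entries of \<open>A\<close>, from which differentiability and C1 regularity of the inverse are
  read off.\<close>

lemma matrix_inv_nth:
  fixes A :: "real^'n::finite^'n"
  assumes "det A \<noteq> 0"
  shows "matrix_inv A $ k $ l = det (\<chi> i j. if j = k then axis l 1 $ i else A $ i $ j) / det A"
proof -
  have "A *v (matrix_inv A *v axis l 1) = axis l 1"
    using matrix_inv_inverse[OF assms] by (simp add: matrix_vector_mul_assoc)
  then have "matrix_inv A *v axis l 1 = (\<chi> k. det (\<chi> i j. if j = k then axis l 1 $ i else A $ i $ j) / det A)"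
    using cramer[OF assms] by blast
  then have "(matrix_inv A *v axis l 1) $ k = det (\<chi> i j. if j = k then axis l 1 $ i else A $ i $ j) / det A"
    by simp
  moreover have "(matrix_inv A *v axis l 1) $ k = matrix_inv A $ k $ l"
    by (simp add: matrix_vector_mult_basis column_def)
  ultimately show ?thesis by simp
qed

lemma differentiable_prod:
  fixes f :: "'i \<Rightarrow> 'a::real_normed_vector \<Rightarrow> real"
  assumes "\<And>i. i \<in> I \<Longrightarrow> f i differentiable (at x within S)"
  shows "(\<lambda>x. \<Prod>i\<in>I. f i x) differentiable (at x within S)"
  using assms
proof (induction I rule: infinite_finite_induct)
  case (insert i I)
  then show ?case by (simp add: differentiable_mult)
qed auto

lemma differentiable_det:
  fixes A :: "'a::real_normed_vector \<Rightarrow> real^'n::finite^'n"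
  assumes "\<And>i j. (\<lambda>x. A x $ i $ j) differentiable (at x within S)"
  shows "(\<lambda>x. det (A x)) differentiable (at x within S)"
  unfolding det_def
  by (intro differentiable_sum ballI differentiable_mult differentiable_const differentiable_prod assms)
     (auto simp: finite_permutations)

lemma differentiable_matrix_inv:
  fixes A :: "'a::real_normed_vector \<Rightarrow> real^'n::finite^'n"
  assumes A: "\<And>i j. (\<lambda>x. A x $ i $ j) differentiable (at x within S)" and d: "\<And>x. det (A x) \<noteq> 0"
  shows "(\<lambda>x. matrix_inv (A x) $ k $ l) differentiable (at x within S)"
proof -
  have "(\<lambda>x. (\<chi> i j. if j = k then axis l 1 $ i else A x $ i $ j) $ i $ j) differentiable (at x within S)" for i j
    using A by (cases "j = k") auto
  then show ?thesis
    using d by (subst matrix_inv_nth[OF d]) (intro differentiable_divide differentiable_det A; simp)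
qed

section \<open>Singular-value bases and the quadratic form in their coordinates\<close>

lemma orthogonal_matrix_rows_iff:
  "orthogonal_matrix (V :: real^'n::finite^'n) \<longleftrightarrow> (\<forall>i j. V $ i \<bullet> V $ j = (if i = j then 1 else 0))"
  unfolding orthogonal_matrix_orthonormal_rows
  by (auto simp: row_def orthogonal_def norm_eq_1 vec_nth_inverse)

lemma compact_orthogonal_matrices: "compact {V :: real^'n::finite^'n. orthogonal_matrix V}"
proof (rule compact_eq_bounded_closed[THEN iffD2], rule conjI)
  show "closed {V :: real^'n^'n. orthogonal_matrix V}"
    unfolding orthogonal_matrix_rows_iff
    by (intro closed_Collect_all closed_Collect_eq continuous_intros)
  have "norm V \<le> real CARD('n)" if "orthogonal_matrix V" for V :: "real^'n^'n"
  proof -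
    have "norm V \<le> (\<Sum>i\<in>UNIV. norm (V $ i))"
      unfolding norm_vec_def by (rule L2_set_le_sum) auto
    also have "\<dots> = real CARD('n)"
      using that by (simp add: orthogonal_matrix_rows_iff norm_eq_sqrt_inner)
    finally show ?thesis .
  qed
  then show "bounded {V :: real^'n^'n. orthogonal_matrix V}"
    unfolding bounded_iff by blast
qed

text \<open>The basis maximises \<open>\<Sum>\<^sub>k c\<^sub>k \<bar>P v\<^sub>k\<bar>\<^sup>2\<close> for pairwise distinct weights \<open>c\<^sub>k\<close>: rotating
  \<open>v\<^sub>i\<close> and \<open>v\<^sub>j\<close> in their plane changes this sum to first order by
  \<open>2 (c\<^sub>i - c\<^sub>j) P v\<^sub>i \<bullet> P v\<^sub>j\<close>, which must therefore vanish.\<close>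

lemma orthonormal_basis_orthogonal_images:
  fixes P :: "real^'n::finite^'m::finite"
  obtains V :: "real^'n^'n" where "orthogonal_matrix V"
    "\<And>i j. i \<noteq> j \<Longrightarrow> (P *v V $ i) \<bullet> (P *v V $ j) = 0"
proof -
  obtain c :: "'n \<Rightarrow> nat" where c: "inj c"
    using finite_imp_inj_to_nat_seg[OF finite[of "UNIV :: 'n set"]] by (elim exE conjE)
  define \<psi> where "\<psi> V = (\<Sum>k\<in>UNIV. real (c k) * ((P *v V $ k) \<bullet> (P *v V $ k)))" for V :: "real^'n^'n"
  have "continuous_on {V :: real^'n^'n. orthogonal_matrix V} \<psi>"
    unfolding \<psi>_def
    by (intro continuous_intros bounded_linear.continuous_on[OF matrix_vector_mul_bounded_linear])
  moreover have "{V :: real^'n^'n. orthogonal_matrix V} \<noteq> {}"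
    using orthogonal_matrix_id by blast
  ultimately obtain V :: "real^'n^'n" where V: "orthogonal_matrix V"
    and max: "\<And>W. orthogonal_matrix W \<Longrightarrow> \<psi> W \<le> \<psi> V"
    using continuous_attains_sup[OF compact_orthogonal_matrices] by (metis mem_Collect_eq)
  note ortho = V[unfolded orthogonal_matrix_rows_iff, rule_format]
  have "(P *v V $ i) \<bullet> (P *v V $ j) = 0" if "i \<noteq> j" for i j
  proof -
    define a b where "a = P *v V $ i" and "b = P *v V $ j"
    define W where "W \<theta> = (\<chi> k. if k = i then cos \<theta> *\<^sub>R V $ i + sin \<theta> *\<^sub>R V $ j
      else if k = j then - sin \<theta> *\<^sub>R V $ i + cos \<theta> *\<^sub>R V $ j else V $ k)" for \<theta>
    have sc: "cos \<theta> * cos \<theta> + sin \<theta> * sin \<theta> = 1" "sin \<theta> * sin \<theta> + cos \<theta> * cos \<theta> = 1" for \<theta> :: real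
      using sin_cos_squared_add[of \<theta>] by (simp_all add: power2_eq_square add.commute)
    have W: "orthogonal_matrix (W \<theta>)" for \<theta>
      unfolding orthogonal_matrix_rows_iff
    proof (intro allI)
      fix k l
      have "k = i \<or> k = j \<or> (k \<noteq> i \<and> k \<noteq> j)" "l = i \<or> l = j \<or> (l \<noteq> i \<and> l \<noteq> j)" by auto
      then show "W \<theta> $ k \<bullet> W \<theta> $ l = (if k = l then 1 else 0)"
        using that by (elim disjE; clarsimp simp: W_def ortho inner_add_left inner_add_right inner_diff_left inner_diff_right sc)
    qed
    define r where "r = (\<Sum>k\<in>UNIV - {i, j}. real (c k) * ((P *v V $ k) \<bullet> (P *v V $ k)))"
    define h where "h \<theta> = real (c i) * ((cos \<theta> *\<^sub>R a + sin \<theta> *\<^sub>R b) \<bullet> (cos \<theta> *\<^sub>R a + sin \<theta> *\<^sub>R b))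
       + real (c j) * ((- sin \<theta> *\<^sub>R a + cos \<theta> *\<^sub>R b) \<bullet> (- sin \<theta> *\<^sub>R a + cos \<theta> *\<^sub>R b)) + r" for \<theta>
    have lin: "P *v (x *\<^sub>R u + y *\<^sub>R w) = x *\<^sub>R (P *v u) + y *\<^sub>R (P *v w)" for x y u w
      by (simp add: matrix_vector_right_distrib matrix_vector_mult_scaleR)
    have \<psi>: "\<psi> (W \<theta>) = h \<theta>" for \<theta>
    proof -
      have U: "(UNIV :: 'n set) = insert i (insert j (UNIV - {i, j}))" by auto
      have "\<psi> (W \<theta>) = real (c i) * ((P *v W \<theta> $ i) \<bullet> (P *v W \<theta> $ i))
          + (real (c j) * ((P *v W \<theta> $ j) \<bullet> (P *v W \<theta> $ j))
          + (\<Sum>k\<in>UNIV - {i, j}. real (c k) * ((P *v W \<theta> $ k) \<bullet> (P *v W \<theta> $ k))))"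
        unfolding \<psi>_def by (subst U) (use that in simp)
      moreover have "P *v W \<theta> $ i = cos \<theta> *\<^sub>R a + sin \<theta> *\<^sub>R b"
        by (simp add: W_def lin a_def b_def)
      moreover have "P *v W \<theta> $ j = - sin \<theta> *\<^sub>R a + cos \<theta> *\<^sub>R b"
        using that lin[of "- sin \<theta>"] by (simp add: W_def a_def b_def)
      moreover have "(\<Sum>k\<in>UNIV - {i, j}. real (c k) * ((P *v W \<theta> $ k) \<bullet> (P *v W \<theta> $ k))) = r"
        unfolding r_def by (rule sum.cong) (auto simp: W_def)
      ultimately show ?thesis by (simp add: h_def)
    qed
    have "W 0 = V" by (simp add: W_def vec_eq_iff)
    then have "h \<theta> \<le> h 0" for \<theta> using max[OF W] \<psi> by metis
    moreover have "(h has_real_derivative 2 * (real (c i) - real (c j)) * (a \<bullet> b)) (at 0)"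
    proof -
      have "h = (\<lambda>\<theta>. real (c i) * (cos \<theta> * cos \<theta> * (a \<bullet> a) + 2 * cos \<theta> * sin \<theta> * (a \<bullet> b) + sin \<theta> * sin \<theta> * (b \<bullet> b))
         + real (c j) * (sin \<theta> * sin \<theta> * (a \<bullet> a) - 2 * cos \<theta> * sin \<theta> * (a \<bullet> b) + cos \<theta> * cos \<theta> * (b \<bullet> b)) + r)"
        by (simp add: h_def fun_eq_iff inner_add_left inner_add_right inner_diff_left inner_diff_right
            inner_commute[of b a] algebra_simps)
      then show ?thesis
        by (auto intro!: derivative_eq_intros simp: algebra_simps)
    qed
    ultimately have "2 * (real (c i) - real (c j)) * (a \<bullet> b) = 0"
      by (intro DERIV_local_max[where d = 1 and x = 0 and f = h]) auto
    moreover have "c i \<noteq> c j" using c that by (auto dest: injD)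
    ultimately show ?thesis by (simp add: a_def b_def)
  qed
  with V show ?thesis by (rule that)
qed

text \<open>Bessel's inequality for vectors that are neither normalised nor assumed non-zero: for
  \<open>w i = 0\<close> the summand is 0 because division by zero gives 0. Vanishing singular
  values therefore need no separate treatment.\<close>

lemma bessel_orthogonal:
  fixes y :: "real^'m::finite" and w :: "'i::finite \<Rightarrow> real^'m"
  assumes "\<And>i j. i \<noteq> j \<Longrightarrow> w i \<bullet> w j = 0"
  shows "(\<Sum>i\<in>UNIV. (w i \<bullet> y)\<^sup>2 / (w i \<bullet> w i)) \<le> y \<bullet> y"
proof -
  \<comment> \<open>The orthogonal projection of \<open>y\<close> onto the span of the
    \<open>w i\<close>; the inequality is the non-negativity of the squared length of
    \<open>y - z\<close>.\<close>
  define z where "z = (\<Sum>i\<in>UNIV. ((w i \<bullet> y) / (w i \<bullet> w i)) *\<^sub>R w i)"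
  have wz: "w i \<bullet> z = w i \<bullet> y" for i
  proof -
    have "w i \<bullet> z = (\<Sum>j\<in>UNIV. if j = i then w i \<bullet> y else 0)"
      unfolding z_def inner_sum_right
      by (rule sum.cong) (auto simp: assms)
    then show ?thesis by simp
  qed
  have zv: "z \<bullet> v = (\<Sum>i\<in>UNIV. (w i \<bullet> y) / (w i \<bullet> w i) * (w i \<bullet> v))" for v
    by (simp add: z_def inner_sum_left)
  have zz: "z \<bullet> z = (\<Sum>i\<in>UNIV. (w i \<bullet> y)\<^sup>2 / (w i \<bullet> w i))" "z \<bullet> y = (\<Sum>i\<in>UNIV. (w i \<bullet> y)\<^sup>2 / (w i \<bullet> w i))"
    by (simp_all add: zv wz power2_eq_square)
  have "0 \<le> (y - z) \<bullet> (y - z)" by simp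
  also have "\<dots> = y \<bullet> y - (\<Sum>i\<in>UNIV. (w i \<bullet> y)\<^sup>2 / (w i \<bullet> w i))"
    by (simp add: inner_diff_left inner_diff_right zz inner_commute[of y z])
  finally show ?thesis by simp
qed

text \<open>The second variation in singular-value coordinates. The diagonal terms are controlled by
  Cauchy-Schwarz, which is where the constant \<open>1/(n-1)\<close> is used; each off-diagonal pair only
  needs \<open>\<lambda>\<^sub>i \<lambda>\<^sub>j \<le> 1\<close>.\<close>

lemma second_variation_form_nonneg:
  fixes l :: "'n::finite \<Rightarrow> real" and b :: "'n \<Rightarrow> 'n \<Rightarrow> real"
  assumes n: "CARD('n) \<ge> 2" and l0: "\<And>i. 0 \<le> l i"
    and ll: "\<And>i j. i \<noteq> j \<Longrightarrow> l i * l j \<le> 1 / (real CARD('n) - 1)"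
    and q: "\<And>j. (\<Sum>i\<in>UNIV. (b i j)\<^sup>2) \<le> q j"
  shows "0 \<le> (\<Sum>i\<in>UNIV. l i * b i i / (1 + (l i)\<^sup>2))\<^sup>2 + (\<Sum>j\<in>UNIV. q j / (1 + (l j)\<^sup>2))
     - (\<Sum>i\<in>UNIV. \<Sum>j\<in>UNIV. (l i * b i j + l j * b j i)\<^sup>2 / ((1 + (l i)\<^sup>2) * (1 + (l j)\<^sup>2))) / 2"
proof -
  define D where "D i = 1 + (l i)\<^sup>2" for i
  have D: "D i > 0" for i unfolding D_def by (simp add: add_pos_nonneg)
  \<comment> \<open>With this rescaling the three contributions to the coefficient of
    \<open>(\<beta> i)\<^sup>2\<close> add up to exactly 1, whatever \<open>l i\<close> is.\<close>
  define \<beta> where "\<beta> i = b i i / D i" for i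
  have b\<beta>: "b i i = \<beta> i * D i" for i using D[of i] by (simp add: \<beta>_def)
  define c where "c = 1 / (real CARD('n) - 1)"
  have c: "0 < c" "c \<le> 1" "c * (real CARD('n) - 1) = 1" using n by (auto simp: c_def field_simps)
  \<comment> \<open>The form as a double sum: the square is expanded over pairs and
    \<open>q j\<close> is replaced by its lower bound, the sum of the
    \<open>(b i j)\<^sup>2\<close>.\<close>
  define e where "e i j = (l i * \<beta> i) * (l j * \<beta> j) + (b i j)\<^sup>2 / D j
      - (l i * b i j + l j * b j i)\<^sup>2 / (D i * D j) / 2" for i j
  \<comment> \<open>A lower bound for the symmetrised \<open>e\<close> whose total is 0. The
    \<open>1 + c\<close> on the diagonal makes up for the \<open>c\<close> subtracted there, so that
    \<open>m i i\<close> is \<open>(\<beta> i)\<^sup>2\<close>; summing over all pairs leaves the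
    factor \<open>1 - c * (n - 1)\<close>, which vanishes by the choice of \<open>c\<close>.\<close>
  define m where "m i j = (if j = i then (1 + c) * (\<beta> i)\<^sup>2 else 0) - (c / 2 * (\<beta> i)\<^sup>2 + c / 2 * (\<beta> j)\<^sup>2)" for i j
  have em: "m i j \<le> (e i j + e j i) / 2" for i j
  proof (cases "i = j")
    case True
    have "e i i = (l i)\<^sup>2 * (\<beta> i)\<^sup>2 + (\<beta> i)\<^sup>2 * D i - 2 * (l i)\<^sup>2 * (\<beta> i)\<^sup>2"
      using D[of i] by (simp add: e_def b\<beta> power2_eq_square field_simps)
    then have "e i i = (\<beta> i)\<^sup>2" by (simp add: D_def algebra_simps)
    then show ?thesis using True by (simp add: m_def algebra_simps)
  next
    case False
    have lc: "0 \<le> l i * l j" "l i * l j \<le> c" using ll[OF False] l0 by (auto simp: c_def)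
    have "0 \<le> (b i j)\<^sup>2 / D j + (b j i)\<^sup>2 / D i - (l i * b i j + l j * b j i)\<^sup>2 / (D i * D j)"
    proof -
      have "2 * (l i * l j) * (b i j * b j i) \<le> 2 * (l i * l j) * \<bar>b i j * b j i\<bar>"
        using lc by (intro mult_left_mono) auto
      also have "\<dots> \<le> 2 * 1 * \<bar>b i j * b j i\<bar>"
        using lc c by (intro mult_right_mono) auto
      also have "\<dots> \<le> (b i j)\<^sup>2 + (b j i)\<^sup>2"
        using sum_squares_bound[of "\<bar>b i j\<bar>" "\<bar>b j i\<bar>"] by (simp add: abs_mult)
      finally have "0 \<le> (b i j)\<^sup>2 + (b j i)\<^sup>2 - 2 * (l i * l j) * (b i j * b j i)" by simp
      also have "\<dots> = (b i j)\<^sup>2 * D i + (b j i)\<^sup>2 * D j - (l i * b i j + l j * b j i)\<^sup>2"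
        by (simp add: D_def power2_eq_square algebra_simps)
      finally have "0 \<le> ((b i j)\<^sup>2 * D i + (b j i)\<^sup>2 * D j - (l i * b i j + l j * b j i)\<^sup>2) / (D i * D j)"
        using D[of i] D[of j] by simp
      also have "\<dots> = (b i j)\<^sup>2 / D j + (b j i)\<^sup>2 / D i - (l i * b i j + l j * b j i)\<^sup>2 / (D i * D j)"
        using D[of i] D[of j] by (simp add: add_divide_distrib diff_divide_distrib)
      finally show ?thesis .
    qed
    moreover have "- (c / 2 * (\<beta> i)\<^sup>2 + c / 2 * (\<beta> j)\<^sup>2) \<le> (l i * \<beta> i) * (l j * \<beta> j)"
    proof -
      have "\<bar>(l i * l j) * (\<beta> i * \<beta> j)\<bar> \<le> c * \<bar>\<beta> i * \<beta> j\<bar>"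
        using lc by (simp add: abs_mult mult_right_mono)
      also have "\<dots> \<le> c * (((\<beta> i)\<^sup>2 + (\<beta> j)\<^sup>2) / 2)"
        using sum_squares_bound[of "\<bar>\<beta> i\<bar>" "\<bar>\<beta> j\<bar>"] c by (intro mult_left_mono) (auto simp: abs_mult)
      finally show ?thesis by (simp add: algebra_simps abs_le_iff)
    qed
    moreover have "e i j + e j i = 2 * ((l i * \<beta> i) * (l j * \<beta> j)) + ((b i j)\<^sup>2 / D j + (b j i)\<^sup>2 / D i
        - (l i * b i j + l j * b j i)\<^sup>2 / (D i * D j))"
    proof -
      have "e j i = (l i * \<beta> i) * (l j * \<beta> j) + (b j i)\<^sup>2 / D i - (l i * b i j + l j * b j i)\<^sup>2 / (D i * D j) / 2"
        unfolding e_def by (simp only: mult.commute[of "l j * \<beta> j"] add.commute[of "l j * b j i"] mult.commute[of "D j"])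
      then show ?thesis by (simp add: e_def)
    qed
    ultimately show ?thesis using False by (simp add: m_def)
  qed
  have "(\<Sum>i\<in>UNIV. \<Sum>j\<in>UNIV. m i j) = (1 + c) * (\<Sum>i\<in>UNIV. (\<beta> i)\<^sup>2) - c * real CARD('n) * (\<Sum>i\<in>UNIV. (\<beta> i)\<^sup>2)"
    unfolding m_def
    by (simp add: sum_subtractf sum.distrib sum_distrib_left[symmetric]) (simp add: algebra_simps sum_distrib_left sum_negf)
  also have "\<dots> = (1 - c * (real CARD('n) - 1)) * (\<Sum>i\<in>UNIV. (\<beta> i)\<^sup>2)"
    by (simp add: algebra_simps)
  finally have "(\<Sum>i\<in>UNIV. \<Sum>j\<in>UNIV. m i j) = 0" using c by simp
  moreover have "(\<Sum>i\<in>UNIV. \<Sum>j\<in>UNIV. (e i j + e j i) / 2) = (\<Sum>i\<in>UNIV. \<Sum>j\<in>UNIV. e i j)"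
  proof -
    have "(\<Sum>i\<in>UNIV. \<Sum>j\<in>UNIV. e j i) = (\<Sum>i\<in>UNIV. \<Sum>j\<in>UNIV. e i j)" by (rule sum.swap)
    then show ?thesis by (simp add: sum.distrib flip: sum_divide_distrib)
  qed
  moreover have "(\<Sum>i\<in>UNIV. \<Sum>j\<in>UNIV. m i j) \<le> (\<Sum>i\<in>UNIV. \<Sum>j\<in>UNIV. (e i j + e j i) / 2)"
    by (intro sum_mono em)
  ultimately have "0 \<le> (\<Sum>i\<in>UNIV. \<Sum>j\<in>UNIV. e i j)" by simp
  also have "\<dots> = (\<Sum>i\<in>UNIV. l i * \<beta> i)\<^sup>2 + (\<Sum>j\<in>UNIV. (\<Sum>i\<in>UNIV. (b i j)\<^sup>2) / D j)
     - (\<Sum>i\<in>UNIV. \<Sum>j\<in>UNIV. (l i * b i j + l j * b j i)\<^sup>2 / (D i * D j)) / 2"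
  proof -
    have "(\<Sum>i\<in>UNIV. \<Sum>j\<in>UNIV. (b i j)\<^sup>2 / D j) = (\<Sum>j\<in>UNIV. (\<Sum>i\<in>UNIV. (b i j)\<^sup>2) / D j)"
      by (subst sum.swap) (simp add: sum_divide_distrib)
    moreover have "(\<Sum>i\<in>UNIV. \<Sum>j\<in>UNIV. (l i * \<beta> i) * (l j * \<beta> j)) = (\<Sum>i\<in>UNIV. l i * \<beta> i)\<^sup>2"
      by (simp add: power2_eq_square sum_product)
    ultimately show ?thesis
      unfolding e_def by (simp add: sum_subtractf sum.distrib sum_divide_distrib)
  qed
  \<comment> \<open>Going back from the sums of squares to \<open>q j\<close>: the part of the
    variation orthogonal to the image only increases the form.\<close>
  also have "\<dots> \<le> (\<Sum>i\<in>UNIV. l i * \<beta> i)\<^sup>2 + (\<Sum>j\<in>UNIV. q j / D j)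
     - (\<Sum>i\<in>UNIV. \<Sum>j\<in>UNIV. (l i * b i j + l j * b j i)\<^sup>2 / (D i * D j)) / 2"
    by (intro diff_right_mono add_left_mono sum_mono divide_right_mono q) (use D in \<open>auto intro: less_imp_le\<close>)
  finally show ?thesis by (simp add: \<beta>_def D_def)
qed

section \<open>The area integrand\<close>

lemma sqrt_det_has_derivative:
  fixes G :: "real \<Rightarrow> real^'n::finite^'n"
  assumes G: "\<And>i j. ((\<lambda>s. G s $ i $ j) has_real_derivative G' $ i $ j) (at t)" and pos: "det (G t) > 0"
  shows "((\<lambda>s. sqrt (det (G s))) has_real_derivative
    sqrt (det (G t)) / 2 * trace (matrix_inv (G t) ** G')) (at t)"
proof -
  have "G t ** matrix_inv (G t) = mat 1" using pos by (intro matrix_inv_inverse) simp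
  from DERIV_chain2[OF DERIV_real_sqrt[OF pos] det_has_derivative[OF G this]]
  have "((\<lambda>s. sqrt (det (G s))) has_real_derivative
    inverse (sqrt (det (G t))) / 2 * (det (G t) * trace (matrix_inv (G t) ** G'))) (at t)" .
  moreover have "inverse (sqrt (det (G t))) * det (G t) = sqrt (det (G t))"
    using pos by (simp add: field_simps)
  then have "inverse (sqrt (det (G t))) / 2 * (det (G t) * x) = sqrt (det (G t)) / 2 * x" for x
    by (metis (no_types, lifting) mult.assoc mult.commute times_divide_eq_left)
  ultimately show ?thesis by (simp only:)
qed

text \<open>Cramer's rule gives differentiability, and differentiating
  \<open>G s ** matrix_inv (G s) = mat 1\<close> then determines the derivative.\<close>

lemma matrix_inv_has_derivative:
  fixes G :: "real \<Rightarrow> real^'n::finite^'n"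
  assumes G: "\<And>i j. ((\<lambda>s. G s $ i $ j) has_real_derivative G' $ i $ j) (at t)" and d: "\<And>s. det (G s) \<noteq> 0"
  shows "((\<lambda>s. matrix_inv (G s) $ k $ l) has_real_derivative
    (- (matrix_inv (G t) ** G' ** matrix_inv (G t))) $ k $ l) (at t)"
proof -
  have "(\<lambda>s. matrix_inv (G s) $ i $ j) differentiable (at t)" for i j
    by (rule differentiable_matrix_inv[OF _ d]) (use G in \<open>auto simp: real_differentiable_def\<close>)
  then have "\<exists>B'. \<forall>i j. ((\<lambda>s. matrix_inv (G s) $ i $ j) has_real_derivative B' i j) (at t)"
    unfolding real_differentiable_def by metis
  then obtain B0 where B0: "\<And>i j. ((\<lambda>s. matrix_inv (G s) $ i $ j) has_real_derivative B0 i j) (at t)"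
    by blast
  define B' where "B' = (\<chi> i j. B0 i j)"
  have B: "((\<lambda>s. matrix_inv (G s) $ i $ j) has_real_derivative B' $ i $ j) (at t)" for i j
    using B0 by (simp add: B'_def)
  have "(G' ** matrix_inv (G t) + G t ** B') $ i $ j = 0" for i j
  proof -
    have "((\<lambda>s. (G s ** matrix_inv (G s)) $ i $ j) has_real_derivative
       (\<Sum>k\<in>UNIV. G' $ i $ k * matrix_inv (G t) $ k $ j + B' $ k $ j * G t $ i $ k)) (at t)"
      unfolding matrix_matrix_mult_def by (simp, intro DERIV_sum DERIV_mult G B)
    moreover have "(\<lambda>s. (G s ** matrix_inv (G s)) $ i $ j) = (\<lambda>s. mat 1 $ i $ j)"
      by (simp add: matrix_inv_inverse[OF d])
    ultimately have "((\<lambda>s. mat 1 $ i $ j :: real) has_real_derivative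
       (\<Sum>k\<in>UNIV. G' $ i $ k * matrix_inv (G t) $ k $ j + B' $ k $ j * G t $ i $ k)) (at t)"
      by (simp only:)
    from DERIV_unique[OF this DERIV_const]
    have "(\<Sum>k\<in>UNIV. G' $ i $ k * matrix_inv (G t) $ k $ j + B' $ k $ j * G t $ i $ k) = 0" .
    then show ?thesis
      by (simp add: matrix_matrix_mult_def sum.distrib mult.commute)
  qed
  then have "G' ** matrix_inv (G t) + G t ** B' = 0"
    by (simp add: vec_eq_iff)
  then have "G t ** B' = - (G' ** matrix_inv (G t))"
    by (simp add: eq_neg_iff_add_eq_0 add.commute)
  then have "matrix_inv (G t) ** (G t ** B') = matrix_inv (G t) ** (- (G' ** matrix_inv (G t)))"
    by simp
  moreover have "matrix_inv (G t) ** (G t ** B') = B'"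
    by (simp add: matrix_mul_assoc matrix_inv_inverse[OF d])
  moreover have "matrix_inv (G t) ** (- (G' ** matrix_inv (G t))) = - (matrix_inv (G t) ** G' ** matrix_inv (G t))"
    by (simp add: matrix_mul_assoc[symmetric]) (simp add: matrix_matrix_mult_def vec_eq_iff sum_negf)
  ultimately show ?thesis using B[of k l] by simp
qed

section \<open>The metric and the area integrand as functions of the Jacobian alone\<close>

definition graph_metric :: "real^'n::finite^'m::finite \<Rightarrow> real^'n^'n"
  where "graph_metric P = mat 1 + transpose P ** P"

definition area_integrand :: "real^'n::finite^'m::finite \<Rightarrow> real"
  where "area_integrand P = sqrt (det (graph_metric P))"

text \<open>The differential of \<open>area_integrand\<close> at \<open>P\<close> in the direction
  \<open>Q\<close>. For \<open>P\<close> the Jacobian of \<open>f\<close> it pairs \<open>Q\<close>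
  with the flux whose divergence vanishes in the minimal surface system.\<close>

definition area_deriv :: "real^'n::finite^'m::finite \<Rightarrow> real^'n^'m \<Rightarrow> real"
  where "area_deriv P Q = area_integrand P * trace (matrix_inv (graph_metric P) ** (transpose P ** Q))"

lemma matrix_add_rdistrib: "(A + B) ** C = A ** C + B ** (C :: 'a::semiring_1^'n::finite^'k::finite)"
  by (simp add: matrix_matrix_mult_def vec_eq_iff distrib_right sum.distrib)

lemma graph_metric_nth:
  "graph_metric P $ i $ j = (if i = j then 1 else 0) + (\<Sum>k\<in>UNIV. P $ k $ i * P $ k $ j)"
  by (simp add: graph_metric_def mat_def matrix_matrix_mult_def transpose_def)

text \<open>The metric in the basis of the rows of \<open>V\<close>. When these have orthogonal
  images under \<open>P\<close>, it is diagonal with entries 1 + \<lambda>_i^2.\<close>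

lemma graph_metric_conj:
  fixes P :: "real^'n::finite^'m::finite" and V :: "real^'n^'n"
  assumes V: "orthogonal_matrix V"
  shows "(V ** graph_metric P ** transpose V) $ i $ j = (if i = j then 1 else 0) + (P *v V $ i) \<bullet> (P *v V $ j)"
proof -
  have "V ** graph_metric P ** transpose V = V ** transpose V + (V ** transpose P) ** (P ** transpose V)"
    by (simp add: graph_metric_def matrix_add_ldistrib matrix_add_rdistrib matrix_mul_assoc)
  moreover have "V ** transpose V = mat 1" using V by (simp add: orthogonal_matrix_def)
  moreover have "(P ** transpose V) $ k $ j = (P *v V $ j) $ k" for k j
    by (simp add: matrix_matrix_mult_def matrix_vector_mult_def transpose_def)
  moreover have "(V ** transpose P) $ i $ k = (P *v V $ i) $ k" for k
    by (simp add: matrix_matrix_mult_def matrix_vector_mult_def transpose_def mult.commute)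
  ultimately show ?thesis
    by (simp add: mat_def matrix_matrix_mult_def[of "V ** transpose P"] inner_vec_def)
qed

lemma det_orthogonal_conj:
  fixes V :: "real^'n::finite^'n"
  assumes V: "orthogonal_matrix V"
  shows "det (V ** A ** transpose V) = det A"
proof -
  have "det V * det V = 1"
    using V by (metis det_I det_mul det_transpose orthogonal_matrix_def)
  then show ?thesis by (simp add: det_mul algebra_simps)
qed

text \<open>In a basis with orthogonal images the metric is diagonal with all entries at least
  1.\<close>

lemma det_graph_metric_ge_1: "det (graph_metric P) \<ge> 1"
proof -
  obtain V where V: "orthogonal_matrix V"
    and o: "\<And>i j. i \<noteq> j \<Longrightarrow> (P *v V $ i) \<bullet> (P *v V $ j) = 0"
    using orthonormal_basis_orthogonal_images[of P] by blast
  have "det (graph_metric P) = det (V ** graph_metric P ** transpose V)"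
    using V by (simp add: det_orthogonal_conj)
  also have "\<dots> = (\<Prod>i\<in>UNIV. (V ** graph_metric P ** transpose V) $ i $ i)"
    by (rule det_diagonal) (simp add: graph_metric_conj[OF V] o)
  also have "\<dots> \<ge> 1"
    by (rule prod_ge_1) (simp add: graph_metric_conj[OF V])
  finally show ?thesis .
qed

lemma det_graph_metric_pos [simp]: "det (graph_metric P) > 0" "det (graph_metric P) \<noteq> 0"
  using det_graph_metric_ge_1[of P] by auto

lemma area_integrand_pos: "area_integrand P > 0"
  by (simp add: area_integrand_def)

lemma graph_metric_line_has_derivative:
  "((\<lambda>s. graph_metric (P + s *\<^sub>R Q) $ i $ j) has_real_derivative
    (transpose (P + t *\<^sub>R Q) ** Q + transpose Q ** (P + t *\<^sub>R Q)) $ i $ j) (at t)"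
  unfolding graph_metric_nth
  by (auto intro!: derivative_eq_intros simp: matrix_matrix_mult_def transpose_def sum.distrib sum_distrib_left algebra_simps)

lemma transpose_add: "transpose (A + B) = transpose A + transpose B"
  by (simp add: transpose_def vec_eq_iff)

lemma transpose_graph_metric [simp]: "transpose (graph_metric P) = graph_metric P"
  by (simp add: graph_metric_def transpose_add matrix_transpose_mul transpose_mat)

lemma transpose_matrix_inv_graph_metric: "transpose (matrix_inv (graph_metric P)) = matrix_inv (graph_metric P)"
proof -
  let ?g = "graph_metric P" and ?B = "matrix_inv (graph_metric P)"
  have "?g ** ?B = mat 1" "?B ** ?g = mat 1" by (simp_all add: matrix_inv_inverse)
  then have "?g ** transpose ?B = mat 1"
    by (metis matrix_transpose_mul transpose_graph_metric transpose_mat)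
  then show ?thesis
    using \<open>?B ** ?g = mat 1\<close> by (metis matrix_mul_assoc matrix_mul_lid matrix_mul_rid)
qed

lemma trace_transpose: "trace (transpose A) = trace A"
  by (simp add: trace_def transpose_def)

text \<open>The metric has derivative \<open>transpose P ** Q\<close> plus its transpose. Both
  halves have the same trace against the symmetric inverse metric, which cancels the 1/2 from the
  square root.\<close>

lemma area_integrand_has_derivative:
  "((\<lambda>s. area_integrand (P + s *\<^sub>R Q)) has_real_derivative area_deriv (P + t *\<^sub>R Q) Q) (at t)"
proof -
  let ?R = "P + t *\<^sub>R Q"
  let ?B = "matrix_inv (graph_metric ?R)"
  have "trace (?B ** (transpose Q ** ?R)) = trace (transpose (?B ** (transpose Q ** ?R)))"
    by (simp add: trace_transpose)
  also have "\<dots> = trace ((transpose ?R ** Q) ** ?B)"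
    by (simp add: matrix_transpose_mul transpose_matrix_inv_graph_metric)
  also have "\<dots> = trace (?B ** (transpose ?R ** Q))"
    by (rule trace_mul_sym)
  finally have "trace (?B ** (transpose ?R ** Q + transpose Q ** ?R)) = 2 * trace (?B ** (transpose ?R ** Q))"
    by (simp add: matrix_add_ldistrib trace_add)
  then show ?thesis
    using sqrt_det_has_derivative[OF graph_metric_line_has_derivative[of P Q], where t = t]
    by (simp add: area_deriv_def area_integrand_def)
qed

text \<open>\<open>G s\<close> models the metric along a line of Jacobians in a singular basis, with
  \<open>D\<close> the diagonal metric at \<open>s = 0\<close>. In the bracket, the square comes
  from differentiating the factor \<open>sqrt (det (G s))\<close>, the sum with \<open>R\<close>
  from the explicit \<open>2 * s\<close>, and the negative double sum from the inverse
  matrix.\<close>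

lemma sqrt_det_second_derivative_at_diagonal:
  fixes S R :: "real^'n::finite^'n"
  assumes G: "\<And>s i j. G s $ i $ j = (if i = j then D i else 0) + s * S $ i $ j + s\<^sup>2 * R $ i $ j"
    and pos: "\<And>s. det (G s) > 0" and D: "\<And>i. D i \<noteq> 0" and sym: "\<And>i j. S $ i $ j = S $ j $ i"
  shows "((\<lambda>s. sqrt (det (G s)) / 2 * trace (matrix_inv (G s) ** (S + (2 * s) *\<^sub>R R))) has_real_derivative
    sqrt (det (G 0)) * ((\<Sum>i\<in>UNIV. S $ i $ i / 2 / D i)\<^sup>2 + (\<Sum>i\<in>UNIV. R $ i $ i / D i)
      - (\<Sum>i\<in>UNIV. \<Sum>j\<in>UNIV. (S $ i $ j)\<^sup>2 / (D i * D j)) / 2)) (at 0)"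
    and "((\<lambda>s. sqrt (det (G s))) has_real_derivative
      sqrt (det (G t)) / 2 * trace (matrix_inv (G t) ** (S + (2 * t) *\<^sub>R R))) (at t)"
proof -
  have d: "det (G s) \<noteq> 0" for s using pos[of s] by simp
  have Gd: "((\<lambda>s. G s $ i $ j) has_real_derivative (S + (2 * t) *\<^sub>R R) $ i $ j) (at t)" for i j t
    unfolding G by (auto intro!: derivative_eq_intros)
  show h': "((\<lambda>s. sqrt (det (G s))) has_real_derivative
      sqrt (det (G t)) / 2 * trace (matrix_inv (G t) ** (S + (2 * t) *\<^sub>R R))) (at t)" for t
    by (rule sqrt_det_has_derivative[OF Gd pos])
  let ?B = "matrix_inv (G 0)"
  \<comment> \<open>The inverse of \<open>G 0\<close>; multiplying by it on either side divides
    entries by the \<open>D i\<close>.\<close>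
  define E where "E = (\<chi> i j. if i = j then 1 / D i else (0 :: real))"
  have E: "(M ** E) $ i $ j = M $ i $ j / D j" "(E ** M) $ i $ j = M $ i $ j / D i" for M i j
  proof -
    have "(M ** E) $ i $ j = (\<Sum>k\<in>UNIV. if k = j then M $ i $ j / D j else 0)"
      unfolding matrix_matrix_mult_def vec_lambda_beta by (rule sum.cong) (auto simp: E_def)
    then show "(M ** E) $ i $ j = M $ i $ j / D j" by simp
    have "(E ** M) $ i $ j = (\<Sum>k\<in>UNIV. if k = i then M $ i $ j / D i else 0)"
      unfolding matrix_matrix_mult_def vec_lambda_beta by (rule sum.cong) (auto simp: E_def)
    then show "(E ** M) $ i $ j = M $ i $ j / D i" by simp
  qed
  have "G 0 ** E = mat 1"
    using D by (simp add: vec_eq_iff E G mat_def)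
  then have BE: "?B = E"
    using matrix_inv_inverse[OF d] by (metis matrix_mul_assoc matrix_mul_lid matrix_mul_rid)
  have EME: "(E ** M ** E) $ i $ j = M $ i $ j / (D i * D j)" for M i j
    by (simp add: E)
  have S0: "S + (2 * 0) *\<^sub>R R = S" by simp
  have B': "((\<lambda>s. matrix_inv (G s) $ i $ j) has_real_derivative - (S $ i $ j / (D i * D j))) (at 0)" for i j
    using matrix_inv_has_derivative[where G = G and t = 0 and k = i and l = j, OF Gd d] unfolding S0 BE
    by (simp add: EME)
  have tr: "trace (E ** M) = (\<Sum>i\<in>UNIV. M $ i $ i / D i)" for M
    by (simp add: trace_def E)
  have "((\<lambda>s. trace (matrix_inv (G s) ** (S + (2 * s) *\<^sub>R R))) has_real_derivative
     (\<Sum>i\<in>UNIV. \<Sum>k\<in>UNIV. - (S $ i $ k / (D i * D k)) * (S + (2 * 0) *\<^sub>R R) $ k $ i + (2 * R $ k $ i) * matrix_inv (G 0) $ i $ k)) (at 0)"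
    unfolding trace_def matrix_matrix_mult_def
    by (simp only: vec_lambda_beta, intro DERIV_sum DERIV_mult B') (auto intro!: derivative_eq_intros)
  moreover have "(\<Sum>i\<in>UNIV. \<Sum>k\<in>UNIV. - (S $ i $ k / (D i * D k)) * (S + (2 * 0) *\<^sub>R R) $ k $ i + (2 * R $ k $ i) * matrix_inv (G 0) $ i $ k)
     = 2 * ((\<Sum>i\<in>UNIV. R $ i $ i / D i) - (\<Sum>i\<in>UNIV. \<Sum>j\<in>UNIV. (S $ i $ j)\<^sup>2 / (D i * D j)) / 2)"
  proof -
    have "(\<Sum>i\<in>UNIV. \<Sum>k\<in>UNIV. (2 * R $ k $ i) * E $ i $ k) = 2 * (\<Sum>i\<in>UNIV. R $ i $ i / D i)"
    proof -
      have "(\<Sum>k\<in>UNIV. (2 * R $ k $ i) * E $ i $ k) = (\<Sum>k\<in>UNIV. if k = i then 2 * (R $ i $ i / D i) else 0)" for i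
        by (rule sum.cong) (auto simp: E_def)
      then show ?thesis by (simp add: sum_distrib_left)
    qed
    moreover have "(\<Sum>i\<in>UNIV. \<Sum>k\<in>UNIV. - (S $ i $ k / (D i * D k)) * S $ k $ i)
        = - (\<Sum>i\<in>UNIV. \<Sum>j\<in>UNIV. (S $ i $ j)\<^sup>2 / (D i * D j))"
      proof -
      have "- (S $ i $ k / (D i * D k)) * S $ k $ i = - ((S $ i $ k)\<^sup>2 / (D i * D k))" for i k
        using sym[of k i] by (simp add: power2_eq_square)
      then show ?thesis by (simp only: sum_negf)
    qed
    ultimately show ?thesis
      unfolding S0 BE sum.distrib by simp
  qed
  ultimately have "((\<lambda>s. trace (matrix_inv (G s) ** (S + (2 * s) *\<^sub>R R))) has_real_derivative
     2 * ((\<Sum>i\<in>UNIV. R $ i $ i / D i) - (\<Sum>i\<in>UNIV. \<Sum>j\<in>UNIV. (S $ i $ j)\<^sup>2 / (D i * D j)) / 2)) (at 0)"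
    by simp
  from DERIV_mult[OF DERIV_cdivide[OF h'[of 0], of 2] this]
  show "((\<lambda>s. sqrt (det (G s)) / 2 * trace (matrix_inv (G s) ** (S + (2 * s) *\<^sub>R R))) has_real_derivative
    sqrt (det (G 0)) * ((\<Sum>i\<in>UNIV. S $ i $ i / 2 / D i)\<^sup>2 + (\<Sum>i\<in>UNIV. R $ i $ i / D i)
      - (\<Sum>i\<in>UNIV. \<Sum>j\<in>UNIV. (S $ i $ j)\<^sup>2 / (D i * D j)) / 2)) (at 0)"
  proof (rule DERIV_cong)
    have half: "(\<Sum>i\<in>UNIV. S $ i $ i / 2 / D i) = (\<Sum>i\<in>UNIV. S $ i $ i / D i) / 2"
      by (simp add: sum_divide_distrib mult.commute)
    show "sqrt (det (G 0)) / 2 * trace (?B ** (S + (2 * 0) *\<^sub>R R)) / 2 * trace (?B ** (S + (2 * 0) *\<^sub>R R))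
       + 2 * ((\<Sum>i\<in>UNIV. R $ i $ i / D i) - (\<Sum>i\<in>UNIV. \<Sum>j\<in>UNIV. (S $ i $ j)\<^sup>2 / (D i * D j)) / 2) * (sqrt (det (G 0)) / 2)
      = sqrt (det (G 0)) * ((\<Sum>i\<in>UNIV. S $ i $ i / 2 / D i)\<^sup>2 + (\<Sum>i\<in>UNIV. R $ i $ i / D i)
      - (\<Sum>i\<in>UNIV. \<Sum>j\<in>UNIV. (S $ i $ j)\<^sup>2 / (D i * D j)) / 2)"
      unfolding S0 BE tr half by (simp only: power2_eq_square) (simp add: algebra_simps)
  qed
qed

text \<open>Conjugation by an orthogonal \<open>V\<close> with orthogonal images does not change the
  determinant and makes the metric at \<open>s = 0\<close> diagonal. On two rows of \<open>V\<close>
  the hypothesis, a bound on the area spanned by the images of an orthonormal pair, reads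
  \<open>l i * l j \<le> 1 / (real CARD('n) - 1)\<close>.\<close>

lemma area_deriv_has_nonneg_derivative:
  fixes P Q :: "real^'n::finite^'m::finite"
  assumes n: "CARD('n) \<ge> 2"
    and P: "\<And>v w. norm v = 1 \<Longrightarrow> norm w = 1 \<Longrightarrow> v \<bullet> w = 0 \<Longrightarrow>
      sqrt (((P *v v) \<bullet> (P *v v)) * ((P *v w) \<bullet> (P *v w)) - ((P *v v) \<bullet> (P *v w))\<^sup>2) \<le> 1 / (real CARD('n) - 1)"
  obtains D where "0 \<le> D" "((\<lambda>s. area_deriv (P + s *\<^sub>R Q) Q) has_real_derivative D) (at 0)"
proof -
  obtain V where V: "orthogonal_matrix V"
    and o: "\<And>i j. i \<noteq> j \<Longrightarrow> (P *v V $ i) \<bullet> (P *v V $ j) = 0"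
    using orthonormal_basis_orthogonal_images[of P] by blast
  define p q where "p i = P *v V $ i" and "q i = Q *v V $ i" for i
  have op: "i \<noteq> j \<Longrightarrow> p i \<bullet> p j = 0" for i j using o by (simp add: p_def)
  define l where "l i = norm (p i)" for i
  \<comment> \<open>The component of \<open>q j\<close> along the normalised \<open>p i\<close>. For
    \<open>l i = 0\<close> it is 0 by the convention on division, so
    \<open>l i * b i j = p i \<bullet> q j\<close> holds in every case.\<close>
  define b where "b i j = (p i \<bullet> q j) / l i" for i j
  define Dg where "Dg i = 1 + (l i)\<^sup>2" for i
  define S R where "S = (\<chi> i j. p i \<bullet> q j + p j \<bullet> q i)" and "R = (\<chi> i j. q i \<bullet> q j)"
  define G where "G s = V ** graph_metric (P + s *\<^sub>R Q) ** transpose V" for s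
  have lb: "l i * b i j = p i \<bullet> q j" for i j by (simp add: b_def l_def)
  have G: "G s $ i $ j = (if i = j then Dg i else 0) + s * S $ i $ j + s\<^sup>2 * R $ i $ j" for s i j
  proof -
    have "G s $ i $ j = (if i = j then 1 else 0) + (p i + s *\<^sub>R q i) \<bullet> (p j + s *\<^sub>R q j)"
      unfolding G_def graph_metric_conj[OF V]
      by (simp add: p_def q_def matrix_vector_mult_add_rdistrib scaleR_matrix_vector_assoc)
    moreover have "Dg i = 1 + p i \<bullet> p i" by (simp add: Dg_def l_def power2_norm_eq_inner)
    ultimately show ?thesis
      using op[of i j] by (cases "i = j") (simp_all add: S_def R_def inner_add_left inner_add_right
          inner_commute[of "q i" "p j"] inner_commute[of "q j" "p j"] power2_eq_square algebra_simps)
  qed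
  have detG: "det (G s) = det (graph_metric (P + s *\<^sub>R Q))" for s
    unfolding G_def by (rule det_orthogonal_conj[OF V])
  have Dg: "Dg i \<noteq> 0" for i
    unfolding Dg_def by (metis add_pos_nonneg less_irrefl zero_le_power2 zero_less_one)
  have pos: "det (G s) > 0" for s by (simp add: detG)
  have sym: "S $ i $ j = S $ j $ i" for i j by (simp add: S_def)
  note der = sqrt_det_second_derivative_at_diagonal[OF G pos Dg sym]
  let ?D = "sqrt (det (G 0)) * ((\<Sum>i\<in>UNIV. S $ i $ i / 2 / Dg i)\<^sup>2 + (\<Sum>i\<in>UNIV. R $ i $ i / Dg i)
      - (\<Sum>i\<in>UNIV. \<Sum>j\<in>UNIV. (S $ i $ j)\<^sup>2 / (Dg i * Dg j)) / 2)"
  \<comment> \<open>Both sides are derivatives of the same function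
    \<open>s \<mapsto> area_integrand (P + s *\<^sub>R Q)\<close>; uniqueness transfers the
    computation in the singular basis to \<open>area_deriv\<close>.\<close>
  have "area_deriv (P + t *\<^sub>R Q) Q = sqrt (det (G t)) / 2 * trace (matrix_inv (G t) ** (S + (2 * t) *\<^sub>R R))" for t
    by (rule DERIV_unique[OF area_integrand_has_derivative])
       (use der(2)[of t] in \<open>simp add: area_integrand_def detG\<close>)
  then have 1: "((\<lambda>s. area_deriv (P + s *\<^sub>R Q) Q) has_real_derivative ?D) (at 0)"
    using der(1) by (simp only:)
  have "0 \<le> (\<Sum>i\<in>UNIV. l i * b i i / (1 + (l i)\<^sup>2))\<^sup>2 + (\<Sum>j\<in>UNIV. (q j \<bullet> q j) / (1 + (l j)\<^sup>2))
     - (\<Sum>i\<in>UNIV. \<Sum>j\<in>UNIV. (l i * b i j + l j * b j i)\<^sup>2 / ((1 + (l i)\<^sup>2) * (1 + (l j)\<^sup>2))) / 2"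
  proof (rule second_variation_form_nonneg[OF n])
    show "l i * l j \<le> 1 / (real CARD('n) - 1)" if "i \<noteq> j" for i j
    proof -
      have "norm (V $ i) = 1" "norm (V $ j) = 1" "V $ i \<bullet> V $ j = 0"
        using V[unfolded orthogonal_matrix_rows_iff] that by (auto simp: norm_eq_sqrt_inner)
      from P[OF this] show ?thesis
        using o[OF that] by (simp add: l_def p_def real_sqrt_mult norm_eq_sqrt_inner)
    qed
    show "(\<Sum>i\<in>UNIV. (b i j)\<^sup>2) \<le> q j \<bullet> q j" for j
      using bessel_orthogonal[of p "q j"] op
      by (simp add: b_def l_def power_divide power2_norm_eq_inner)
  qed (simp add: l_def)
  then have "0 \<le> (\<Sum>i\<in>UNIV. S $ i $ i / 2 / Dg i)\<^sup>2 + (\<Sum>i\<in>UNIV. R $ i $ i / Dg i)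
      - (\<Sum>i\<in>UNIV. \<Sum>j\<in>UNIV. (S $ i $ j)\<^sup>2 / (Dg i * Dg j)) / 2"
    by (simp add: lb Dg_def S_def R_def)
  then have "0 \<le> ?D" using pos[of 0] by (intro mult_nonneg_nonneg) auto
  from this 1 show ?thesis by (rule that)
qed

section \<open>A quadratic lower bound for the area integrand, uniform on compact sets\<close>

text \<open>The pair of base matrix and direction plays the role of the space variable, so the
  second derivative along lines is jointly continuous in time, base and direction.\<close>

lemma C2_in_time_area_line:
  "C2_in_time \<epsilon> UNIV (\<lambda>s p. area_integrand (fst p + s *\<^sub>R snd p))"
  unfolding area_integrand_def
proof (intro C2_in_time_sqrt C2_in_time_det)
  show "C2_in_time \<epsilon> UNIV (\<lambda>s p. graph_metric (fst p + s *\<^sub>R snd p) $ i $ j)" for i j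
    unfolding graph_metric_nth vector_add_component vector_scaleR_component real_scaleR_def
    by (intro C2_in_time_add C2_in_time_const C2_in_time_sum C2_in_time_mult C2_in_time_time continuous_intros)
qed simp

lemma area_deriv_scale: "area_deriv P (r *\<^sub>R Q) = r * area_deriv P Q"
  by (simp add: area_deriv_def trace_def matrix_matrix_mult_def sum_distrib_left algebra_simps)

text \<open>Second-order Taylor expansion along the direction of \<open>Q\<close>. The second
  derivative is known to be non-negative only at the base points in \<open>C\<close>; by uniform
  continuity it is at least \<open>- 2 * e\<close> shortly after, and the Taylor coefficient 1/2
  turns this into \<open>e\<close>.\<close>

lemma area_integrand_taylor_lower_bound:
  fixes C :: "(real^'n::finite^'m::finite) set"
  assumes C: "compact C"
    and nonneg: "\<And>P Q. P \<in> C \<Longrightarrow> \<exists>D\<ge>0. ((\<lambda>s. area_deriv (P + s *\<^sub>R Q) Q) has_real_derivative D) (at 0)"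
    and e: "0 < e"
  obtains \<delta> where "\<delta> > 0"
    "\<And>P Q. P \<in> C \<Longrightarrow> norm Q \<le> \<delta> \<Longrightarrow> area_integrand (P + Q) \<ge> area_integrand P + area_deriv P Q - e * (norm Q)\<^sup>2"
proof -
  obtain h' h'' :: "real \<Rightarrow> (real^'n^'m) \<times> (real^'n^'m) \<Rightarrow> real" where h: "\<And>t x. t \<in> {-2<..<2} \<Longrightarrow> ((\<lambda>s. area_integrand (fst x + s *\<^sub>R snd x)) has_real_derivative h' t x) (at t)"
      "\<And>t x. t \<in> {-2<..<2} \<Longrightarrow> ((\<lambda>s. h' s x) has_real_derivative h'' t x) (at t)"
    and c: "continuous_on ({-2<..<2} \<times> UNIV) (\<lambda>p. h'' (fst p) (snd p))"
    by (rule C2_in_timeE[OF C2_in_time_area_line[of 2]])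
       (auto simp: has_real_derivative_iff_has_vector_derivative)
  have h'_eq: "h' t x = area_deriv (fst x + t *\<^sub>R snd x) (snd x)" if "t \<in> {-2<..<2}" for t x
    using h(1)[OF that] area_integrand_has_derivative by (rule DERIV_unique)
  have h''0: "h'' 0 (P, Q) \<ge> 0" if PC: "P \<in> C" for P Q
  proof -
    obtain D where "0 \<le> D" and D: "((\<lambda>s. area_deriv (P + s *\<^sub>R Q) Q) has_real_derivative D) (at 0)"
      using nonneg[OF PC] by blast
    have "((\<lambda>s. h' s (P, Q)) has_real_derivative D) (at 0)"
      by (rule has_field_derivative_transform_within_open[OF D, where S = "{-2<..<2}"]) (auto simp: h'_eq)
    then have "h'' 0 (P, Q) = D" using h(2)[of 0 "(P, Q)"] by (auto intro: DERIV_unique)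
    then show ?thesis using \<open>0 \<le> D\<close> by simp
  qed
  \<comment> \<open>Homogeneity in \<open>Q\<close> reduces to unit directions, which is where
    compactness comes from. Times up to 1 stay well inside the interval of radius 2 chosen
    above.\<close>
  let ?K = "{-1..1::real} \<times> (C \<times> sphere (0 :: real^'n^'m) 1)"
  have "compact ?K" using C by (intro compact_Times) auto
  moreover have "continuous_on ?K (\<lambda>p. h'' (fst p) (snd p))"
    by (rule continuous_on_subset[OF c]) auto
  ultimately have "uniformly_continuous_on ?K (\<lambda>p. h'' (fst p) (snd p))"
    by (rule compact_uniformly_continuous[rotated])
  then obtain d where d: "d > 0" "\<And>p p'. p \<in> ?K \<Longrightarrow> p' \<in> ?K \<Longrightarrow> dist p' p < d \<Longrightarrow>
      dist (h'' (fst p') (snd p')) (h'' (fst p) (snd p)) < 2 * e"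
    unfolding uniformly_continuous_on_def using e by (metis mult_pos_pos zero_less_numeral)
  \<comment> \<open>The 1 keeps the times in \<open>{-1..1}\<close>; halving \<open>d\<close> turns
    the weak bound on \<open>norm Q\<close> into the strict one that uniform continuity asks
    for.\<close>
  show ?thesis
  proof (rule that[of "min 1 (d / 2)"])
    show "min 1 (d / 2) > 0" using d(1) by simp
    fix P Q :: "real^'n^'m" assume P: "P \<in> C" and Q: "norm Q \<le> min 1 (d / 2)"
    show "area_integrand (P + Q) \<ge> area_integrand P + area_deriv P Q - e * (norm Q)\<^sup>2"
    proof (cases "Q = 0")
      case True
      then show ?thesis using area_deriv_scale[of P 0 Q] by simp
    next
      case False
      define r where "r = norm Q"
      define U where "U = (1 / r) *\<^sub>R Q"
      have r: "0 < r" "r \<le> 1" "r < d" using False Q d(1) by (auto simp: r_def)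
      have U: "norm U = 1" "r *\<^sub>R U = Q" using False by (auto simp: U_def r_def)
      define diff where "diff m = (if m = 0 then (\<lambda>s. area_integrand (P + s *\<^sub>R U))
         else if m = 1 then (\<lambda>s. h' s (P, U)) else (\<lambda>s. h'' s (P, U)))" for m :: nat
      have "\<exists>t>0. t < r \<and> area_integrand (P + r *\<^sub>R U) = (\<Sum>m<2. diff m 0 / fact m * r ^ m) + diff 2 t / fact 2 * r ^ 2"
      proof (rule Maclaurin)
        show "\<forall>m t. m < 2 \<and> 0 \<le> t \<and> t \<le> r \<longrightarrow> (diff m has_real_derivative diff (Suc m) t) (at t)"
          using r h[of _ "(P, U)"] by (auto simp: diff_def less_2_cases_iff)
      qed (use r in \<open>auto simp: diff_def\<close>)
      then obtain t where t: "0 < t" "t < r"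
        and eq: "area_integrand (P + Q) = area_integrand P + h' 0 (P, U) * r + h'' t (P, U) / 2 * r\<^sup>2"
        using U by (auto simp: diff_def numeral_2_eq_2)
      have "dist (h'' t (P, U)) (h'' 0 (P, U)) < 2 * e"
        using d(2)[of "(0, P, U)" "(t, P, U)"] t r P U by (auto simp: dist_Pair_Pair)
      then have "h'' t (P, U) \<ge> - (2 * e)"
        using h''0[OF P, of U] by (auto simp: dist_real_def)
      then have "h'' t (P, U) / 2 * r\<^sup>2 \<ge> - e * r\<^sup>2"
        by (intro mult_right_mono) auto
      moreover have "h' 0 (P, U) * r = area_deriv P Q"
        using area_deriv_scale[of P r U] U by (simp add: h'_eq)
      ultimately show ?thesis using eq by (simp add: r_def)
    qed
  qed
qed

section \<open>The weak form of the minimal surface system\<close>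

lemma partial_eq:
  assumes "(f has_derivative f') (at x)"
  shows "partial i f x = f' (axis i 1)"
proof -
  have "((\<lambda>s. x + s *\<^sub>R axis i 1) has_derivative (\<lambda>s. s *\<^sub>R axis i 1)) (at 0)"
    by (auto intro!: derivative_eq_intros)
  moreover have "(f has_derivative f') (at (x + 0 *\<^sub>R axis i 1))" using assms by simp
  ultimately have "(f \<circ> (\<lambda>s. x + s *\<^sub>R axis i 1) has_derivative f' \<circ> (\<lambda>s. s *\<^sub>R axis i 1)) (at 0)"
    by (rule diff_chain_at)
  moreover have "f' \<circ> (\<lambda>s. s *\<^sub>R axis i 1) = (\<lambda>s. s *\<^sub>R f' (axis i 1))"
    using assms by (auto simp: has_derivative_def linear_cmul bounded_linear.linear)
  ultimately have "((\<lambda>s. f (x + s *\<^sub>R axis i 1)) has_vector_derivative f' (axis i 1)) (at 0)"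
    by (simp add: has_vector_derivative_def o_def)
  then show ?thesis unfolding partial_def by (rule vector_derivative_at)
qed

definition jacobian :: "(real^'n::finite \<Rightarrow> real^'m::finite) \<Rightarrow> real^'n \<Rightarrow> real^'n^'m"
  where "jacobian f x = (\<chi> a i. partial i f x $ a)"

lemma jacobian_nth [simp]: "jacobian f x $ a $ i = partial i f x $ a"
  by (simp add: jacobian_def)

lemma jacobian_eq_matrix:
  assumes "(f has_derivative f') (at x)"
  shows "jacobian f x = matrix f'"
  by (simp add: vec_eq_iff matrix_def partial_eq[OF assms])

lemma has_derivative_jacobian:
  assumes "f differentiable (at x)"
  shows "(f has_derivative (\<lambda>v. jacobian f x *v v)) (at x)"
proof -
  obtain f' where f': "(f has_derivative f') (at x)"
    using assms by (auto simp: differentiable_def)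
  have "linear f'" using f' by (rule has_derivative_linear)
  then have "f' = (\<lambda>v. jacobian f x *v v)"
    by (auto simp: jacobian_eq_matrix[OF f'] matrix_works)
  then show ?thesis using f' by simp
qed

lemma induced_metric_eq: "induced_metric f x = graph_metric (jacobian f x)"
  by (simp add: vec_eq_iff induced_metric_def graph_metric_nth)

section \<open>Scalar C1 functions and integration by parts\<close>

text \<open>In finite dimensions, continuity of \<open>f' x v\<close> in \<open>x\<close> for each
  fixed \<open>v\<close> amounts to continuity of the differential, and it is easier to propagate
  through sums, products and compositions.\<close>

definition C1_fun :: "'a::real_normed_vector set \<Rightarrow> ('a \<Rightarrow> real) \<Rightarrow> bool"
  where "C1_fun S f \<longleftrightarrow> (\<exists>f'. (\<forall>x\<in>S. (f has_derivative f' x) (at x)) \<and> (\<forall>v. continuous_on S (\<lambda>x. f' x v)))"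

lemma C1_funI:
  assumes "\<And>x. x \<in> S \<Longrightarrow> (f has_derivative f' x) (at x)" "\<And>v. continuous_on S (\<lambda>x. f' x v)"
  shows "C1_fun S f"
  using assms unfolding C1_fun_def by blast

lemma C1_fun_continuous_on: "C1_fun S f \<Longrightarrow> continuous_on S f"
  unfolding C1_fun_def
  by (meson continuous_at_imp_continuous_on has_derivative_continuous)

lemma C1_fun_const: "C1_fun S (\<lambda>x. c)"
  by (rule C1_funI[where f' = "\<lambda>_ _. 0"]) auto

lemma C1_fun_add:
  assumes "C1_fun S f" "C1_fun S g"
  shows "C1_fun S (\<lambda>x. f x + g x)"
proof -
  obtain f' where f: "\<And>x. x \<in> S \<Longrightarrow> (f has_derivative f' x) (at x)" "\<And>v. continuous_on S (\<lambda>x. f' x v)"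
    using assms(1) unfolding C1_fun_def by blast
  obtain g' where g: "\<And>x. x \<in> S \<Longrightarrow> (g has_derivative g' x) (at x)" "\<And>v. continuous_on S (\<lambda>x. g' x v)"
    using assms(2) unfolding C1_fun_def by blast
  show ?thesis
    by (rule C1_funI[where f' = "\<lambda>x v. f' x v + g' x v"]) (auto intro!: has_derivative_add continuous_intros f g)
qed

lemma C1_fun_mult:
  assumes "C1_fun S f" "C1_fun S g"
  shows "C1_fun S (\<lambda>x. f x * g x)"
proof -
  obtain f' where f: "\<And>x. x \<in> S \<Longrightarrow> (f has_derivative f' x) (at x)" "\<And>v. continuous_on S (\<lambda>x. f' x v)"
    using assms(1) unfolding C1_fun_def by blast
  obtain g' where g: "\<And>x. x \<in> S \<Longrightarrow> (g has_derivative g' x) (at x)" "\<And>v. continuous_on S (\<lambda>x. g' x v)"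
    using assms(2) unfolding C1_fun_def by blast
  show ?thesis
    by (rule C1_funI[where f' = "\<lambda>x v. f x * g' x v + f' x v * g x"])
       (auto intro!: has_derivative_mult continuous_intros assms[THEN C1_fun_continuous_on] f g)
qed

lemma C1_fun_sum:
  assumes "\<And>i. i \<in> I \<Longrightarrow> C1_fun S (f i)"
  shows "C1_fun S (\<lambda>x. \<Sum>i\<in>I. f i x)"
  using assms by (induction I rule: infinite_finite_induct) (auto intro!: C1_fun_add C1_fun_const)

lemma C1_fun_prod:
  assumes "\<And>i. i \<in> I \<Longrightarrow> C1_fun S (f i)"
  shows "C1_fun S (\<lambda>x. \<Prod>i\<in>I. f i x)"
  using assms by (induction I rule: infinite_finite_induct) (auto intro!: C1_fun_mult C1_fun_const)

lemma C1_fun_compose: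
  assumes "C1_fun S f" and h: "\<And>y. y \<in> T \<Longrightarrow> (h has_real_derivative h' y) (at y)"
    and c: "continuous_on T h'" and T: "\<And>x. x \<in> S \<Longrightarrow> f x \<in> T"
  shows "C1_fun S (\<lambda>x. h (f x))"
proof -
  obtain f' where f: "\<And>x. x \<in> S \<Longrightarrow> (f has_derivative f' x) (at x)" "\<And>v. continuous_on S (\<lambda>x. f' x v)"
    using assms(1) unfolding C1_fun_def by blast
  show ?thesis
  proof (rule C1_funI[where f' = "\<lambda>x v. h' (f x) * f' x v"])
    fix x assume x: "x \<in> S"
    have "(h has_derivative (\<lambda>v. h' (f x) * v)) (at (f x))"
      using h[OF T[OF x]] by (simp add: has_field_derivative_def)
    from has_derivative_compose[OF f(1)[OF x] this]
    show "((\<lambda>x. h (f x)) has_derivative (\<lambda>v. h' (f x) * f' x v)) (at x)" .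
  qed (auto intro!: continuous_intros f continuous_on_compose2[OF c] C1_fun_continuous_on[OF assms(1)] T)
qed

lemma C1_fun_det:
  assumes "\<And>i j. C1_fun S (\<lambda>x. A x $ i $ j)"
  shows "C1_fun S (\<lambda>x. det (A x))"
  unfolding det_def by (intro C1_fun_sum C1_fun_mult C1_fun_prod assms C1_fun_const)

lemma C1_fun_matrix_inv:
  fixes A :: "'a::real_normed_vector \<Rightarrow> real^'n::finite^'n"
  assumes A: "\<And>i j. C1_fun S (\<lambda>x. A x $ i $ j)" and d: "\<And>x. det (A x) > 0"
  shows "C1_fun S (\<lambda>x. matrix_inv (A x) $ k $ l)"
proof -
  have "C1_fun S (\<lambda>x. (\<chi> i j. if j = k then axis l 1 $ i else A x $ i $ j) $ i $ j)" for i j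
    using A by (cases "j = k") (auto intro: C1_fun_const)
  then have 1: "C1_fun S (\<lambda>x. det (\<chi> i j. if j = k then axis l 1 $ i else A x $ i $ j))"
    by (intro C1_fun_det)
  have 2: "C1_fun S (\<lambda>x. inverse (det (A x)))"
    by (rule C1_fun_compose[OF C1_fun_det[OF A], where T = "{0<..}" and h' = "\<lambda>y. - inverse (y\<^sup>2)"])
       (use d in \<open>auto intro!: derivative_eq_intros continuous_intros simp: power2_eq_square\<close>)
  have "d \<noteq> 0" if "d = det (A x)" for d x using d[of x] that by simp
  then have "matrix_inv (A x) $ k $ l = det (\<chi> i j. if j = k then axis l 1 $ i else A x $ i $ j) * inverse (det (A x))" for x
    by (subst matrix_inv_nth) (auto simp: divide_inverse)
  then show ?thesis using C1_fun_mult[OF 1 2] by simp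
qed

text \<open>Each of the finitely many derivatives along basis vectors is bounded on
  \<open>K\<close>, and linearity extends the bound to all directions.\<close>

lemma C1_fun_bounded:
  fixes f :: "'a::euclidean_space \<Rightarrow> real"
  assumes "C1_fun S f" "compact K" "K \<subseteq> S"
  obtains f' B where "\<And>x. x \<in> S \<Longrightarrow> (f has_derivative f' x) (at x)"
    "\<And>x v. x \<in> K \<Longrightarrow> \<bar>f' x v\<bar> \<le> B * norm v"
proof -
  obtain f' where f: "\<And>x. x \<in> S \<Longrightarrow> (f has_derivative f' x) (at x)" "\<And>v. continuous_on S (\<lambda>x. f' x v)"
    using assms(1) unfolding C1_fun_def by blast
  have "\<exists>c. \<forall>x\<in>K. \<bar>f' x b\<bar> \<le> c" for b
  proof -
    have "compact ((\<lambda>x. f' x b) ` K)"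
      using assms f(2) by (intro compact_continuous_image continuous_on_subset[OF f(2)]) auto
    then show ?thesis by (auto dest!: compact_imp_bounded simp: bounded_iff)
  qed
  then obtain c where c: "\<And>b x. x \<in> K \<Longrightarrow> \<bar>f' x b\<bar> \<le> c b" by metis
  have "\<bar>f' x v\<bar> \<le> (\<Sum>b\<in>Basis. c b) * norm v" if x: "x \<in> K" for x v
  proof -
    have lin: "linear (f' x)" using f(1) x assms(3) by (blast intro: has_derivative_linear)
    have "f' x v = f' x (\<Sum>b\<in>Basis. (v \<bullet> b) *\<^sub>R b)" by (simp add: euclidean_representation)
    also have "\<dots> = (\<Sum>b\<in>Basis. (v \<bullet> b) * f' x b)"
      using lin by (simp add: linear_sum linear_cmul)
    finally have "\<bar>f' x v\<bar> \<le> (\<Sum>b\<in>Basis. \<bar>(v \<bullet> b) * f' x b\<bar>)" by (simp add: sum_abs)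
    also have "\<dots> \<le> (\<Sum>b\<in>Basis. norm v * c b)"
      unfolding abs_mult by (intro sum_mono mult_mono Basis_le_norm c x) auto
    finally show ?thesis by (simp add: sum_distrib_left[symmetric] mult.commute)
  qed
  with f(1) show ?thesis by (rule that)
qed

text \<open>The difference quotients of a compactly supported function have integral \<open>0\<close> by translation
  invariance, and they converge boundedly to the directional derivative.\<close>

lemma has_integral_directional_derivative_compact_support:
  fixes w :: "'a::euclidean_space \<Rightarrow> real"
  assumes w: "\<And>x. (w has_derivative w' x) (at x)" and B: "\<And>x v. \<bar>w' x v\<bar> \<le> B * norm v"
    and K: "compact K" and supp: "\<And>x. x \<notin> K \<Longrightarrow> w x = 0"
  shows "((\<lambda>x. w' x e) has_integral 0) K"
proof -
  have cont: "continuous_on X w" for X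
    using w by (meson continuous_at_imp_continuous_on has_derivative_continuous)
  have [measurable]: "w \<in> borel_measurable borel"
    using cont by (rule borel_measurable_continuous_onI)
  have wint: "integrable lborel w"
  proof -
    have "integrable lborel (\<lambda>x. indicator K x *\<^sub>R w x)"
      by (rule borel_integrable_compact[OF K cont])
    moreover have "(\<lambda>x. indicator K x *\<^sub>R w x) = w"
      using supp by (auto simp: fun_eq_iff indicator_def)
    ultimately show ?thesis by simp
  qed
  have shift: "integrable lborel (\<lambda>x. w (c + x)) \<and> integral\<^sup>L lborel (\<lambda>x. w (c + x)) = integral\<^sup>L lborel w" for c
  proof -
    have "lborel = distr lborel borel ((+) c)" by (simp add: lborel_distr_plus)
    then show ?thesis
      using wint integrable_distr_eq[of "(+) c" lborel borel w] integral_distr[of "(+) c" lborel borel w] by simp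
  qed
  have lip: "\<bar>w y - w x\<bar> \<le> B * norm (y - x)" for x y
  proof -
    have "norm (w y - w x) \<le> B * norm (y - x)"
      by (rule differentiable_bound[where S = UNIV and f' = w'])
         (use w B in \<open>auto intro!: onorm_le simp: has_derivative_at_withinI\<close>)
    then show ?thesis by simp
  qed
  define h where "h k = inverse (real (Suc k))" for k
  have h: "h k > 0" "h k \<le> 1" for k by (auto simp: h_def field_simps)
  define s where "s k x = (w (h k *\<^sub>R e + x) - w x) / h k" for k x
  obtain R where R: "\<And>x. x \<in> K \<Longrightarrow> norm x \<le> R"
    using compact_imp_bounded[OF K] by (auto simp: bounded_iff)
  \<comment> \<open>The steps \<open>h k\<close> are at most 1, so all difference quotients vanish
    outside this ball, and the Lipschitz bound dominates them inside.\<close>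
  let ?b = "\<lambda>x. indicator (cball 0 (R + norm e)) x *\<^sub>R (\<bar>B\<bar> * norm e)"
  have s_int: "integrable lborel (s k)" "integral\<^sup>L lborel (s k) = 0" for k
    using shift[of "h k *\<^sub>R e"] wint by (auto simp: s_def[abs_def])
  have lim: "(\<lambda>k. s k x) \<longlonglongrightarrow> w' x e" for x
  proof -
    have "((\<lambda>t. x + t *\<^sub>R e) has_derivative (\<lambda>t. t *\<^sub>R e)) (at 0)"
      by (auto intro!: derivative_eq_intros)
    then have "((\<lambda>t. w (x + t *\<^sub>R e)) has_derivative (\<lambda>t. w' x (t *\<^sub>R e))) (at 0)"
      using has_derivative_compose[of "\<lambda>t. x + t *\<^sub>R e" _ 0 UNIV w "w' x"] w[of x] by simp
    moreover have "(\<lambda>t. w' x (t *\<^sub>R e)) = (\<lambda>t. w' x e * t)"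
      using has_derivative_linear[OF w[of x]] by (auto simp: linear_cmul)
    ultimately have "((\<lambda>t. w (x + t *\<^sub>R e)) has_real_derivative w' x e) (at 0)"
      by (simp add: has_field_derivative_def)
    then have "((\<lambda>t. (w (x + t *\<^sub>R e) - w x) / t) \<longlongrightarrow> w' x e) (at 0)"
      by (simp add: DERIV_def)
    moreover have "filterlim h (at 0) sequentially"
      unfolding filterlim_at
      using h(1) LIMSEQ_inverse_real_of_nat by (auto simp: h_def[abs_def] intro!: always_eventually)
    ultimately show ?thesis
      by (auto dest: filterlim_compose simp: s_def add.commute)
  qed
  have bound: "norm (s k x) \<le> ?b x" for k x
  proof (cases "x \<in> cball 0 (R + norm e)")
    case True
    have "\<bar>w (h k *\<^sub>R e + x) - w x\<bar> \<le> B * (h k * norm e)"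
      using lip[of "h k *\<^sub>R e + x" x] h(1)[of k] by simp
    also have "\<dots> \<le> \<bar>B\<bar> * (h k * norm e)"
      using h(1)[of k] by (intro mult_right_mono) auto
    finally show ?thesis
      using True h(1)[of k] by (simp add: s_def field_simps)
  next
    case False
    then have "norm x > R + norm e" by simp
    moreover have "norm (h k *\<^sub>R e) \<le> norm e"
      using h[of k] by (simp add: mult_left_le_one_le)
    moreover have "norm x \<le> norm (h k *\<^sub>R e + x) + norm (h k *\<^sub>R e)"
      using norm_triangle_ineq4[of "h k *\<^sub>R e + x" "h k *\<^sub>R e"] by simp
    ultimately have "norm (h k *\<^sub>R e + x) > R" "norm x > R" using norm_ge_zero[of e] by linarith+
    then have "x \<notin> K" "h k *\<^sub>R e + x \<notin> K" by (meson R not_le)+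
    then show ?thesis using False by (simp add: s_def supp)
  qed
  have lim_meas: "(\<lambda>x. w' x e) \<in> borel_measurable lborel"
    by (rule borel_measurable_LIMSEQ_metric[OF _ lim]) (use s_int in auto)
  have bint: "integrable lborel ?b"
    by (rule borel_integrable_compact) auto
  note dc = lim_meas borel_measurable_integrable[OF s_int(1)] bint
  have int: "integrable lborel (\<lambda>x. w' x e)"
    by (rule integrable_dominated_convergence[where s = s, OF dc]) (use lim bound in auto)
  have "(\<lambda>k. integral\<^sup>L lborel (s k)) \<longlonglongrightarrow> integral\<^sup>L lborel (\<lambda>x. w' x e)"
    by (rule integral_dominated_convergence[where s = s, OF dc]) (use lim bound in auto)
  then have "integral\<^sup>L lborel (\<lambda>x. w' x e) = 0"
    using s_int(2) by (simp add: LIMSEQ_const_iff)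
  then have "((\<lambda>x. w' x e) has_integral 0) UNIV"
    using has_integral_integral_lborel[OF int] by simp
  \<comment> \<open>Off the closed set \<open>K\<close> the function vanishes on a neighbourhood, so
    the integral over the whole space is the integral over \<open>K\<close>.\<close>
  moreover have "w' x e = 0" if "x \<notin> K" for x
  proof -
    have "((\<lambda>_. 0) has_derivative (\<lambda>_. 0)) (at x)" by simp
    then have "(w has_derivative (\<lambda>_. 0)) (at x)"
      by (rule has_derivative_transform_within_open[where s = "- K"])
         (use that supp K in \<open>auto simp: compact_imp_closed open_Compl\<close>)
    from has_derivative_unique[OF w this] show ?thesis by simp
  qed
  then have "(\<lambda>x. w' x e) = (\<lambda>x. if x \<in> K then w' x e else 0)" by auto
  ultimately have "((\<lambda>x. if x \<in> K then w' x e else 0) has_integral 0) UNIV" by (simp only:)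
  then show ?thesis by (simp only: has_integral_restrict_UNIV)
qed

lemma C1_on_nth_C1_fun:
  assumes "C1_on S f" "open S"
  shows "C1_fun S (\<lambda>x. f x $ a)"
proof (rule C1_funI[where f' = "\<lambda>x v. frechet_derivative f (at x) v $ a"])
  have d: "(f has_derivative frechet_derivative f (at x)) (at x)" if "x \<in> S" for x
  proof -
    have "f differentiable (at x)"
      using assms that unfolding C1_on_def by (metis differentiable_on_eq_differentiable_at)
    then show ?thesis by (simp only: frechet_derivative_works)
  qed
  then show "((\<lambda>x. f x $ a) has_derivative (\<lambda>v. frechet_derivative f (at x) v $ a)) (at x)" if "x \<in> S" for x
    using that bounded_linear.has_derivative[OF bounded_linear_vec_nth] by blast
  fix v
  have "frechet_derivative f (at x) v $ a = (\<Sum>i\<in>UNIV. v $ i * partial i f x $ a)" if "x \<in> S" for x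
  proof -
    have lin: "linear (frechet_derivative f (at x))" using d[OF that] by (rule has_derivative_linear)
    have "frechet_derivative f (at x) v = frechet_derivative f (at x) (\<Sum>i\<in>UNIV. v $ i *\<^sub>R axis i 1)"
      using basis_expansion[of v] by (simp add: scalar_mult_eq_scaleR)
    also have "\<dots> = (\<Sum>i\<in>UNIV. v $ i *\<^sub>R frechet_derivative f (at x) (axis i 1))"
      by (simp only: linear_sum[OF lin] linear_cmul[OF lin])
    finally have "frechet_derivative f (at x) v = (\<Sum>i\<in>UNIV. v $ i *\<^sub>R frechet_derivative f (at x) (axis i 1))" .
    then show ?thesis by (simp add: partial_eq[OF d[OF that]])
  qed
  moreover have "continuous_on S (\<lambda>x. \<Sum>i\<in>UNIV. v $ i * partial i f x $ a)"
    using assms(1) by (auto simp: C1_on_def intro!: continuous_intros)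
  ultimately show "continuous_on S (\<lambda>x. frechet_derivative f (at x) v $ a)"
    by (simp cong: continuous_on_cong)
qed

text \<open>Integration by parts without boundary term: since \<open>\<phi>\<close> vanishes off
  \<open>K\<close>, the product extended by zero is differentiable on the whole space with bounded
  derivative, and its directional derivatives integrate to 0.\<close>

lemma has_integral_product_derivative_compact_support:
  fixes \<Omega> :: "(real^'n::finite) set" and A \<phi> :: "real^'n \<Rightarrow> real"
  assumes \<Omega>: "open \<Omega>" and K: "compact K" "K \<subseteq> \<Omega>" and A: "C1_fun \<Omega> A"
    and \<phi>: "\<And>x. (\<phi> has_derivative \<phi>' x) (at x)" and B: "\<And>x v. \<bar>\<phi>' x v\<bar> \<le> B * norm v"
    and supp: "\<And>x. x \<notin> K \<Longrightarrow> \<phi> x = 0"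
  shows "((\<lambda>x. A x * \<phi>' x (axis i 1) + partial i A x * \<phi> x) has_integral 0) K"
proof -
  obtain A' BA where A': "\<And>x. x \<in> \<Omega> \<Longrightarrow> (A has_derivative A' x) (at x)"
    and BA: "\<And>x v. x \<in> K \<Longrightarrow> \<bar>A' x v\<bar> \<le> BA * norm v"
    using C1_fun_bounded[OF A K] by blast
  have bdd: "\<exists>c. \<forall>x\<in>K. \<bar>g x\<bar> \<le> c" if "continuous_on K g" for g :: "real^'n \<Rightarrow> real"
    using compact_imp_bounded[OF compact_continuous_image[OF that K(1)]] by (auto simp: bounded_iff)
  obtain a where a: "\<And>x. x \<in> K \<Longrightarrow> \<bar>A x\<bar> \<le> a"
    using bdd[of A] C1_fun_continuous_on[OF A] K(2) by (blast intro: continuous_on_subset)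
  obtain c where c: "\<And>x. x \<in> K \<Longrightarrow> \<bar>\<phi> x\<bar> \<le> c"
    using bdd[of \<phi>] \<phi> by (meson continuous_at_imp_continuous_on has_derivative_continuous)
  define w where "w x = (if x \<in> K then A x * \<phi> x else 0)" for x
  define w' where "w' x v = (if x \<in> K then A x * \<phi>' x v + A' x v * \<phi> x else 0)" for x v
  have \<phi>'0: "\<phi>' x = (\<lambda>_. 0)" if "x \<notin> K" for x
  proof -
    have "((\<lambda>_. 0) has_derivative (\<lambda>_. 0)) (at x)" by simp
    then have "(\<phi> has_derivative (\<lambda>_. 0)) (at x)"
      by (rule has_derivative_transform_within_open[where s = "- K"])
         (use that supp K in \<open>auto simp: compact_imp_closed open_Compl\<close>)
    from has_derivative_unique[OF \<phi> this] show ?thesis .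
  qed
  have "((\<lambda>x. w' x (axis i 1)) has_integral 0) K"
  proof (rule has_integral_directional_derivative_compact_support[where w = w and B = "\<bar>a\<bar> * \<bar>B\<bar> + \<bar>BA\<bar> * \<bar>c\<bar>"])
    fix x
    \<comment> \<open>The split is along \<open>\<Omega>\<close>, not \<open>K\<close>: on the open
      \<open>\<Omega>\<close> the function \<open>w\<close> is the product even at boundary points
      of \<open>K\<close>, and outside \<open>\<Omega>\<close> it is zero on the open complement of
      \<open>K\<close>.\<close>
    show "(w has_derivative w' x) (at x)"
    proof (cases "x \<in> \<Omega>")
      case True
      have "((\<lambda>x. A x * \<phi> x) has_derivative (\<lambda>v. A x * \<phi>' x v + A' x v * \<phi> x)) (at x)"
        by (rule has_derivative_mult[OF A'[OF True] \<phi>])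
      then have "(w has_derivative (\<lambda>v. A x * \<phi>' x v + A' x v * \<phi> x)) (at x)"
        by (rule has_derivative_transform_within_open[OF _ \<Omega> True]) (auto simp: w_def supp)
      moreover have "(\<lambda>v. A x * \<phi>' x v + A' x v * \<phi> x) = w' x"
        by (auto simp: w'_def fun_eq_iff \<phi>'0 supp)
      ultimately show ?thesis by simp
    next
      case False
      then have "x \<notin> K" using K by blast
      have "((\<lambda>_. 0) has_derivative (\<lambda>_. 0)) (at x)" by simp
      then have "(w has_derivative (\<lambda>_. 0)) (at x)"
        by (rule has_derivative_transform_within_open[where s = "- K"])
           (use \<open>x \<notin> K\<close> K in \<open>auto simp: w_def compact_imp_closed open_Compl\<close>)
      moreover have "(\<lambda>_. 0) = w' x" using \<open>x \<notin> K\<close> by (auto simp: w'_def)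
      ultimately show ?thesis by simp
    qed
    fix v
    show "\<bar>w' x v\<bar> \<le> (\<bar>a\<bar> * \<bar>B\<bar> + \<bar>BA\<bar> * \<bar>c\<bar>) * norm v"
    proof (cases "x \<in> K")
      case True
      have "\<bar>A x\<bar> * \<bar>\<phi>' x v\<bar> \<le> \<bar>a\<bar> * (\<bar>B\<bar> * norm v)"
        by (intro mult_mono order_trans[OF B] order_trans[OF a[OF True]] mult_right_mono) auto
      moreover have "\<bar>A' x v\<bar> * \<bar>\<phi> x\<bar> \<le> (\<bar>BA\<bar> * norm v) * \<bar>c\<bar>"
        by (intro mult_mono order_trans[OF BA[OF True]] order_trans[OF c[OF True]] mult_right_mono) auto
      moreover have "\<bar>w' x v\<bar> \<le> \<bar>A x\<bar> * \<bar>\<phi>' x v\<bar> + \<bar>A' x v\<bar> * \<bar>\<phi> x\<bar>"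
        using True by (simp add: w'_def abs_mult[symmetric] abs_triangle_ineq)
      ultimately show ?thesis by (simp add: algebra_simps)
    qed (simp add: w'_def)
  qed (use K in \<open>auto simp: w_def\<close>)
  then show ?thesis
    by (rule has_integral_eq[rotated]) (use K partial_eq[OF A'] in \<open>auto simp: w'_def subset_iff\<close>)
qed

text \<open>Each equation is multiplied by the matching component of \<open>\<phi>\<close>,
  integrated by parts and summed. What remains is the differential of the area integrand at the
  Jacobian of \<open>f\<close>, evaluated at the Jacobian of the test function.\<close>

lemma minimal_surface_system_weak:
  fixes \<Omega> :: "(real^'n::finite) set" and f \<phi> :: "real^'n \<Rightarrow> real^'m::finite"
  assumes \<Omega>: "open \<Omega>" and f: "minimal_surface_system \<Omega> f" and K: "compact K" "K \<subseteq> \<Omega>"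
    and \<phi>: "\<And>x. (\<phi> has_derivative \<phi>' x) (at x)" and B: "\<And>x v. norm (\<phi>' x v) \<le> B * norm v"
    and supp: "\<And>x. x \<notin> K \<Longrightarrow> \<phi> x = 0"
  shows "((\<lambda>x. area_deriv (jacobian f x) (matrix (\<phi>' x))) has_integral 0) K"
proof -
  define A where "A i j a x = sqrt (det (induced_metric f x)) * matrix_inv (induced_metric f x) $ i $ j * partial j f x $ a" for i j a x
  have J: "C1_fun \<Omega> (\<lambda>x. partial i f x $ a)" for i a
    using f \<Omega> by (auto simp: minimal_surface_system_def C2_on_def intro: C1_on_nth_C1_fun)
  have g: "C1_fun \<Omega> (\<lambda>x. induced_metric f x $ i $ j)" for i j
    unfolding induced_metric_eq graph_metric_nth jacobian_nth
    by (intro C1_fun_add C1_fun_sum C1_fun_mult C1_fun_const J)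
  have det: "det (induced_metric f x) > 0" for x by (simp add: induced_metric_eq)
  have "C1_fun \<Omega> (\<lambda>x. sqrt (det (induced_metric f x)))"
    by (rule C1_fun_compose[OF C1_fun_det[OF g], where T = "{0<..}" and h' = "\<lambda>y. inverse (sqrt y) / 2"])
       (use det in \<open>auto intro!: DERIV_real_sqrt continuous_intros\<close>)
  then have A: "C1_fun \<Omega> (A i j a)" for i j a
    unfolding A_def by (intro C1_fun_mult C1_fun_matrix_inv g det J)
  have 1: "((\<lambda>x. A i j a x * \<phi>' x (axis i 1) $ a + partial i (A i j a) x * \<phi> x $ a) has_integral 0) K" for i j a
  proof (rule has_integral_product_derivative_compact_support[OF \<Omega> K A])
    show "((\<lambda>x. \<phi> x $ a) has_derivative (\<lambda>v. \<phi>' x v $ a)) (at x)" for x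
      by (rule bounded_linear.has_derivative[OF bounded_linear_vec_nth \<phi>])
    show "\<bar>\<phi>' x v $ a\<bar> \<le> B * norm v" for x v
      using component_le_norm_cart[of "\<phi>' x v" a] B[of x v] by linarith
  qed (simp add: supp)
  have "((\<lambda>x. \<Sum>a\<in>UNIV. \<Sum>i\<in>UNIV. \<Sum>j\<in>UNIV. A i j a x * \<phi>' x (axis i 1) $ a + partial i (A i j a) x * \<phi> x $ a)
     has_integral (\<Sum>a\<in>(UNIV::'m set). \<Sum>i\<in>(UNIV::'n set). \<Sum>j\<in>(UNIV::'n set). 0)) K"
    by (intro has_integral_sum 1) auto
  then have 2: "((\<lambda>x. \<Sum>a\<in>UNIV. \<Sum>i\<in>UNIV. \<Sum>j\<in>UNIV. A i j a x * \<phi>' x (axis i 1) $ a + partial i (A i j a) x * \<phi> x $ a)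
     has_integral 0) K" by simp
  show ?thesis
  proof (rule has_integral_eq[OF _ 2])
    fix x assume "x \<in> K"
    then have "x \<in> \<Omega>" using K by blast
    have sys: "(\<Sum>i\<in>UNIV. \<Sum>j\<in>UNIV. partial i (A i j a) x) = 0" for a
      using f \<open>x \<in> \<Omega>\<close> unfolding minimal_surface_system_def A_def by blast
    have "(\<Sum>a\<in>UNIV. \<Sum>i\<in>UNIV. \<Sum>j\<in>UNIV. A i j a x * \<phi>' x (axis i 1) $ a + partial i (A i j a) x * \<phi> x $ a)
      = (\<Sum>a\<in>UNIV. \<Sum>i\<in>UNIV. \<Sum>j\<in>UNIV. A i j a x * \<phi>' x (axis i 1) $ a)
        + (\<Sum>a\<in>UNIV. (\<Sum>i\<in>UNIV. \<Sum>j\<in>UNIV. partial i (A i j a) x) * \<phi> x $ a)"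
      by (simp add: sum.distrib sum_distrib_right)
    also have "\<dots> = (\<Sum>a\<in>UNIV. \<Sum>i\<in>UNIV. \<Sum>j\<in>UNIV. A i j a x * \<phi>' x (axis i 1) $ a)"
      by (simp add: sys)
    also have "\<dots> = (\<Sum>i\<in>UNIV. \<Sum>j\<in>UNIV. \<Sum>a\<in>UNIV. A i j a x * \<phi>' x (axis i 1) $ a)"
      by (subst sum.swap, rule sum.cong[OF refl], subst sum.swap) simp
    also have "\<dots> = area_deriv (jacobian f x) (matrix (\<phi>' x))"
      by (simp add: A_def area_deriv_def area_integrand_def induced_metric_eq trace_def matrix_matrix_mult_def
          transpose_def matrix_def sum_distrib_left mult.assoc)
    finally show "(\<Sum>a\<in>UNIV. \<Sum>i\<in>UNIV. \<Sum>j\<in>UNIV. A i j a x * \<phi>' x (axis i 1) $ a + partial i (A i j a) x * \<phi> x $ a)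
      = area_deriv (jacobian f x) (matrix (\<phi>' x))" .
  qed
qed

section \<open>Near-identity maps and differentiation under the integral\<close>

lemma norm_matrix_le_sum: "norm (A :: real^'n::finite^'m::finite) \<le> (\<Sum>i\<in>UNIV. \<Sum>j\<in>UNIV. \<bar>A $ i $ j\<bar>)"
proof -
  have "norm A \<le> (\<Sum>i\<in>UNIV. norm (A $ i))"
    unfolding norm_vec_def[of A] by (rule L2_set_le_sum) auto
  also have "\<dots> \<le> (\<Sum>i\<in>UNIV. \<Sum>j\<in>UNIV. \<bar>A $ i $ j\<bar>)"
    by (intro sum_mono norm_le_l1_cart)
  finally show ?thesis .
qed

lemma norm_matrix_vector_le_sum:
  "norm ((A :: real^'n::finite^'m::finite) *v v) \<le> (\<Sum>i\<in>UNIV. \<Sum>j\<in>UNIV. \<bar>A $ i $ j\<bar>) * norm v"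
proof -
  have "norm (A *v v) \<le> (\<Sum>i\<in>UNIV. \<bar>(A *v v) $ i\<bar>)"
    by (rule norm_le_l1_cart)
  also have "\<dots> \<le> (\<Sum>i\<in>UNIV. \<Sum>j\<in>UNIV. \<bar>A $ i $ j\<bar> * norm v)"
  proof (rule sum_mono)
    fix i
    have "\<bar>(A *v v) $ i\<bar> \<le> (\<Sum>j\<in>UNIV. \<bar>A $ i $ j * v $ j\<bar>)"
      by (simp add: matrix_vector_mult_def sum_abs)
    also have "\<dots> \<le> (\<Sum>j\<in>UNIV. \<bar>A $ i $ j\<bar> * norm v)"
      unfolding abs_mult by (intro sum_mono mult_left_mono component_le_norm_cart) auto
    finally show "\<bar>(A *v v) $ i\<bar> \<le> (\<Sum>j\<in>UNIV. \<bar>A $ i $ j\<bar> * norm v)" .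
  qed
  finally show ?thesis by (simp add: sum_distrib_right)
qed

lemma bivector_norm_le_norm: "bivector_norm B \<le> norm B" "norm B \<le> sqrt 2 * bivector_norm B"
proof -
  have "(norm B)\<^sup>2 = (\<Sum>i\<in>UNIV. \<Sum>j\<in>UNIV. (B $ i $ j)\<^sup>2)"
    unfolding power2_norm_eq_inner by (simp add: inner_vec_def power2_eq_square)
  then have 1: "bivector_norm B = sqrt ((norm B)\<^sup>2 / 2)"
    by (simp add: bivector_norm_def)
  show "bivector_norm B \<le> norm B"
    unfolding 1 by (rule real_le_lsqrt) auto
  show "norm B \<le> sqrt 2 * bivector_norm B"
    unfolding 1 by (simp add: real_sqrt_divide)
qed

text \<open>A supremum of reals bounds its members only when the set is bounded above. Here this
  follows from the linearity of \<open>wedge2_map L\<close> in finite dimensions and the equivalence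
  of \<open>bivector_norm\<close> with the matrix norm.\<close>

lemma wedge2_norm_upper:
  fixes L :: "real^'n::finite \<Rightarrow> real^'m::finite"
  assumes "linear L" and "bivector_norm (wedge v w) = 1"
  shows "bivector_norm (wedge (L v) (L w)) \<le> wedge2_norm L"
proof -
  have "bounded_linear (wedge2_map L)"
    using linear_wedge2_map by (rule linear_conv_bounded_linear[THEN iffD1])
  then obtain C where C: "\<And>B. norm (wedge2_map L B) \<le> norm B * C" "0 \<le> C"
    using bounded_linear.nonneg_bounded by blast
  have "bdd_above ((\<lambda>(v, w). bivector_norm (wedge2_map L (wedge v w))) ` {(v, w). bivector_norm (wedge v w) = 1})"
  proof (rule bdd_aboveI2[where M = "sqrt 2 * C"], clarify)
    fix v w :: "real^'n" assume 1: "bivector_norm (wedge v w) = 1"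
    have "bivector_norm (wedge2_map L (wedge v w)) \<le> norm (wedge v w) * C"
      using bivector_norm_le_norm(1) C(1) by (rule order_trans)
    also have "\<dots> \<le> sqrt 2 * C"
      using bivector_norm_le_norm(2)[of "wedge v w"] 1 C(2) by (intro mult_right_mono) auto
    finally show "bivector_norm (wedge2_map L (wedge v w)) \<le> sqrt 2 * C" .
  qed
  then have "(\<lambda>(v, w). bivector_norm (wedge2_map L (wedge v w))) (v, w) \<le> wedge2_norm L"
    unfolding wedge2_norm_def using assms(2) by (intro cSUP_upper) auto
  then show ?thesis using assms(1) by (simp add: wedge2_map_wedge)
qed

text \<open>The map \<open>u\<close> has Lipschitz constant 1/2. Hence
  \<open>x \<mapsto> z - u x\<close> is a contraction whose fixed point is the preimage of
  \<open>z\<close>, and the identity plus \<open>u\<close> shrinks distances by at most a factor 2.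
  This makes \<open>\<eta>\<close> Lipschitz, and continuity together with invertible differentials
  gives its derivative.\<close>

lemma has_derivative_inverse_near_identity:
  fixes u :: "real^'n::finite \<Rightarrow> real^'n"
  assumes u: "\<And>x. (u has_derivative (\<lambda>v. U x *v v)) (at x)" and U: "\<And>x v. norm (U x *v v) \<le> 1 / 2 * norm v"
    and supp: "\<And>x. x \<notin> K \<Longrightarrow> u x = 0"
  obtains \<eta> where "\<And>x. \<eta> (x + u x) = x" "\<And>z. \<eta> z + u (\<eta> z) = z" "\<And>z. \<eta> z \<in> K \<longleftrightarrow> z \<in> K"
    "\<And>x. det (mat 1 + U x) \<noteq> 0"
    "\<And>z. (\<eta> has_derivative (\<lambda>v. matrix_inv (mat 1 + U (\<eta> z)) *v v)) (at z)"
    "\<And>x v. norm (matrix_inv (mat 1 + U x) *v v) \<le> 2 * norm v"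
proof -
  have lip: "norm (u y - u x) \<le> 1 / 2 * norm (y - x)" for x y
    by (rule differentiable_bound[where S = UNIV and f' = "\<lambda>x v. U x *v v"])
       (use u onorm_le[OF U] in \<open>auto simp: has_derivative_at_withinI\<close>)
  have expand: "norm (y - x) \<le> 2 * norm ((y + u y) - (x + u x))" for x y
  proof -
    have "norm (y - x) \<le> norm ((y + u y) - (x + u x)) + norm (u y - u x)"
      using norm_triangle_ineq4[of "(y + u y) - (x + u x)" "u y - u x"] by (simp add: algebra_simps)
    then show ?thesis using lip[of y x] by simp
  qed
  have "\<exists>x. x + u x = z" for z
  proof -
    have "\<exists>!x\<in>UNIV. z - u x = x"
    proof (rule Banach_fix[where c = "1 / 2"])
      show "dist (z - u x) (z - u y) \<le> 1 / 2 * dist x y" for x y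
        using lip[of x y] by (simp add: dist_norm norm_minus_commute)
    qed (auto simp: complete_UNIV)
    then obtain x where "z - u x = x" by blast
    then show ?thesis by (metis diff_add_cancel)
  qed
  then obtain \<eta> where \<eta>1: "\<And>z. \<eta> z + u (\<eta> z) = z" by metis
  have \<eta>2: "\<eta> (x + u x) = x" for x
    using expand[of "\<eta> (x + u x)" x] \<eta>1[of "x + u x"] by simp
  \<comment> \<open>Points outside \<open>K\<close> are fixed, so a bijection of the whole space
    must map \<open>K\<close> onto itself.\<close>
  have \<eta>K: "\<eta> z \<in> K \<longleftrightarrow> z \<in> K" for z
    by (metis \<eta>1 \<eta>2 add.right_neutral supp)
  have inj: "norm v \<le> 2 * norm ((mat 1 + U x) *v v)" for x v
  proof -
    have "norm v \<le> norm ((mat 1 + U x) *v v) + norm (U x *v v)"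
      using norm_triangle_ineq4[of "(mat 1 + U x) *v v" "U x *v v"]
      by (simp add: matrix_vector_mult_add_rdistrib)
    then show ?thesis using U[of x v] by simp
  qed
  have det: "det (mat 1 + U x) \<noteq> 0" for x
  proof -
    have "inj ((*v) (mat 1 + U x))"
    proof (rule injI)
      fix v w assume "(mat 1 + U x) *v v = (mat 1 + U x) *v w"
      then have "(mat 1 + U x) *v (v - w) = 0" by (simp add: matrix_vector_mult_diff_distrib)
      then have "norm (v - w) \<le> 0" using inj[of "v - w" x] by simp
      then show "v = w" by simp
    qed
    then show ?thesis using det_nz_iff_inj[of "(*v) (mat 1 + U x)"] by simp
  qed
  note inverse = matrix_inv_inverse[OF det]
  have cont: "continuous (at z) \<eta>" for z
  proof -
    have "\<forall>x x'. dist (\<eta> x) (\<eta> x') \<le> 2 * dist x x'"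
      using expand[of "\<eta> _" "\<eta> _"] \<eta>1 by (simp add: dist_norm)
    then have "2-lipschitz_on UNIV \<eta>" by (auto intro: lipschitz_onI)
    then have "continuous_on UNIV \<eta>" by (rule lipschitz_on_continuous_on)
    then show ?thesis by (simp add: continuous_on_eq_continuous_at)
  qed
  have der: "(\<eta> has_derivative (\<lambda>v. matrix_inv (mat 1 + U (\<eta> z)) *v v)) (at z)" for z
  proof (rule has_derivative_inverse_basic[where f = "\<lambda>x. x + u x" and f' = "\<lambda>v. (mat 1 + U (\<eta> z)) *v v" and T = UNIV])
    show "((\<lambda>x. x + u x) has_derivative (\<lambda>v. (mat 1 + U (\<eta> z)) *v v)) (at (\<eta> z))"
      using has_derivative_add[OF has_derivative_ident u[of "\<eta> z"]]
      by (simp add: matrix_vector_mult_add_rdistrib)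
    show "(*v) (matrix_inv (mat 1 + U (\<eta> z))) \<circ> (*v) (mat 1 + U (\<eta> z)) = id"
      by (simp add: fun_eq_iff matrix_vector_mul_assoc inverse)
  qed (use \<eta>1 cont in \<open>auto intro: matrix_vector_mul_bounded_linear\<close>)
  have "norm (matrix_inv (mat 1 + U x) *v v) \<le> 2 * norm v" for x v
    using inj[of "matrix_inv (mat 1 + U x) *v v" x] by (simp add: matrix_vector_mul_assoc inverse)
  then show ?thesis using that[OF \<eta>2 \<eta>1 \<eta>K det der] by blast
qed

text \<open>\<open>h'\<close> is uniformly continuous on a compact time interval times
  \<open>K\<close>, so the difference quotients converge uniformly in \<open>x\<close>.\<close>

lemma has_real_derivative_integral_compact:
  fixes h :: "real \<Rightarrow> 'a::euclidean_space \<Rightarrow> real"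
  assumes K: "compact K" and I: "open I" "t \<in> I"
    and h: "\<And>s x. s \<in> I \<Longrightarrow> x \<in> K \<Longrightarrow> ((\<lambda>s. h s x) has_real_derivative h' s x) (at s)"
    and c: "continuous_on (I \<times> K) (\<lambda>p. h (fst p) (snd p))" and c': "continuous_on (I \<times> K) (\<lambda>p. h' (fst p) (snd p))"
  shows "((\<lambda>s. integral K (h s)) has_real_derivative integral K (h' t)) (at t)"
proof -
  have int: "g s integrable_on K" if "continuous_on (I \<times> K) (\<lambda>p. g (fst p) (snd p))" "s \<in> I" for g :: "real \<Rightarrow> 'a \<Rightarrow> real" and s
  proof -
    have "continuous_on K (g s)"
      using continuous_on_compose2[OF that(1), of K "\<lambda>x. (s, x)"] that(2)
      by (auto simp: image_subset_iff continuous_on_Pair)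
    then show ?thesis
      using absolutely_integrable_continuous_compact[OF K] set_lebesgue_integral_eq_integral(1) by blast
  qed
  obtain r where r: "r > 0" "cball t r \<subseteq> I"
    using I open_contains_cball by blast
  define V where "V = integral K (\<lambda>_. 1 :: real)"
  have one: "(\<lambda>_. 1 :: real) integrable_on K"
    using absolutely_integrable_continuous_compact[OF K continuous_on_const] set_lebesgue_integral_eq_integral(1)
    by blast
  have V: "((\<lambda>x. c) has_integral V * c) K" for c :: real
    using has_integral_mult_left[OF integrable_integral[OF one], of c] by (simp add: V_def)
  have "V \<ge> 0" unfolding V_def by (rule integral_nonneg[OF one]) simp
  have "uniformly_continuous_on (cball t r \<times> K) (\<lambda>p. h' (fst p) (snd p))"
    using r(2) K by (intro compact_uniformly_continuous continuous_on_subset[OF c'] compact_Times) auto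
  show ?thesis
    unfolding has_field_derivative_def has_derivative_within_alt
  proof (intro conjI allI impI)
    show "bounded_linear ((*) (integral K (h' t)))" by (rule bounded_linear_mult_right)
    fix e :: real assume e: "e > 0"
    \<comment> \<open>The \<open>+ 1\<close> covers the case that \<open>K\<close> has measure zero;
      the same device recurs in \<open>volume_lower_bound\<close>.\<close>
    define e' where "e' = e / (V + 1)"
    have e': "e' > 0" "V * e' \<le> e" using e \<open>V \<ge> 0\<close> by (auto simp: e'_def field_simps)
    obtain d where d: "d > 0" "\<And>p p'. p \<in> cball t r \<times> K \<Longrightarrow> p' \<in> cball t r \<times> K \<Longrightarrow> dist p' p < d \<Longrightarrow>
        dist (h' (fst p') (snd p')) (h' (fst p) (snd p)) < e'"
      using \<open>uniformly_continuous_on _ _\<close> e'(1) unfolding uniformly_continuous_on_def by meson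
    show "\<exists>d>0. \<forall>y\<in>UNIV. norm (y - t) < d \<longrightarrow>
        norm (integral K (h y) - integral K (h t) - integral K (h' t) * (y - t)) \<le> e * norm (y - t)"
    proof (intro exI[of _ "min d r"] conjI ballI impI)
      fix y assume y: "norm (y - t) < min d r"
      have seg: "s \<in> cball t r" "\<bar>s - t\<bar> < d" if "s \<in> closed_segment t y" for s
      proof -
        have "\<bar>s - t\<bar> \<le> \<bar>y - t\<bar>" using segment_bound(1)[OF that] by simp
        then show "s \<in> cball t r" "\<bar>s - t\<bar> < d" using y by (auto simp: dist_real_def)
      qed
      have yI: "y \<in> I" using seg(1)[of y] r(2) by auto
      have pt: "\<bar>h y x - h t x - h' t x * (y - t)\<bar> \<le> e' * \<bar>y - t\<bar>" if x: "x \<in> K" for x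
      proof -
        \<comment> \<open>The mean value inequality for \<open>h s x\<close> minus its linear part
          at \<open>t\<close>, whose derivative is at most \<open>e'\<close> along the
          segment.\<close>
        have "norm ((h y x - h' t x * y) - (h t x - h' t x * t)) \<le> e' * norm (y - t)"
        proof (rule differentiable_bound[where S = "closed_segment t y" and f' = "\<lambda>s v. (h' s x - h' t x) * v"])
          fix s assume s: "s \<in> closed_segment t y"
          then have "s \<in> I" using seg(1)[OF s] r(2) by blast
          have "((\<lambda>s. h s x - h' t x * s) has_real_derivative h' s x - h' t x) (at s)"
            using h[OF \<open>s \<in> I\<close> x] by (auto intro!: derivative_eq_intros)
          then show "((\<lambda>s. h s x - h' t x * s) has_derivative (\<lambda>v. (h' s x - h' t x) * v)) (at s within closed_segment t y)"
            by (simp add: has_field_derivative_def has_derivative_at_withinI)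
          have "dist (h' s x) (h' t x) < e'"
            using d(2)[of "(t, x)" "(s, x)"] seg[OF s] r(1) x by (auto simp: dist_Pair_Pair dist_real_def)
          then show "onorm (\<lambda>v. (h' s x - h' t x) * v) \<le> e'"
            by (intro onorm_le) (auto simp: abs_mult dist_real_def intro!: mult_right_mono)
        qed auto
        then show ?thesis by (simp add: algebra_simps)
      qed
      have i: "((\<lambda>x. h y x - h t x - h' t x * (y - t)) has_integral
          (integral K (h y) - integral K (h t) - integral K (h' t) * (y - t))) K"
        by (intro has_integral_diff has_integral_mult_left integrable_integral int c c' yI I(2))
      have "\<bar>integral K (h y) - integral K (h t) - integral K (h' t) * (y - t)\<bar> \<le> V * (e' * \<bar>y - t\<bar>)"
      proof (rule abs_leI)
        show "integral K (h y) - integral K (h t) - integral K (h' t) * (y - t) \<le> V * (e' * \<bar>y - t\<bar>)"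
          by (rule has_integral_le[OF i V]) (use pt in \<open>fastforce simp: abs_le_iff\<close>)
        show "- (integral K (h y) - integral K (h t) - integral K (h' t) * (y - t)) \<le> V * (e' * \<bar>y - t\<bar>)"
          by (rule has_integral_le[OF has_integral_neg[OF i] V]) (use pt in \<open>fastforce simp: abs_le_iff\<close>)
      qed
      also have "\<dots> \<le> e * \<bar>y - t\<bar>"
        using e'(2) by (metis abs_ge_zero mult.assoc mult_right_mono)
      finally show "norm (integral K (h y) - integral K (h t) - integral K (h' t) * (y - t)) \<le> e * norm (y - t)"
        by simp
    qed (use d r in auto)
  qed
qed

text \<open>If \<open>D\<close> were negative, take \<open>e = - D / 4\<close>. The bound makes 0 a
  local minimum of \<open>g t + e * t\<^sup>2\<close>, so its first derivative vanishes there; its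
  second derivative \<open>D + 2 * e = D / 2\<close> is still negative, so it decreases to the right
  of 0.\<close>

lemma second_derivative_nonneg_of_quadratic_lower_bound:
  fixes g g' :: "real \<Rightarrow> real"
  assumes r: "r > 0" and g: "\<And>t. \<bar>t\<bar> < r \<Longrightarrow> (g has_real_derivative g' t) (at t)"
    and g': "(g' has_real_derivative D) (at 0)"
    and low: "\<And>e. e > 0 \<Longrightarrow> \<exists>d>0. \<forall>t. \<bar>t\<bar> < d \<longrightarrow> g t \<ge> g 0 - e * t\<^sup>2"
  shows "0 \<le> D"
proof (rule ccontr)
  assume "\<not> 0 \<le> D"
  define e where "e = - D / 4"
  have e: "e > 0" using \<open>\<not> 0 \<le> D\<close> by (simp add: e_def)
  obtain d where d: "d > 0" "\<And>t. \<bar>t\<bar> < d \<Longrightarrow> g t \<ge> g 0 - e * t\<^sup>2" using low[OF e] by blast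
  define q where "q t = g t + e * t\<^sup>2" for t
  have q: "(q has_real_derivative g' t + 2 * e * t) (at t)" if "\<bar>t\<bar> < r" for t
    unfolding q_def using g[OF that] by (auto intro!: derivative_eq_intros)
  have min: "q 0 \<le> q t" if "\<bar>t\<bar> < d" for t using d(2)[OF that] by (simp add: q_def)
  have q0: "g' 0 + 2 * e * 0 = 0"
    by (rule DERIV_local_min[OF q[of 0] d(1)]) (use r min in auto)
  have "((\<lambda>t. g' t + 2 * e * t) has_real_derivative D + 2 * e) (at 0)"
    using g' by (auto intro!: derivative_eq_intros)
  moreover have "D + 2 * e < 0" using \<open>\<not> 0 \<le> D\<close> by (simp add: e_def)
  ultimately obtain b where b: "b > 0" "\<And>h. h > 0 \<Longrightarrow> h < b \<Longrightarrow> g' h + 2 * e * h < 0"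
    using DERIV_neg_dec_right[of "\<lambda>t. g' t + 2 * e * t" "D + 2 * e" 0] q0 by auto
  define c where "c = min b (min r d) / 2"
  have c: "0 < c" "c < b" "c < r" "c < d" using b(1) r d(1) by (auto simp: c_def)
  have "q c < q 0"
  proof (rule DERIV_neg_imp_decreasing_open[OF c(1)])
    show "\<exists>y. (q has_real_derivative y) (at x) \<and> y < 0" if "0 < x" "x < c" for x
      using q[of x] b(2)[of x] that c by auto
    show "continuous_on {0..c} q"
      using q c by (intro continuous_at_imp_continuous_on ballI) (auto intro!: DERIV_isCont[OF q])
  qed
  moreover have "q 0 \<le> q c" using min c by auto
  ultimately show False by simp
qed

section \<open>Lower bound for the volume of nearby submanifolds\<close>

lemma continuous_on_det:
  fixes A :: "'a::topological_space \<Rightarrow> real^'n::finite^'n"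
  assumes "\<And>i j. continuous_on S (\<lambda>x. A x $ i $ j)"
  shows "continuous_on S (\<lambda>x. det (A x))"
  unfolding det_def by (intro continuous_intros assms)

lemma C2_on_jacobian_C1_fun:
  assumes "C2_on \<Omega> f" "open \<Omega>"
  shows "C1_fun \<Omega> (\<lambda>x. jacobian f x $ a $ i)"
  using assms C1_on_nth_C1_fun[of \<Omega> "partial i f" a] by (simp add: C2_on_def)

text \<open>Compares df at \<open>x\<close> and at the displaced point \<open>z\<close>. The mean
  value inequality needs convex sets, hence balls around the points of \<open>K\<close>; the
  constant is uniform because all these balls lie in one compact subset of
  \<open>\<Omega>\<close>.\<close>

lemma jacobian_lipschitz_near_compact:
  fixes f :: "real^'n::finite \<Rightarrow> real^'m::finite"
  assumes f: "C2_on \<Omega> f" and \<Omega>: "open \<Omega>" and K: "compact K" "K \<subseteq> \<Omega>"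
  obtains L r where "L \<ge> 0" "r > 0"
    "\<And>x z v. x \<in> K \<Longrightarrow> norm (z - x) \<le> r \<Longrightarrow> norm ((jacobian f z - jacobian f x) *v v) \<le> L * norm (z - x) * norm v"
proof -
  obtain r where r: "r > 0" "(\<Union>x\<in>K. cball x r) \<subseteq> \<Omega>"
    using compact_subset_open_imp_cball_epsilon_subset[OF K(1) \<Omega> K(2)] by blast
  \<comment> \<open>Written as a sum of two compact sets, the closed neighbourhood is visibly
    compact.\<close>
  define K' where "K' = (\<Union>x\<in>K. \<Union>y\<in>cball 0 r. {x + y})"
  have K': "compact K'"
    unfolding K'_def by (rule compact_sums') (use K in auto)
  have ball: "cball x r \<subseteq> K'" if "x \<in> K" for x
  proof
    fix z assume "z \<in> cball x r"
    then have "z - x \<in> cball 0 r" "z = x + (z - x)" by (auto simp: dist_norm norm_minus_commute)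
    then show "z \<in> K'" unfolding K'_def using that by blast
  qed
  have "K' \<subseteq> \<Omega>"
  proof
    fix z assume "z \<in> K'"
    then obtain x y where "x \<in> K" "norm y \<le> r" "z = x + y" by (auto simp: K'_def)
    then have "z \<in> cball x r" by (simp add: dist_norm)
    then show "z \<in> \<Omega>" using r(2) \<open>x \<in> K\<close> by blast
  qed
  have "\<exists>B. \<forall>x\<in>K. \<forall>z\<in>cball x r. \<bar>jacobian f z $ a $ i - jacobian f x $ a $ i\<bar> \<le> B * norm (z - x)" for a i
  proof -
    obtain g' B where g': "\<And>x. x \<in> \<Omega> \<Longrightarrow> ((\<lambda>x. jacobian f x $ a $ i) has_derivative g' x) (at x)"
      and B: "\<And>x v. x \<in> K' \<Longrightarrow> \<bar>g' x v\<bar> \<le> B * norm v"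
      using C1_fun_bounded[OF C2_on_jacobian_C1_fun[OF f \<Omega>, of a i] K' \<open>K' \<subseteq> \<Omega>\<close>] by blast
    have "norm (jacobian f z $ a $ i - jacobian f x $ a $ i) \<le> B * norm (z - x)" if x: "x \<in> K" and z: "z \<in> cball x r" for x z
    proof (rule differentiable_bound[where S = "cball x r" and f' = g'])
      fix y assume y: "y \<in> cball x r"
      then have "y \<in> K'" "y \<in> \<Omega>" using ball[OF x] \<open>K' \<subseteq> \<Omega>\<close> by auto
      then show "((\<lambda>x. jacobian f x $ a $ i) has_derivative g' y) (at y within cball x r)"
        using g' has_derivative_at_withinI by blast
      show "onorm (g' y) \<le> B" using B[OF \<open>y \<in> K'\<close>] by (intro onorm_le) simp
    qed (use z r in auto)
    then show ?thesis by (intro exI[of _ B]) auto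
  qed
  then obtain B where B: "\<And>a i x z. x \<in> K \<Longrightarrow> z \<in> cball x r \<Longrightarrow>
      \<bar>jacobian f z $ a $ i - jacobian f x $ a $ i\<bar> \<le> B a i * norm (z - x)"
    by metis
  define L where "L = (\<Sum>a\<in>UNIV. \<Sum>i\<in>UNIV. \<bar>B a i\<bar>)"
  have "norm ((jacobian f z - jacobian f x) *v v) \<le> L * norm (z - x) * norm v"
    if x: "x \<in> K" and z: "norm (z - x) \<le> r" for x z v
  proof -
    have "z \<in> cball x r" using z by (simp add: dist_norm norm_minus_commute)
    have "(\<Sum>a\<in>UNIV. \<Sum>i\<in>UNIV. \<bar>(jacobian f z - jacobian f x) $ a $ i\<bar>) \<le> (\<Sum>a\<in>UNIV. \<Sum>i\<in>UNIV. \<bar>B a i\<bar> * norm (z - x))"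
    proof (intro sum_mono)
      fix a i
      have "\<bar>(jacobian f z - jacobian f x) $ a $ i\<bar> \<le> B a i * norm (z - x)"
        using B[OF x \<open>z \<in> cball x r\<close>, of a i] by simp
      also have "\<dots> \<le> \<bar>B a i\<bar> * norm (z - x)" by (intro mult_right_mono) auto
      finally show "\<bar>(jacobian f z - jacobian f x) $ a $ i\<bar> \<le> \<bar>B a i\<bar> * norm (z - x)" .
    qed
    also have "\<dots> = L * norm (z - x)" by (simp add: L_def sum_distrib_right)
    finally show ?thesis
      using norm_matrix_vector_le_sum[of "jacobian f z - jacobian f x" v]
      by (meson mult_right_mono norm_ge_zero order_trans)
  qed
  moreover have "L \<ge> 0" by (auto simp: L_def intro!: sum_nonneg)
  ultimately show ?thesis using r(1) by (intro that)
qed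

text \<open>A parametrised tangent plane with horizontal part \<open>A\<close> and vertical part
  \<open>Q\<close> is the graph of \<open>Q ** matrix_inv A\<close>. The factor
  \<open>\<bar>det A\<bar>\<close> is the Jacobian of the passage to graph coordinates.\<close>

lemma sqrt_det_sum_eq:
  fixes A :: "real^'n::finite^'n" and Q :: "real^'n^'m::finite"
  assumes A: "det A \<noteq> 0"
  shows "sqrt (det (transpose A ** A + transpose Q ** Q)) = \<bar>det A\<bar> * area_integrand (Q ** matrix_inv A)"
proof -
  let ?R = "Q ** matrix_inv A"
  have "?R ** A = Q"
    by (simp add: matrix_mul_assoc[symmetric] matrix_inv_inverse[OF A])
  have "transpose A ** graph_metric ?R ** A = transpose A ** A + transpose (?R ** A) ** (?R ** A)"
    by (simp add: graph_metric_def matrix_add_ldistrib matrix_add_rdistrib matrix_mul_assoc matrix_transpose_mul)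
  then have "transpose A ** A + transpose Q ** Q = transpose A ** graph_metric ?R ** A"
    unfolding \<open>?R ** A = Q\<close> by (rule sym)
  then have "det (transpose A ** A + transpose Q ** Q) = (det A)\<^sup>2 * det (graph_metric ?R)"
    by (simp only: det_mul det_transpose power2_eq_square mult_ac)
  then show ?thesis by (simp add: area_integrand_def real_sqrt_mult)
qed

text \<open>Time is frozen: \<open>u\<close> and \<open>d\<close> are the horizontal and vertical
  displacements, and \<open>\<tau>\<close> bounds \<open>u\<close> and both differentials. Since
  \<open>\<delta>\<close> does not depend on the displacement, the bound can be used later at every
  small time with \<open>\<tau>\<close> proportional to \<open>\<bar>t\<bar>\<close>.\<close>

lemma volume_lower_bound:
  fixes \<Omega> :: "(real^'n::finite) set" and f :: "real^'n \<Rightarrow> real^'m::finite"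
  assumes \<Omega>: "open \<Omega>" and f: "minimal_surface_system \<Omega> f" and K: "compact K" "K \<subseteq> \<Omega>"
    and convex: "\<And>x Q. x \<in> K \<Longrightarrow>
      \<exists>D\<ge>0. ((\<lambda>s. area_deriv (jacobian f x + s *\<^sub>R Q) Q) has_real_derivative D) (at 0)"
    and e: "e > 0"
  obtains \<delta> where "\<delta> > 0"
    "\<And>\<tau> u U d D J. \<lbrakk>0 \<le> \<tau>; \<tau> \<le> \<delta>;
      \<And>x. (u has_derivative (\<lambda>v. U x *v v)) (at x); \<And>x. (d has_derivative (\<lambda>v. D x *v v)) (at x);
      \<And>x v. norm (U x *v v) \<le> \<tau> * norm v; \<And>x v. norm (D x *v v) \<le> \<tau> * norm v; \<And>x. norm (u x) \<le> \<tau>;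
      \<And>x. x \<notin> K \<Longrightarrow> u x = 0; \<And>x. x \<notin> K \<Longrightarrow> d x = 0;
      continuous_on K (\<lambda>x. det (mat 1 + U x)); continuous_on K J;
      \<And>x. x \<in> K \<Longrightarrow> J x = sqrt (det (transpose (mat 1 + U x) ** (mat 1 + U x) +
          transpose (jacobian f x + D x) ** (jacobian f x + D x)))\<rbrakk>
      \<Longrightarrow> integral K J \<ge> integral K (\<lambda>x. area_integrand (jacobian f x)) - e * \<tau>\<^sup>2"
proof -
  have C2: "C2_on \<Omega> f" using f by (simp add: minimal_surface_system_def)
  obtain L r where L: "L \<ge> 0" "r > 0"
    "\<And>x z v. x \<in> K \<Longrightarrow> norm (z - x) \<le> r \<Longrightarrow> norm ((jacobian f z - jacobian f x) *v v) \<le> L * norm (z - x) * norm v"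
    using jacobian_lipschitz_near_compact[OF C2 \<Omega> K] by blast
  have Jc: "continuous_on K (\<lambda>x. jacobian f x $ a $ i)" for a i
    using C1_fun_continuous_on[OF C2_on_jacobian_C1_fun[OF C2 \<Omega>]] K(2) by (rule continuous_on_subset)
  have Jcont: "continuous_on K (jacobian f)"
    using Jc unfolding jacobian_def vec_lambda_beta by (intro continuous_on_vec_lambda)
  have Acont: "continuous_on K (\<lambda>x. area_integrand (jacobian f x))"
    unfolding area_integrand_def
    by (intro continuous_on_real_sqrt continuous_on_det) (unfold graph_metric_nth, intro continuous_intros Jc)
  have C: "compact (jacobian f ` K)" by (rule compact_continuous_image[OF Jcont K(1)])
  obtain M0 where M0: "\<And>x. x \<in> K \<Longrightarrow> norm (\<Sum>a\<in>UNIV. \<Sum>i\<in>UNIV. \<bar>jacobian f x $ a $ i\<bar>) \<le> M0"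
  proof -
    have "compact ((\<lambda>x. \<Sum>a\<in>UNIV. \<Sum>i\<in>UNIV. \<bar>jacobian f x $ a $ i\<bar>) ` K)"
      by (intro compact_continuous_image K continuous_intros Jc)
    then obtain c where "\<forall>y\<in>(\<lambda>x. \<Sum>a\<in>UNIV. \<Sum>i\<in>UNIV. \<bar>jacobian f x $ a $ i\<bar>) ` K. norm y \<le> c"
      using compact_imp_bounded bounded_iff by blast
    then show ?thesis using that by blast
  qed
  define M where "M = \<bar>M0\<bar>"
  have M: "norm (jacobian f x *v v) \<le> M * norm v" if "x \<in> K" for x v
  proof -
    have "(\<Sum>a\<in>UNIV. \<Sum>i\<in>UNIV. \<bar>jacobian f x $ a $ i\<bar>) \<le> M" using M0[OF that] unfolding M_def by simp
    then show ?thesis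
      by (intro order_trans[OF norm_matrix_vector_le_sum] mult_right_mono) auto
  qed
  have "M \<ge> 0" by (simp add: M_def)
  define V where "V = integral K (\<lambda>_. 1 :: real)"
  have int: "g integrable_on K" if "continuous_on K g" for g :: "real^'n \<Rightarrow> real"
    using absolutely_integrable_continuous_compact[OF K(1) that] set_lebesgue_integral_eq_integral(1) by blast
  have V: "((\<lambda>x. c) has_integral V * c) K" for c :: real
    using has_integral_mult_left[OF integrable_integral[OF int[of "\<lambda>_. 1"]], of c] by (simp add: V_def)
  have "V \<ge> 0" unfolding V_def by (rule integral_nonneg[OF int]) auto
  \<comment> \<open>Three contributions to the change of slope: \<open>2 * M\<close> from the
    distortion \<open>U\<close>, \<open>L\<close> from evaluating df at a shifted point, and 2 from
    \<open>D\<close>. Both 2s come from the bound on the inverse of \<open>mat 1 + U x\<close>.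
    \<open>N\<close> then sums over all matrix entries.\<close>
  define Cf where "Cf = 2 * M + L + 2"
  define N where "N = real CARD('m) * (real CARD('n) * Cf)"
  have Cf: "Cf \<ge> 2" using \<open>M \<ge> 0\<close> L(1) by (simp add: Cf_def)
  have N: "N > 0" unfolding N_def using Cf by (intro mult_pos_pos) auto
  define e' where "e' = e / (N\<^sup>2 * (V + 1))"
  have e': "e' > 0" "V * (e' * (N * \<tau>)\<^sup>2) \<le> e * \<tau>\<^sup>2" for \<tau>
  proof -
    show "e' > 0" unfolding e'_def using e N \<open>V \<ge> 0\<close> by (intro divide_pos_pos mult_pos_pos) auto
    have "V * (e' * (N * \<tau>)\<^sup>2) = V / (V + 1) * (e * \<tau>\<^sup>2)"
      using N by (simp add: e'_def power_mult_distrib)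
    also have "\<dots> \<le> 1 * (e * \<tau>\<^sup>2)"
      using \<open>V \<ge> 0\<close> e by (intro mult_right_mono) auto
    finally show "V * (e' * (N * \<tau>)\<^sup>2) \<le> e * \<tau>\<^sup>2" by simp
  qed
  obtain \<delta>0 where \<delta>0: "\<delta>0 > 0" "\<And>P Q. P \<in> jacobian f ` K \<Longrightarrow> norm Q \<le> \<delta>0 \<Longrightarrow>
      area_integrand (P + Q) \<ge> area_integrand P + area_deriv P Q - e' * (norm Q)\<^sup>2"
  proof (rule area_integrand_taylor_lower_bound[OF C _ e'(1)])
    show "\<exists>D\<ge>0. ((\<lambda>s. area_deriv (P + s *\<^sub>R Q) Q) has_real_derivative D) (at 0)" if "P \<in> jacobian f ` K" for P Q
      using that convex by blast
  qed blast
  \<comment> \<open>The three bounds serve the inversion of the identity plus \<open>u\<close>, the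
    radius of the Lipschitz estimate, and the range of the Taylor bound.\<close>
  define \<delta> where "\<delta> = min (1 / 2) (min r (\<delta>0 / N))"
  show ?thesis
  proof (rule that[of \<delta>])
    show "\<delta> > 0" using L(2) \<delta>0(1) N by (simp add: \<delta>_def)
    fix \<tau> :: real and u :: "real^'n \<Rightarrow> real^'n" and U and d :: "real^'n \<Rightarrow> real^'m" and D and J
    assume \<tau>: "0 \<le> \<tau>" "\<tau> \<le> \<delta>"
      and u: "\<And>x. (u has_derivative (\<lambda>v. U x *v v)) (at x)" and d: "\<And>x. (d has_derivative (\<lambda>v. D x *v v)) (at x)"
      and U: "\<And>x v. norm (U x *v v) \<le> \<tau> * norm v" and D: "\<And>x v. norm (D x *v v) \<le> \<tau> * norm v"
      and u\<tau>: "\<And>x. norm (u x) \<le> \<tau>"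
      and u0: "\<And>x. x \<notin> K \<Longrightarrow> u x = 0" and d0: "\<And>x. x \<notin> K \<Longrightarrow> d x = 0"
      and Uc: "continuous_on K (\<lambda>x. det (mat 1 + U x))" and JJc: "continuous_on K J"
      and J: "\<And>x. x \<in> K \<Longrightarrow> J x = sqrt (det (transpose (mat 1 + U x) ** (mat 1 + U x) +
          transpose (jacobian f x + D x) ** (jacobian f x + D x)))"
    have \<tau>': "\<tau> \<le> 1 / 2" "\<tau> \<le> r" "N * \<tau> \<le> \<delta>0"
      using \<tau> N by (auto simp: \<delta>_def field_simps)
    have U2: "norm (U x *v v) \<le> 1 / 2 * norm v" for x v
      using U[of x v] mult_right_mono[OF \<tau>'(1), of "norm v"] by simp
    obtain \<eta> where \<eta>: "\<And>x. \<eta> (x + u x) = x" "\<And>z. \<eta> z + u (\<eta> z) = z" "\<And>z. \<eta> z \<in> K \<longleftrightarrow> z \<in> K"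
      and det: "\<And>x. det (mat 1 + U x) \<noteq> 0"
      and \<eta>': "\<And>z. (\<eta> has_derivative (\<lambda>v. matrix_inv (mat 1 + U (\<eta> z)) *v v)) (at z)"
      and inv2: "\<And>x v. norm (matrix_inv (mat 1 + U x) *v v) \<le> 2 * norm v"
      by (rule has_derivative_inverse_near_identity[OF u U2 u0]) blast+
    define B where "B z = matrix_inv (mat 1 + U (\<eta> z))" for z
    \<comment> \<open>The displaced submanifold is the graph of
      \<open>z \<mapsto> f (\<eta> z) + d (\<eta> z)\<close>; \<open>\<phi>\<close> is its
      difference from \<open>f\<close> and serves as test function in the weak system.
      \<open>\<Phi>\<close> is its Jacobian.\<close>
    define \<phi> where "\<phi> z = (if z \<in> K then f (\<eta> z) + d (\<eta> z) - f z else 0)" for z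
    define \<Phi> where "\<Phi> z = (if z \<in> K then (jacobian f (\<eta> z) + D (\<eta> z)) ** B z - jacobian f z else 0)" for z
    have fd: "(f has_derivative (\<lambda>v. jacobian f x *v v)) (at x)" if "x \<in> \<Omega>" for x
    proof (rule has_derivative_jacobian)
      show "f differentiable (at x)"
        using C2 that \<Omega> unfolding C2_on_def C1_on_def by (metis differentiable_on_eq_differentiable_at)
    qed
    have \<phi>: "(\<phi> has_derivative (\<lambda>v. \<Phi> z *v v)) (at z)" for z
    proof (cases "z \<in> K")
      case True
      then have z: "z \<in> \<Omega>" "\<eta> z \<in> \<Omega>" using \<eta>(3) K(2) by auto
      have "((\<lambda>z. f (\<eta> z) + d (\<eta> z) - f z) has_derivative
          (\<lambda>v. jacobian f (\<eta> z) *v (B z *v v) + D (\<eta> z) *v (B z *v v) - jacobian f z *v v)) (at z)"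
        unfolding B_def
        by (intro has_derivative_diff has_derivative_add fd z
            has_derivative_compose[OF \<eta>' fd[OF z(2)]] has_derivative_compose[OF \<eta>' d])
      then have "(\<phi> has_derivative
          (\<lambda>v. jacobian f (\<eta> z) *v (B z *v v) + D (\<eta> z) *v (B z *v v) - jacobian f z *v v)) (at z)"
      proof (rule has_derivative_transform_within_open[OF _ \<Omega> z(1)])
        fix y assume "y \<in> \<Omega>"
        show "f (\<eta> y) + d (\<eta> y) - f y = \<phi> y"
          using \<eta>(1)[of y] by (cases "y \<in> K") (auto simp: \<phi>_def u0 d0)
      qed
      moreover have "(\<lambda>v. jacobian f (\<eta> z) *v (B z *v v) + D (\<eta> z) *v (B z *v v) - jacobian f z *v v) = (\<lambda>v. \<Phi> z *v v)"
        using True by (simp add: \<Phi>_def fun_eq_iff matrix_vector_mult_add_rdistrib matrix_vector_mult_diff_rdistrib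
            matrix_add_rdistrib matrix_vector_mul_assoc)
      ultimately show ?thesis by simp
    next
      case False
      have "((\<lambda>_. 0) has_derivative (\<lambda>_. 0)) (at z)" by simp
      then have "(\<phi> has_derivative (\<lambda>_. 0)) (at z)"
        by (rule has_derivative_transform_within_open[where s = "- K"])
           (use False K in \<open>auto simp: \<phi>_def compact_imp_closed open_Compl\<close>)
      then show ?thesis using False by (simp add: \<Phi>_def)
    qed
    have \<Phi>b: "norm (\<Phi> z *v v) \<le> Cf * \<tau> * norm v" for z v
    proof (cases "z \<in> K")
      case True
      define x where "x = \<eta> z"
      have x: "x \<in> K" "x + u x = z" using True \<eta> by (auto simp: x_def)
      have zx: "norm (z - x) \<le> \<tau>" using u\<tau>[of x] x(2) by (metis add_diff_cancel_left')
      define y where "y = B z *v v"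
      have y: "norm y \<le> 2 * norm v" using inv2 by (simp add: y_def B_def)
      have "(mat 1 + U x) *v y = v"
        by (simp add: y_def B_def x_def[symmetric] matrix_vector_mul_assoc matrix_inv_inverse[OF det])
      then have v: "v = y + U x *v y" by (simp add: matrix_vector_mult_add_rdistrib)
      \<comment> \<open>Substituting \<open>v = y + U x *v y\<close> cancels the term
        \<open>jacobian f x *v y\<close>, leaving only terms of order \<open>\<tau>\<close>.\<close>
      have "\<Phi> z *v v = - (jacobian f x *v (U x *v y)) + (- ((jacobian f z - jacobian f x) *v v)) + D x *v y"
      proof -
        have "\<Phi> z *v v = jacobian f x *v y + D x *v y - jacobian f z *v v"
          using True by (simp add: \<Phi>_def x_def y_def matrix_vector_mult_add_rdistrib matrix_vector_mult_diff_rdistrib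
            matrix_add_rdistrib matrix_vector_mul_assoc)
        moreover have "jacobian f x *v v = jacobian f x *v y + jacobian f x *v (U x *v y)"
          by (subst v) (simp add: matrix_vector_right_distrib)
        ultimately show ?thesis by (simp add: matrix_vector_mult_diff_rdistrib algebra_simps)
      qed
      then have "norm (\<Phi> z *v v) \<le> norm (jacobian f x *v (U x *v y)) + norm ((jacobian f z - jacobian f x) *v v) + norm (D x *v y)"
        by (metis norm_minus_cancel norm_triangle_ineq norm_triangle_mono order_refl)
      also have "\<dots> \<le> M * (\<tau> * (2 * norm v)) + L * \<tau> * norm v + \<tau> * (2 * norm v)"
      proof (intro add_mono)
        have "norm (jacobian f x *v (U x *v y)) \<le> M * norm (U x *v y)" by (rule M[OF x(1)])
        also have "\<dots> \<le> M * (\<tau> * norm y)" using U \<open>M \<ge> 0\<close> by (rule mult_left_mono)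
        also have "\<dots> \<le> M * (\<tau> * (2 * norm v))" using y \<open>M \<ge> 0\<close> \<tau>(1) by (intro mult_left_mono) auto
        finally show "norm (jacobian f x *v (U x *v y)) \<le> M * (\<tau> * (2 * norm v))" .
        have "norm ((jacobian f z - jacobian f x) *v v) \<le> L * norm (z - x) * norm v"
          by (rule L(3)[OF x(1)]) (use zx \<tau>'(2) in simp)
        also have "\<dots> \<le> L * \<tau> * norm v" using zx L(1) by (intro mult_right_mono mult_left_mono) auto
        finally show "norm ((jacobian f z - jacobian f x) *v v) \<le> L * \<tau> * norm v" .
        show "norm (D x *v y) \<le> \<tau> * (2 * norm v)"
          by (rule order_trans[OF D]) (use y \<tau>(1) in \<open>intro mult_left_mono\<close>)
      qed
      also have "\<dots> = Cf * \<tau> * norm v" by (simp add: Cf_def algebra_simps)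
      finally show ?thesis .
    next
      case False
      then show ?thesis using Cf \<tau>(1) by (simp add: \<Phi>_def)
    qed
    have \<Phi>n: "norm (\<Phi> z) \<le> N * \<tau>" for z
    proof -
      have "norm (\<Phi> z) \<le> (\<Sum>i\<in>(UNIV :: 'm set). \<Sum>j\<in>(UNIV :: 'n set). \<bar>\<Phi> z $ i $ j\<bar>)" by (rule norm_matrix_le_sum)
      also have "\<dots> \<le> (\<Sum>i\<in>(UNIV :: 'm set). \<Sum>j\<in>(UNIV :: 'n set). Cf * \<tau>)"
      proof (intro sum_mono)
        fix i j
        have "\<Phi> z $ i $ j = (\<Phi> z *v axis j 1) $ i" by (simp add: matrix_vector_mult_basis column_def)
        then show "\<bar>\<Phi> z $ i $ j\<bar> \<le> Cf * \<tau>"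
          using component_le_norm_cart[of "\<Phi> z *v axis j 1" i] \<Phi>b[of z "axis j 1"] by simp
      qed
      finally show ?thesis by (simp add: N_def)
    qed
    have weak: "((\<lambda>z. area_deriv (jacobian f z) (\<Phi> z)) has_integral 0) K"
      using minimal_surface_system_weak[OF \<Omega> f K \<phi> \<Phi>b] by (simp add: \<phi>_def)
    define F where "F z = area_integrand (jacobian f z + \<Phi> z)" for z
    \<comment> \<open>At \<open>z\<close> the new slope is
      \<open>(jacobian f x + D x) ** matrix_inv (mat 1 + U x)\<close> with
      \<open>x = \<eta> z\<close>, so \<open>sqrt_det_sum_eq\<close> relates the graph area density
      at \<open>z\<close> to the parametric one at \<open>x\<close>.\<close>
    have FJ: "\<bar>det (mat 1 + U (\<eta> z))\<bar> * F z = J (\<eta> z)" if "z \<in> K" for z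
      using that \<eta>(3)[of z] sqrt_det_sum_eq[OF det, of "\<eta> z" "jacobian f (\<eta> z) + D (\<eta> z)"]
      by (simp add: J F_def \<Phi>_def B_def)
    have \<eta>c: "continuous_on K \<eta>"
      using \<eta>' by (meson continuous_at_imp_continuous_on has_derivative_continuous)
    \<comment> \<open>Continuity of \<open>F\<close> is obtained from that of \<open>J\<close> and
      of the determinant, without looking at the entries of \<open>\<Phi>\<close>.\<close>
    have "continuous_on K (\<lambda>z. J (\<eta> z) / \<bar>det (mat 1 + U (\<eta> z))\<bar>)"
      by (intro continuous_on_divide continuous_on_rabs continuous_on_compose2[OF JJc \<eta>c] continuous_on_compose2[OF Uc \<eta>c])
         (use \<eta>(3) det in auto)
    then have Fc: "continuous_on K F"
      by (rule continuous_on_eq) (use FJ det in \<open>auto simp: field_simps\<close>)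
    have img: "(\<lambda>x. x + u x) ` K = K"
    proof (intro set_eqI iffI)
      fix z assume "z \<in> (\<lambda>x. x + u x) ` K"
      then obtain x where "x \<in> K" "z = x + u x" by blast
      then show "z \<in> K" using \<eta>(1,3) by metis
    next
      fix z assume "z \<in> K"
      then show "z \<in> (\<lambda>x. x + u x) ` K" using \<eta>(2)[of z] \<eta>(3)[of z] by (metis imageI)
    qed
    have "((\<lambda>x. \<bar>det (matrix (\<lambda>v. (mat 1 + U x) *v v))\<bar> * F (x + u x)) has_integral integral ((\<lambda>x. x + u x) ` K) F) K"
    proof (rule has_integral_change_of_variables_compact[OF K(1)])
      show "((\<lambda>x. x + u x) has_derivative (\<lambda>v. (mat 1 + U x) *v v)) (at x within K)" for x
        using has_derivative_add[OF has_derivative_ident u[of x]]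
        by (simp add: matrix_vector_mult_add_rdistrib has_derivative_at_withinI)
      show "inj_on (\<lambda>x. x + u x) K" by (rule inj_on_inverseI[where g = \<eta>]) (rule \<eta>(1))
      show "continuous_on ((\<lambda>x. x + u x) ` K) F" unfolding img by (rule Fc)
    qed
    then have "(J has_integral integral K F) K"
      unfolding img
    proof (rule has_integral_eq[rotated])
      fix x assume "x \<in> K"
      then have "x + u x \<in> K" using img by blast
      from FJ[OF this] show "\<bar>det (matrix (\<lambda>v. (mat 1 + U x) *v v))\<bar> * F (x + u x) = J x"
        by (simp add: \<eta>(1))
    qed
    then have JF: "integral K J = integral K F" by (rule integral_unique)
    have "((\<lambda>z. area_integrand (jacobian f z) + area_deriv (jacobian f z) (\<Phi> z) - e' * (N * \<tau>)\<^sup>2) has_integral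
        (integral K (\<lambda>x. area_integrand (jacobian f x)) + 0 - V * (e' * (N * \<tau>)\<^sup>2))) K"
      by (intro has_integral_diff has_integral_add weak V integrable_integral int Acont)
    moreover have "(F has_integral integral K F) K" using int[OF Fc] by (rule integrable_integral)
    ultimately have "integral K (\<lambda>x. area_integrand (jacobian f x)) + 0 - V * (e' * (N * \<tau>)\<^sup>2) \<le> integral K F"
    proof (rule has_integral_le)
      fix z assume z: "z \<in> K"
      have "norm (\<Phi> z) \<le> \<delta>0" using \<Phi>n[of z] \<tau>'(3) by simp
      from \<delta>0(2)[OF _ this, of "jacobian f z"] z
      have "area_integrand (jacobian f z) + area_deriv (jacobian f z) (\<Phi> z) - e' * (norm (\<Phi> z))\<^sup>2 \<le> F z"
        by (simp add: F_def)
      moreover have "e' * (norm (\<Phi> z))\<^sup>2 \<le> e' * (N * \<tau>)\<^sup>2"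
        using e'(1) \<Phi>n[of z] by (intro mult_left_mono power_mono) auto
      ultimately show "area_integrand (jacobian f z) + area_deriv (jacobian f z) (\<Phi> z) - e' * (N * \<tau>)\<^sup>2 \<le> F z"
        by simp
    qed
    then show "integral K J \<ge> integral K (\<lambda>x. area_integrand (jacobian f x)) - e * \<tau>\<^sup>2"
      using e'(2)[of \<tau>] JF by simp
  qed
qed

section \<open>Stability\<close>

text \<open>The velocity is bounded on the compact product of \<open>K\<close> with the closed
  half-length interval, and the mean value inequality applies in time.\<close>

lemma C2_in_time_lipschitz:
  assumes h: "C2_in_time \<epsilon> S h" and K: "compact K" "K \<subseteq> S" and \<epsilon>: "0 < \<epsilon>"
  shows "\<exists>C\<ge>0. \<forall>t x. \<bar>t\<bar> \<le> \<epsilon> / 2 \<longrightarrow> x \<in> K \<longrightarrow> norm (h t x - h 0 x) \<le> C * \<bar>t\<bar>"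
proof -
  obtain h' h'' where d: "\<And>t x. t \<in> {-\<epsilon><..<\<epsilon>} \<Longrightarrow> x \<in> S \<Longrightarrow> ((\<lambda>s. h s x) has_vector_derivative h' t x) (at t)"
    and c: "continuous_on ({-\<epsilon><..<\<epsilon>} \<times> S) (\<lambda>p. h' (fst p) (snd p))"
    by (rule C2_in_timeE[OF h]) blast
  have "compact ((\<lambda>p. h' (fst p) (snd p)) ` ({-(\<epsilon>/2)..\<epsilon>/2} \<times> K))"
    by (intro compact_continuous_image continuous_on_subset[OF c] compact_Times K) (use K \<epsilon> in auto)
  then obtain C where C: "\<forall>y\<in>(\<lambda>p. h' (fst p) (snd p)) ` ({-(\<epsilon>/2)..\<epsilon>/2} \<times> K). norm y \<le> C"
    using compact_imp_bounded bounded_iff by blast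
  have "norm (h t x - h 0 x) \<le> \<bar>C\<bar> * \<bar>t\<bar>" if t: "\<bar>t\<bar> \<le> \<epsilon> / 2" and x: "x \<in> K" for t x
  proof -
    have "norm (h t x - h 0 x) \<le> \<bar>C\<bar> * norm (t - 0)"
    proof (rule differentiable_bound[where S = "{-(\<epsilon>/2)..\<epsilon>/2}" and f = "\<lambda>s. h s x" and f' = "\<lambda>s v. v *\<^sub>R h' s x"])
      fix s assume s: "s \<in> {-(\<epsilon>/2)..\<epsilon>/2}"
      have "((\<lambda>s. h s x) has_vector_derivative h' s x) (at s)"
        by (rule d) (use s x K \<epsilon> in auto)
      then show "((\<lambda>s. h s x) has_derivative (\<lambda>v. v *\<^sub>R h' s x)) (at s within {-(\<epsilon>/2)..\<epsilon>/2})"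
        by (simp add: has_vector_derivative_def has_derivative_at_withinI)
      have "norm (h' s x) \<le> C" using C s x by force
      then show "onorm (\<lambda>v. v *\<^sub>R h' s x) \<le> \<bar>C\<bar>"
        by (intro onorm_le) (simp add: mult.commute[of _ "norm (h' s x)"] mult_right_mono)
    qed (use t \<epsilon> in \<open>auto simp: abs_le_iff\<close>)
    then show ?thesis by simp
  qed
  then show ?thesis by (intro exI[of _ "\<bar>C\<bar>"]) auto
qed

lemma C2_in_time_continuous_on_slice:
  assumes "C2_in_time \<epsilon> S h" "t \<in> {-\<epsilon><..<\<epsilon>}"
  shows "continuous_on S (h t)"
proof -
  have "continuous_on ({-\<epsilon><..<\<epsilon>} \<times> S) (\<lambda>p. h (fst p) (snd p))"
    by (rule C2_in_timeE[OF assms(1)]) blast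
  from continuous_on_compose2[OF this, of S "\<lambda>x. (t, x)"] assms(2) show ?thesis
    by (auto simp: image_subset_iff continuous_on_Pair)
qed

lemma inner_matrix_columns:
  fixes A :: "real^'n::finite^'m::finite"
  shows "(A *v axis i 1) \<bullet> (A *v axis j 1) = (transpose A ** A) $ i $ j"
  by (simp add: matrix_vector_mult_basis column_def inner_vec_def matrix_matrix_mult_def transpose_def)

lemma jacobian_zero: "jacobian (\<lambda>_. 0) x = 0"
  by (simp add: jacobian_eq_matrix[OF has_derivative_const] matrix_def vec_eq_iff del: jacobian_nth)

text \<open>An orthonormal pair spans a bivector of norm 1, so the bound on
  \<open>wedge2_norm\<close> is in particular a bound on the areas spanned by images of orthonormal
  pairs.\<close>

lemma area_second_derivative_nonneg:
  fixes f :: "real^'n::finite \<Rightarrow> real^'m::finite"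
  assumes n: "CARD('n) \<ge> 2" and f: "f differentiable (at x)"
    and w: "wedge2_norm (frechet_derivative f (at x)) \<le> 1 / (real CARD('n) - 1)"
  shows "\<exists>D\<ge>0. ((\<lambda>s. area_deriv (jacobian f x + s *\<^sub>R Q) Q) has_real_derivative D) (at 0)"
proof -
  let ?P = "jacobian f x"
  have L: "frechet_derivative f (at x) = (\<lambda>v. ?P *v v)"
    using frechet_derivative_at[OF has_derivative_jacobian[OF f]] by simp
  obtain D where "0 \<le> D" "((\<lambda>s. area_deriv (?P + s *\<^sub>R Q) Q) has_real_derivative D) (at 0)"
  proof (rule area_deriv_has_nonneg_derivative[OF n])
    fix v y :: "real^'n" assume "norm v = 1" "norm y = 1" "v \<bullet> y = 0"
    then have "bivector_norm (wedge v y) = 1"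
      by (simp add: bivector_norm_wedge norm_eq_1)
    then have "bivector_norm (wedge (?P *v v) (?P *v y)) \<le> 1 / (real CARD('n) - 1)"
      using wedge2_norm_upper[of "\<lambda>v. ?P *v v" v y] w by (simp add: L)
    then show "sqrt (((?P *v v) \<bullet> (?P *v v)) * ((?P *v y) \<bullet> (?P *v y)) - ((?P *v v) \<bullet> (?P *v y))\<^sup>2)
        \<le> 1 / (real CARD('n) - 1)"
      by (simp add: bivector_norm_wedge)
  qed blast
  then show ?thesis by blast
qed

theorem theoremC:
  fixes \<Omega> :: "(real^'n::finite) set" and f :: "real^'n \<Rightarrow> real^'m::finite"
  assumes "CARD('n) \<ge> 2"
    and "open \<Omega>" and "connected \<Omega>" and "bounded \<Omega>"
    and "minimal_surface_system \<Omega> f"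
    and "\<forall>x\<in>\<Omega>. wedge2_norm (frechet_derivative f (at x)) \<le> 1 / (real CARD('n) - 1)"
  shows "stable_submanifold \<Omega> (graph_param f)"
  unfolding stable_submanifold_def
proof (intro allI impI)
  fix K \<epsilon> and F :: "real \<Rightarrow> real^'n \<Rightarrow> (real^'n) \<times> (real^'m)"
  assume NV: "normal_variation \<Omega> (graph_param f) K \<epsilon> F"
  note \<Omega> = \<open>open \<Omega>\<close>
  have K: "compact K" "K \<subseteq> \<Omega>" and \<epsilon>: "0 < \<epsilon>" and F0: "\<And>x. x \<in> \<Omega> \<Longrightarrow> F 0 x = graph_param f x"
    and Fout: "\<And>t x. t \<in> {-\<epsilon><..<\<epsilon>} \<Longrightarrow> x \<in> \<Omega> - K \<Longrightarrow> F t x = graph_param f x"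
    and Fdiff: "\<And>t. t \<in> {-\<epsilon><..<\<epsilon>} \<Longrightarrow> F t differentiable_on \<Omega>"
    and FC2: "C2_in_time \<epsilon> \<Omega> F" and dFC2: "\<And>i. C2_in_time \<epsilon> \<Omega> (\<lambda>t. partial i (F t))"
    using NV unfolding normal_variation_def by blast+
  have fdiff: "f differentiable (at x)" if "x \<in> \<Omega>" for x
    using assms(5) that \<Omega> unfolding minimal_surface_system_def C2_on_def C1_on_def
    by (metis differentiable_on_eq_differentiable_at)
  have convex: "\<exists>D\<ge>0. ((\<lambda>s. area_deriv (jacobian f x + s *\<^sub>R Q) Q) has_real_derivative D) (at 0)"
    if "x \<in> K" for x Q
    using that K(2) assms(1,6) fdiff by (intro area_second_derivative_nonneg) auto

  \<comment> \<open>Horizontal and vertical displacements. Both vanish off \<open>K\<close>, so the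
    extension by zero makes them differentiable on the whole space, as the global inversion of the
    identity plus \<open>u\<close> demands.\<close>
  define u where "u t x = (if x \<in> \<Omega> then fst (F t x) - x else 0)" for t x
  define d where "d t x = (if x \<in> \<Omega> then snd (F t x) - f x else 0)" for t x
  define U where "U t = jacobian (u t)" for t
  define D where "D t = jacobian (d t)" for t
  have supp: "u t x = 0" "d t x = 0" if "t \<in> {-\<epsilon><..<\<epsilon>}" "x \<notin> K" for t x
    using Fout[OF that(1), of x] that(2) by (auto simp: u_def d_def graph_param_def)
  \<comment> \<open>The open sets \<open>\<Omega>\<close> and the complement of \<open>K\<close>
    cover the space; the displacement is differentiable on the first and zero on the second.\<close>
  have diff: "u t differentiable (at x)" "d t differentiable (at x)" if t: "t \<in> {-\<epsilon><..<\<epsilon>}" for t x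
  proof -
    have "u t differentiable (at x) \<and> d t differentiable (at x)"
    proof (cases "x \<in> \<Omega>")
      case True
      have "F t differentiable (at x)"
        using Fdiff[OF t] True \<Omega> by (metis differentiable_on_eq_differentiable_at)
      then obtain F' where F': "(F t has_derivative F') (at x)" unfolding differentiable_def by blast
      obtain f' where f': "(f has_derivative f') (at x)" using fdiff[OF True] unfolding differentiable_def by blast
      have "((\<lambda>x. fst (F t x) - x) has_derivative (\<lambda>v. fst (F' v) - v)) (at x)"
        by (intro has_derivative_diff has_derivative_fst F' has_derivative_ident)
      then have "(u t has_derivative (\<lambda>v. fst (F' v) - v)) (at x)"
        by (rule has_derivative_transform_within_open[OF _ \<Omega> True]) (simp add: u_def)
      moreover have "((\<lambda>x. snd (F t x) - f x) has_derivative (\<lambda>v. snd (F' v) - f' v)) (at x)"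
        by (intro has_derivative_diff has_derivative_snd F' f')
      then have "(d t has_derivative (\<lambda>v. snd (F' v) - f' v)) (at x)"
        by (rule has_derivative_transform_within_open[OF _ \<Omega> True]) (simp add: d_def)
      ultimately show ?thesis unfolding differentiable_def by blast
    next
      case False
      then have x: "x \<in> - K" using K(2) by blast
      have op: "open (- K)" using K(1) by (simp add: compact_imp_closed open_Compl)
      have "((\<lambda>_. 0) has_derivative (\<lambda>_. 0)) (at x)" by simp
      from has_derivative_transform_within_open[OF this op x, of "u t"]
      have "(u t has_derivative (\<lambda>_. 0)) (at x)" using supp(1)[OF t] by simp
      moreover have "((\<lambda>_. 0) has_derivative (\<lambda>_. 0)) (at x)" by simp
      from has_derivative_transform_within_open[OF this op x, of "d t"]
      have "(d t has_derivative (\<lambda>_. 0)) (at x)" using supp(2)[OF t] by simp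
      ultimately show ?thesis unfolding differentiable_def by blast
    qed
    then show "u t differentiable (at x)" "d t differentiable (at x)" by auto
  qed
  have uder: "(u t has_derivative (\<lambda>v. U t x *v v)) (at x)" and dder: "(d t has_derivative (\<lambda>v. D t x *v v)) (at x)"
    if "t \<in> {-\<epsilon><..<\<epsilon>}" for t x
    unfolding U_def D_def using diff[OF that] by (auto intro: has_derivative_jacobian)
  have UD_out: "U t x = 0" "D t x = 0" if t: "t \<in> {-\<epsilon><..<\<epsilon>}" and x: "x \<notin> K" for t x
  proof -
    have op: "open (- K)" "x \<in> - K" using K(1) x by (auto simp: compact_imp_closed open_Compl)
    have "((\<lambda>_. 0) has_derivative (\<lambda>_. 0)) (at x)" by simp
    from has_derivative_transform_within_open[OF this op, of "u t"]
    have "(u t has_derivative (\<lambda>_. 0)) (at x)" using supp(1)[OF t] by simp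
    then show "U t x = 0" unfolding U_def by (simp add: jacobian_eq_matrix vec_eq_iff matrix_def)
    have "((\<lambda>_. 0) has_derivative (\<lambda>_. 0)) (at x)" by simp
    from has_derivative_transform_within_open[OF this op, of "d t"]
    have "(d t has_derivative (\<lambda>_. 0)) (at x)" using supp(2)[OF t] by simp
    then show "D t x = 0" unfolding D_def by (simp add: jacobian_eq_matrix vec_eq_iff matrix_def)
  qed
  have partialF: "partial i (F t) x = ((mat 1 + U t x) *v axis i 1, (jacobian f x + D t x) *v axis i 1)"
    if t: "t \<in> {-\<epsilon><..<\<epsilon>}" and x: "x \<in> \<Omega>" for t x i
  proof -
    have "((\<lambda>x. (x + u t x, f x + d t x)) has_derivative
        (\<lambda>v. (v + U t x *v v, jacobian f x *v v + D t x *v v))) (at x)"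
      by (intro has_derivative_Pair has_derivative_add has_derivative_ident uder dder t
          has_derivative_jacobian fdiff x)
    then have "(F t has_derivative (\<lambda>v. (v + U t x *v v, jacobian f x *v v + D t x *v v))) (at x)"
      by (rule has_derivative_transform_within_open[OF _ \<Omega> x]) (simp add: u_def d_def)
    from partial_eq[OF this] show ?thesis
      by (simp add: matrix_vector_mult_add_rdistrib)
  qed
  have zero: "0 \<in> {-\<epsilon><..<\<epsilon>}" using \<epsilon> by simp
  have U0: "U 0 x = 0" "D 0 x = 0" for x
  proof -
    have z: "u 0 = (\<lambda>_. 0)" "d 0 = (\<lambda>_. 0)" by (auto simp: u_def d_def F0 graph_param_def)
    show "U 0 x = 0" "D 0 x = 0" unfolding U_def D_def z by (rule jacobian_zero)+
  qed

  obtain C0 where C0: "C0 \<ge> 0" "\<And>t x. \<bar>t\<bar> \<le> \<epsilon> / 2 \<Longrightarrow> x \<in> K \<Longrightarrow> norm (F t x - F 0 x) \<le> C0 * \<bar>t\<bar>"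
    using C2_in_time_lipschitz[OF FC2 K \<epsilon>] by blast
  have "\<exists>C. \<forall>i. C i \<ge> 0 \<and> (\<forall>t x. \<bar>t\<bar> \<le> \<epsilon> / 2 \<longrightarrow> x \<in> K \<longrightarrow> norm (partial i (F t) x - partial i (F 0) x) \<le> C i * \<bar>t\<bar>)"
    using C2_in_time_lipschitz[OF dFC2 K \<epsilon>] by (intro choice) blast
  then obtain Cp where Cp: "\<And>i. Cp i \<ge> 0"
      "\<And>i t x. \<bar>t\<bar> \<le> \<epsilon> / 2 \<Longrightarrow> x \<in> K \<Longrightarrow> norm (partial i (F t) x - partial i (F 0) x) \<le> Cp i * \<bar>t\<bar>"
    by blast
  \<comment> \<open>One constant for \<open>u\<close>, \<open>U\<close> and \<open>D\<close>:
    entries in column \<open>i\<close> are at most \<open>Cp i * \<bar>t\<bar>\<close>, and the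
    matrix bounds sum over all entries. The \<open>+ 1\<close> permits division by
    \<open>C\<close>.\<close>
  define C where "C = C0 + (\<Sum>a\<in>(UNIV :: 'n set). \<Sum>i\<in>UNIV. Cp i) + (\<Sum>a\<in>(UNIV :: 'm set). \<Sum>i\<in>UNIV. Cp i) + 1"
  have sums: "(\<Sum>a\<in>(UNIV :: 'n set). \<Sum>i\<in>UNIV. Cp i) \<ge> 0" "(\<Sum>a\<in>(UNIV :: 'm set). \<Sum>i\<in>UNIV. Cp i) \<ge> 0"
    by (intro sum_nonneg Cp(1))+
  have C: "C > 0" "C0 \<le> C" "(\<Sum>a\<in>(UNIV :: 'n set). \<Sum>i\<in>UNIV. Cp i) \<le> C" "(\<Sum>a\<in>(UNIV :: 'm set). \<Sum>i\<in>UNIV. Cp i) \<le> C"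
    using sums C0(1) by (auto simp: C_def)
  have small: "t \<in> {-\<epsilon><..<\<epsilon>}" if "\<bar>t\<bar> \<le> \<epsilon> / 2" for t using that \<epsilon> by auto
  have ub: "norm (u t x) \<le> C * \<bar>t\<bar>" if t: "\<bar>t\<bar> \<le> \<epsilon> / 2" for t x
  proof (cases "x \<in> K")
    case True
    then have "x \<in> \<Omega>" using K by blast
    then have "u t x = fst (F t x - F 0 x)" by (simp add: u_def F0 graph_param_def)
    then have "norm (u t x) \<le> norm (F t x - F 0 x)" by (metis norm_fst_le prod.collapse)
    also have "\<dots> \<le> C0 * \<bar>t\<bar>" by (rule C0(2)[OF t True])
    also have "\<dots> \<le> C * \<bar>t\<bar>" using C(2) by (rule mult_right_mono) simp
    finally show ?thesis .
  next
    case False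
    then show ?thesis using supp(1)[OF small[OF t]] C(1) by simp
  qed
  have UDb: "norm (U t x *v v) \<le> C * \<bar>t\<bar> * norm v" "norm (D t x *v y) \<le> C * \<bar>t\<bar> * norm y"
    if t: "\<bar>t\<bar> \<le> \<epsilon> / 2" for t x v y
  proof -
    have "norm (U t x *v v) \<le> C * \<bar>t\<bar> * norm v \<and> norm (D t x *v y) \<le> C * \<bar>t\<bar> * norm y"
    proof (cases "x \<in> K")
      case True
      then have x: "x \<in> \<Omega>" using K by blast
      have p: "partial i (F t) x - partial i (F 0) x = (U t x *v axis i 1, D t x *v axis i 1)" for i
        using partialF[OF small[OF t] x] partialF[OF zero x]
        by (simp add: U0 matrix_vector_mult_add_rdistrib)
      have n: "norm (U t x *v axis i 1) \<le> Cp i * \<bar>t\<bar>" "norm (D t x *v axis i 1) \<le> Cp i * \<bar>t\<bar>" for i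
        using Cp(2)[OF t True, of i] unfolding p
        by (auto intro: order_trans[OF norm_fst_le] order_trans[OF norm_snd_le])
      have e: "\<bar>U t x $ a $ i\<bar> \<le> Cp i * \<bar>t\<bar>" "\<bar>D t x $ b $ i\<bar> \<le> Cp i * \<bar>t\<bar>" for a b i
        using component_le_norm_cart[of "U t x *v axis i 1" a] component_le_norm_cart[of "D t x *v axis i 1" b] n[of i]
        by (auto simp: matrix_vector_mult_basis column_def)
      have "(\<Sum>a\<in>UNIV. \<Sum>i\<in>UNIV. \<bar>U t x $ a $ i\<bar>) \<le> (\<Sum>a\<in>(UNIV :: 'n set). \<Sum>i\<in>UNIV. Cp i) * \<bar>t\<bar>"
        unfolding sum_distrib_right by (intro sum_mono e)
      also have "\<dots> \<le> C * \<bar>t\<bar>" using C(3) by (rule mult_right_mono) simp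
      finally have 1: "norm (U t x *v v) \<le> C * \<bar>t\<bar> * norm v"
        by (intro order_trans[OF norm_matrix_vector_le_sum] mult_right_mono) auto
      have "(\<Sum>a\<in>UNIV. \<Sum>i\<in>UNIV. \<bar>D t x $ a $ i\<bar>) \<le> (\<Sum>a\<in>(UNIV :: 'm set). \<Sum>i\<in>UNIV. Cp i) * \<bar>t\<bar>"
        unfolding sum_distrib_right by (intro sum_mono e)
      also have "\<dots> \<le> C * \<bar>t\<bar>" using C(4) by (rule mult_right_mono) simp
      finally have "norm (D t x *v y) \<le> C * \<bar>t\<bar> * norm y"
        by (intro order_trans[OF norm_matrix_vector_le_sum] mult_right_mono) auto
      with 1 show ?thesis ..
    next
      case False
      then show ?thesis using UD_out[OF small[OF t]] C(1) by simp
    qed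
    then show "norm (U t x *v v) \<le> C * \<bar>t\<bar> * norm v" "norm (D t x *v y) \<le> C * \<bar>t\<bar> * norm y" by auto
  qed

  have gram: "gram_matrix (F t) x = transpose (mat 1 + U t x) ** (mat 1 + U t x) +
      transpose (jacobian f x + D t x) ** (jacobian f x + D t x)"
    if "t \<in> {-\<epsilon><..<\<epsilon>}" "x \<in> \<Omega>" for t x
    by (simp add: gram_matrix_def partialF[OF that] vec_eq_iff inner_matrix_columns)
  \<comment> \<open>The bound \<open>1 / (2 * C)\<close> keeps \<open>U t x\<close> below 1/2, so
    \<open>mat 1 + U t x\<close> is invertible.\<close>
  define \<epsilon>1 where "\<epsilon>1 = min (\<epsilon> / 2) (1 / (2 * C))"
  have \<epsilon>1: "0 < \<epsilon>1" "\<epsilon>1 \<le> \<epsilon> / 2" using \<epsilon> C(1) by (auto simp: \<epsilon>1_def)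
  have half: "norm (U t x *v v) \<le> 1 / 2 * norm v" if t: "\<bar>t\<bar> < \<epsilon>1" for t x v
  proof -
    have "C * \<bar>t\<bar> \<le> 1 / 2" using t C(1) by (simp add: \<epsilon>1_def field_simps)
    then have "C * \<bar>t\<bar> * norm v \<le> 1 / 2 * norm v" by (rule mult_right_mono) simp
    then show ?thesis using UDb(1)[of t x v] t \<epsilon>1(2) by linarith
  qed
  \<comment> \<open>The parametrisation stays an immersion on \<open>K\<close>; the square root of
    the Gram determinant is then C2 in time.\<close>
  have pos: "det (gram_matrix (F t) x) > 0" if t: "\<bar>t\<bar> < \<epsilon>1" and x: "x \<in> K" for t x
  proof -
    have t': "t \<in> {-\<epsilon><..<\<epsilon>}" using t \<epsilon>1 small[of t] by simp
    have "det (mat 1 + U t x) \<noteq> 0"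
      by (rule has_derivative_inverse_near_identity[OF uder[OF t'] half[OF t] supp(1)[OF t']]) blast
    then have "sqrt (det (gram_matrix (F t) x)) > 0"
      using sqrt_det_sum_eq[of "mat 1 + U t x" "jacobian f x + D t x"] x K(2)
      by (simp add: gram[OF t'] subset_iff area_integrand_pos)
    then show ?thesis by simp
  qed
  define J where "J t x = sqrt (det (gram_matrix (F t) x))" for t x
  have volJ: "volume K (F t) = integral K (J t)" for t by (simp add: volume_def J_def[abs_def])
  have "C2_in_time \<epsilon>1 K J"
    unfolding J_def[abs_def]
  proof (intro C2_in_time_sqrt C2_in_time_det)
    have "C2_in_time \<epsilon>1 K (\<lambda>t. partial i (F t))" for i
      by (rule C2_in_time_subset[OF dFC2 K(2)]) (use \<epsilon>1 in simp)
    \<comment> \<open>In coordinates the inner product is a finite sum of products of scalars, to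
      which the closure rules apply.\<close>
    then show "C2_in_time \<epsilon>1 K (\<lambda>t x. gram_matrix (F t) x $ i $ j)" for i j
      unfolding gram_matrix_def vec_lambda_beta
      by (subst euclidean_inner) (intro C2_in_time_sum C2_in_time_mult C2_in_time_bounded_linear[OF bounded_linear_inner_left])
    show "0 < det (gram_matrix (F t) x)" if "t \<in> {-\<epsilon>1<..<\<epsilon>1}" "x \<in> K" for t x
      using pos[of t x] that by auto
  qed
  note JC2 = this
  then obtain J' J'' where J: "\<And>t x. t \<in> {-\<epsilon>1<..<\<epsilon>1} \<Longrightarrow> x \<in> K \<Longrightarrow> ((\<lambda>s. J s x) has_real_derivative J' t x) (at t)"
    "\<And>t x. t \<in> {-\<epsilon>1<..<\<epsilon>1} \<Longrightarrow> x \<in> K \<Longrightarrow> ((\<lambda>s. J' s x) has_real_derivative J'' t x) (at t)"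
    and Jc: "continuous_on ({-\<epsilon>1<..<\<epsilon>1} \<times> K) (\<lambda>p. J (fst p) (snd p))"
      "continuous_on ({-\<epsilon>1<..<\<epsilon>1} \<times> K) (\<lambda>p. J' (fst p) (snd p))"
      "continuous_on ({-\<epsilon>1<..<\<epsilon>1} \<times> K) (\<lambda>p. J'' (fst p) (snd p))"
    unfolding has_real_derivative_iff_has_vector_derivative by (rule C2_in_timeE) blast
  have vol': "((\<lambda>s. integral K (J s)) has_real_derivative integral K (J' t)) (at t)" if "\<bar>t\<bar> < \<epsilon>1" for t
    by (rule has_real_derivative_integral_compact[OF K(1) _ _ J(1) Jc(1,2)]) (use that in auto)
  have vol'': "((\<lambda>s. integral K (J' s)) has_real_derivative integral K (J'' 0)) (at 0)"
    by (rule has_real_derivative_integral_compact[OF K(1) _ _ J(2) Jc(2,3)]) (use \<epsilon>1 in auto)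
  have J0: "J 0 x = area_integrand (jacobian f x)" if "x \<in> K" for x
    using that K(2) by (simp add: J_def gram[OF zero] subset_iff U0 area_integrand_def graph_metric_def transpose_mat)
  have low: "\<exists>\<rho>>0. \<forall>t. \<bar>t\<bar> < \<rho> \<longrightarrow> integral K (J t) \<ge> integral K (J 0) - e * t\<^sup>2" if e: "e > 0" for e
  proof -
    \<comment> \<open>The bound is applied with \<open>\<tau> = C * \<bar>t\<bar>\<close>, and
      dividing by the square of \<open>C\<close> restores \<open>e * t\<^sup>2\<close>.\<close>
    have "e / C\<^sup>2 > 0" using e C(1) by simp
    from volume_lower_bound[OF \<Omega> assms(5) K convex this]
    obtain \<delta> where \<delta>: "\<delta> > 0" and bound:
      "\<And>\<tau> u U d D J. \<lbrakk>0 \<le> \<tau>; \<tau> \<le> \<delta>;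
      \<And>x. (u has_derivative (\<lambda>v. U x *v v)) (at x); \<And>x. (d has_derivative (\<lambda>v. D x *v v)) (at x);
      \<And>x v. norm (U x *v v) \<le> \<tau> * norm v; \<And>x v. norm (D x *v v) \<le> \<tau> * norm v; \<And>x. norm (u x) \<le> \<tau>;
      \<And>x. x \<notin> K \<Longrightarrow> u x = 0; \<And>x. x \<notin> K \<Longrightarrow> d x = 0;
      continuous_on K (\<lambda>x. det (mat 1 + U x)); continuous_on K J;
      \<And>x. x \<in> K \<Longrightarrow> J x = sqrt (det (transpose (mat 1 + U x) ** (mat 1 + U x) +
          transpose (jacobian f x + D x) ** (jacobian f x + D x)))\<rbrakk>
      \<Longrightarrow> integral K J \<ge> integral K (\<lambda>x. area_integrand (jacobian f x)) - e / C\<^sup>2 * \<tau>\<^sup>2"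
      by blast
    show ?thesis
    proof (intro exI[of _ "min \<epsilon>1 (\<delta> / C)"] conjI allI impI)
      show "min \<epsilon>1 (\<delta> / C) > 0" using \<epsilon>1 \<delta> C(1) by simp
      fix t assume t: "\<bar>t\<bar> < min \<epsilon>1 (\<delta> / C)"
      then have t1: "\<bar>t\<bar> \<le> \<epsilon> / 2" "t \<in> {-\<epsilon>1<..<\<epsilon>1}" using \<epsilon>1 by auto
      note t2 = small[OF t1(1)]
      have "integral K (J t) \<ge> integral K (\<lambda>x. area_integrand (jacobian f x)) - e / C\<^sup>2 * (C * \<bar>t\<bar>)\<^sup>2"
      proof (rule bound[where u = "u t" and U = "U t" and d = "d t" and D = "D t"])
        show "0 \<le> C * \<bar>t\<bar>" "C * \<bar>t\<bar> \<le> \<delta>" using t C(1) by (auto simp: field_simps)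
        show "continuous_on K (J t)" by (rule C2_in_time_continuous_on_slice[OF JC2 t1(2)])
        \<comment> \<open>The horizontal part of \<open>partial i (F t)\<close> is column
          \<open>i\<close> of \<open>mat 1 + U t x\<close>.\<close>
        show "continuous_on K (\<lambda>x. det (mat 1 + U t x))"
        proof (rule continuous_on_det)
          fix a i
          have "continuous_on K (partial i (F t))"
            by (rule continuous_on_subset[OF C2_in_time_continuous_on_slice[OF dFC2 t2] K(2)])
          then have "continuous_on K (\<lambda>x. fst (partial i (F t) x) $ a)"
            by (intro continuous_intros)
          then show "continuous_on K (\<lambda>x. (mat 1 + U t x) $ a $ i)"
            by (rule continuous_on_eq) (use K(2) partialF[OF t2] in \<open>auto simp: matrix_vector_mult_basis column_def subset_iff\<close>)
        qed
        show "J t x = sqrt (det (transpose (mat 1 + U t x) ** (mat 1 + U t x) +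
          transpose (jacobian f x + D t x) ** (jacobian f x + D t x)))" if "x \<in> K" for x
          using gram[OF t2, of x] that K(2) by (simp add: J_def subset_iff)
      qed (use uder[OF t2] dder[OF t2] UDb[OF t1(1)] ub[OF t1(1)] supp[OF t2] in auto)
      moreover have "e / C\<^sup>2 * (C * \<bar>t\<bar>)\<^sup>2 = e * t\<^sup>2" using C(1) by (simp add: power_mult_distrib)
      moreover have "integral K (\<lambda>x. area_integrand (jacobian f x)) = integral K (J 0)"
        by (rule integral_cong) (simp add: J0)
      ultimately show "integral K (J t) \<ge> integral K (J 0) - e * t\<^sup>2" by simp
    qed
  qed
  have "0 \<le> integral K (J'' 0)"
    by (rule second_derivative_nonneg_of_quadratic_lower_bound[OF \<epsilon>1(1) vol' vol'' low])
  moreover have "\<forall>\<^sub>F t in nhds 0. ((\<lambda>s. volume K (F s)) has_real_derivative integral K (J' t)) (at t)"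
    unfolding volJ eventually_nhds_metric using vol' \<epsilon>1(1) by (auto simp: dist_real_def)
  ultimately show "\<exists>vol' D. (\<forall>\<^sub>F t in nhds 0. ((\<lambda>s. volume K (F s)) has_real_derivative vol' t) (at t)) \<and>
      (vol' has_real_derivative D) (at 0) \<and> 0 \<le> D"
    using vol'' by (intro exI[of _ "\<lambda>t. integral K (J' t)"] exI[of _ "integral K (J'' 0)"]) blast
qed

end
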